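(* Let $\epsilon>0$ be a constant and let $p=\frac{1+\epsilon}{d}$. Then with high probability (i.e. with probability tending to one as $d\to\infty$) $Q^d_p$ contains a $K_t$-minor with $t=\Omega\left(\frac{2^{d/2}}{d^3(\log d)^3}\right)$.
   Context: $Q^d$ denotes the $d$-dimensional hypercube: vertex set $\{0,1\}^d$, two vertices adjacent iff they differ in exactly one coordinate. $Q^d_p$ denotes the random subgraph of $Q^d$ on the same vertex set obtained by retaining each edge of $Q^d$ independently with probability $p$. $K_t$ is the complete graph on $t$ vertices. All asymptotics are as $d\to\infty$; implicit constants may depend on $\epsilon$. *)

theory Defs
  imports "HOL-Analysis.Analysis"
begin

text \<open>The hypercube Q^d: vertices are the subsets of {0..<d} (identified with
  0/1-vectors via indicator functions); two vertices are adjacent iff their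
  symmetric difference has exactly one element (they differ in exactly one coordinate).
  Edges are unordered pairs {u,v}.\<close>

definition cube_verts :: "nat \<Rightarrow> nat set set" where
  "cube_verts d = Pow {..<d}"

definition cube_edges :: "nat \<Rightarrow> nat set set set" where
  "cube_edges d = {{u, v} | u v. u \<in> cube_verts d \<and> v \<in> cube_verts d \<and>
                               card ((u - v) \<union> (v - u)) = 1}"

text \<open>Connectivity of the subgraph induced on S by the edge set E.\<close>

definition induced_connected :: "'a set set \<Rightarrow> 'a set \<Rightarrow> bool" where
  "induced_connected E S \<longleftrightarrow>
     (\<forall>u\<in>S. \<forall>v\<in>S. (u, v) \<in> {(x, y). x \<in> S \<and> y \<in> S \<and> {x, y} \<in> E}\<^sup>*)"

text \<open>The graph (V,E) contains K_t as a minor: there are t pairwise disjoint,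
  nonempty branch sets in V, each inducing a connected subgraph, with an edge
  between any two of them.\<close>

definition has_K_minor :: "'a set \<Rightarrow> 'a set set \<Rightarrow> nat \<Rightarrow> bool" where
  "has_K_minor V E t \<longleftrightarrow>
     (\<exists>B :: nat \<Rightarrow> 'a set.
        (\<forall>i<t. B i \<noteq> {} \<and> B i \<subseteq> V \<and> induced_connected E (B i)) \<and>
        (\<forall>i<t. \<forall>j<t. i \<noteq> j \<longrightarrow> B i \<inter> B j = {}) \<and>
        (\<forall>i<t. \<forall>j<t. i \<noteq> j \<longrightarrow> (\<exists>u\<in>B i. \<exists>v\<in>B j. {u, v} \<in> E)))"

text \<open>Probability that the random subgraph Q^d_p (each edge kept independently
  with probability p) has property P, where P is a property of the retained edge set.\<close>

definition cube_prob :: "nat \<Rightarrow> real \<Rightarrow> (nat set set set \<Rightarrow> bool) \<Rightarrow> real" where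
  "cube_prob d p P =
     (\<Sum>F\<in>{F. F \<subseteq> cube_edges d \<and> P F}.
        p ^ card F * (1 - p) ^ (card (cube_edges d) - card F))"

end

theory Submission
  imports Defs "HOL-Real_Asymp.Real_Asymp"
begin

text \<open>
  The edges are exposed in four independent rounds, a first one with edge probability at least
  \<open>(1 + \<epsilon>/2)/d\<close> and three sprinkling rounds with probability \<open>\<epsilon>/(6d)\<close>.

  In the first round, a branching argument in a subcube of dimension \<open>(1 - 2\<eta>)d\<close> puts a given
  vertex into a component of size \<open>\<Theta>(d)\<close> with constant probability; \<open>\<eta>d\<close> further directions
  raise this size to \<open>\<Theta>(d\<^sup>2)\<close>, and another \<open>\<eta>d\<close> directions supply independent trials, so that all but few
  vertices have \<open>\<Omega>(d)\<close> cube neighbours in components with at least \<open>C d\<close> vertices.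

  Fix a set \<open>S\<close> of at most \<open>2\<^sup>d/(2 d\<^sup>2 ln\<^sup>2 d)\<close> vertices and a bipartition of the large components left
  after deleting \<open>S\<close>. By edge isoperimetry there are \<open>\<Omega>(2\<^sup>d)\<close> cube edges \<open>xy\<close> such that \<open>x\<close> has
  \<open>\<Omega>(d)\<close> neighbours on one side and \<open>y\<close> on the other, and the sprinkling joins the sides through none of
  them with probability at most \<open>exp (- \<Omega>(2\<^sup>d/d))\<close>. This beats the number of choices of \<open>S\<close> and of the
  bipartition, which is at most \<open>2 ^ (2\<^sup>d/(C d))\<close> for the latter. Hence no such \<open>S\<close> separates
  the large components evenly, and the Plotkin--Rao--Smith argument, which produces either a complete
  minor or a small separator, yields the minor.
\<close>

section \<open>Random subsets of a finite set\<close>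

text \<open>The orders of magnitude are governed by the union bound. A pair \<open>xy\<close> joins
  the two sides if \<open>x\<close> has a sprinkled edge into one side, \<open>y\<close> has one
  into the other, and \<open>xy\<close> itself is sprinkled. The attachments have constant
  probability, the middle edge has probability of order 1/d: hence three rounds, one per edge, and
  the rate 2^d/d. The bipartitions stay below this rate only if components have C d vertices with C
  large in terms of \<epsilon>; branching alone yields a small multiple of d, whence the passage to
  order d^2. Each first-round edge at a deleted vertex can leave behind one remnant of fewer than C
  d vertices. Nearly all vertices have fewer than 5 ln d such edges, and each vertex lost costs O(d)
  cross pairs. With the stated bound on \<open>S\<close> the loss is of order 2^d / ln d, while the
  choices of \<open>S\<close> number only exp (O(2^d / (d^2 ln d))). In the separator argument, with
  l = 4 d^2 ln^2 d, half of the allowance for \<open>S\<close> pays for thin layers, and the rest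
  leaves room for t^2 connecting paths of O(l d) vertices.\<close>

definition rand_exp :: "'e set \<Rightarrow> real \<Rightarrow> ('e set \<Rightarrow> real) \<Rightarrow> real" where
  "rand_exp E p f = (\<Sum>F\<in>Pow E. p ^ card F * (1 - p) ^ (card E - card F) * f F)"

definition rand_prob :: "'e set \<Rightarrow> real \<Rightarrow> ('e set \<Rightarrow> bool) \<Rightarrow> real" where
  "rand_prob E p P = rand_exp E p (\<lambda>F. of_bool (P F))"

lemma rand_exp_empty [simp]: "rand_exp {} p f = f {}"
  by (simp add: rand_exp_def)

text \<open>Conditioning on a single element. Expectations being finite sums, this recursion yields
  the product formula, the union of rounds and the binomial generating function by induction on the
  ground set.\<close>

lemma rand_exp_insert:
  assumes "finite E" "e \<notin> E"
  shows "rand_exp (insert e E) p f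
           = (1 - p) * rand_exp E p f + p * rand_exp E p (\<lambda>F. f (insert e F))"
proof -
  have inj: "inj_on (insert e) (Pow E)"
    using assms by (intro inj_onI) (metis Pow_iff insert_ident subsetD)
  have disj: "Pow E \<inter> insert e ` Pow E = {}"
    using assms by auto
  have fin: "finite F" "e \<notin> F" "card F \<le> card E" if "F \<in> Pow E" for F
    using that assms by (auto intro: finite_subset card_mono)
  have "rand_exp (insert e E) p f
      = (\<Sum>F\<in>Pow E. p ^ card F * (1 - p) ^ (Suc (card E) - card F) * f F)
      + (\<Sum>F\<in>Pow E. p ^ card (insert e F) * (1 - p) ^ (Suc (card E) - card (insert e F)) * f (insert e F))"
    unfolding rand_exp_def Pow_insert using assms disj
    by (simp add: sum.union_disjoint sum.reindex[OF inj] o_def)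
  also have "(\<Sum>F\<in>Pow E. p ^ card F * (1 - p) ^ (Suc (card E) - card F) * f F) = (1 - p) * rand_exp E p f"
    unfolding rand_exp_def sum_distrib_left
    by (intro sum.cong refl) (use fin in \<open>simp add: Suc_diff_le\<close>)
  also have "(\<Sum>F\<in>Pow E. p ^ card (insert e F) * (1 - p) ^ (Suc (card E) - card (insert e F)) * f (insert e F))
      = p * rand_exp E p (\<lambda>F. f (insert e F))"
    unfolding rand_exp_def sum_distrib_left
    by (intro sum.cong refl) (use fin in simp)
  finally show ?thesis .
qed

lemma rand_exp_cong:
  assumes "\<And>F. F \<subseteq> E \<Longrightarrow> f F = g F"
  shows "rand_exp E p f = rand_exp E p g"
  unfolding rand_exp_def by (intro sum.cong) (use assms in auto)

lemma rand_prob_cong: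
  assumes "\<And>F. F \<subseteq> E \<Longrightarrow> P F \<longleftrightarrow> Q F"
  shows "rand_prob E p P = rand_prob E p Q"
  unfolding rand_prob_def by (intro rand_exp_cong) (use assms in auto)

lemma rand_exp_add: "rand_exp E p (\<lambda>F. f F + g F) = rand_exp E p f + rand_exp E p g"
  by (simp add: rand_exp_def sum.distrib algebra_simps)

lemma rand_exp_sum: "rand_exp E p (\<lambda>F. \<Sum>i\<in>I. f i F) = (\<Sum>i\<in>I. rand_exp E p (f i))"
  unfolding rand_exp_def sum_distrib_left by (rule sum.swap)

lemma rand_exp_cmult: "rand_exp E p (\<lambda>F. c * f F) = c * rand_exp E p f"
  unfolding rand_exp_def sum_distrib_left by (intro sum.cong) auto

lemma rand_exp_multc: "rand_exp E p (\<lambda>F. f F * c) = rand_exp E p f * c"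
  unfolding rand_exp_def sum_distrib_right by (intro sum.cong) auto

lemma rand_exp_const [simp]:
  assumes "finite E"
  shows "rand_exp E p (\<lambda>F. c) = c"
  using assms by (induction E) (auto simp: rand_exp_insert algebra_simps)

lemma rand_exp_mono:
  assumes "0 \<le> p" "p \<le> 1" "\<And>F. F \<subseteq> E \<Longrightarrow> f F \<le> g F"
  shows "rand_exp E p f \<le> rand_exp E p g"
  unfolding rand_exp_def using assms by (intro sum_mono mult_left_mono) auto

lemma rand_exp_nonneg:
  assumes "0 \<le> p" "p \<le> 1" "\<And>F. F \<subseteq> E \<Longrightarrow> 0 \<le> f F"
  shows "0 \<le> rand_exp E p f"
  unfolding rand_exp_def using assms by (intro sum_nonneg mult_nonneg_nonneg) auto

lemma rand_prob_mono:
  assumes "0 \<le> p" "p \<le> 1" "\<And>F. F \<subseteq> E \<Longrightarrow> P F \<Longrightarrow> Q F"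
  shows "rand_prob E p P \<le> rand_prob E p Q"
  unfolding rand_prob_def using assms by (intro rand_exp_mono) auto

lemma rand_prob_nonneg:
  assumes "0 \<le> p" "p \<le> 1"
  shows "0 \<le> rand_prob E p P"
  unfolding rand_prob_def using assms by (intro rand_exp_nonneg) auto

lemma rand_prob_le_1:
  assumes "finite E" "0 \<le> p" "p \<le> 1"
  shows "rand_prob E p P \<le> 1"
proof -
  have "rand_prob E p P \<le> rand_exp E p (\<lambda>F. 1)"
    unfolding rand_prob_def using assms by (intro rand_exp_mono) auto
  then show ?thesis using assms by simp
qed

lemma rand_prob_not:
  assumes "finite E"
  shows "rand_prob E p (\<lambda>F. \<not> P F) = 1 - rand_prob E p P"
proof -
  have "rand_prob E p (\<lambda>F. \<not> P F) + rand_prob E p P = rand_exp E p (\<lambda>F. 1)"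
    unfolding rand_prob_def rand_exp_add[symmetric] by (intro rand_exp_cong) auto
  then show ?thesis using assms by simp
qed

lemma rand_prob_le_sum:
  assumes "0 \<le> p" "p \<le> 1" "finite I"
    and "\<And>F. F \<subseteq> E \<Longrightarrow> P F \<Longrightarrow> \<exists>i\<in>I. Q i F"
  shows "rand_prob E p P \<le> (\<Sum>i\<in>I. rand_prob E p (Q i))"
proof -
  have "rand_prob E p P \<le> rand_exp E p (\<lambda>F. \<Sum>i\<in>I. of_bool (Q i F))"
    unfolding rand_prob_def
  proof (intro rand_exp_mono assms)
    fix F assume F: "F \<subseteq> E"
    show "of_bool (P F) \<le> (\<Sum>i\<in>I. of_bool (Q i F) :: real)"
    proof (cases "P F")
      case True
      then obtain i where "i \<in> I" "Q i F" using assms(4) F by blast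
      then have "of_bool (Q i F) \<le> (\<Sum>i\<in>I. of_bool (Q i F) :: real)"
        using assms(3) by (intro member_le_sum) auto
      then show ?thesis using \<open>Q i F\<close> True by simp
    qed (simp add: sum_nonneg)
  qed
  then show ?thesis by (simp add: rand_exp_sum rand_prob_def)
qed

lemma rand_prob_disj_le:
  assumes "0 \<le> p" "p \<le> 1"
  shows "rand_prob E p (\<lambda>F. P F \<or> Q F) \<le> rand_prob E p P + rand_prob E p Q"
  unfolding rand_prob_def rand_exp_add[symmetric] using assms by (intro rand_exp_mono) auto

lemma rand_prob_markov:
  assumes "0 \<le> p" "p \<le> 1" "a > 0" "\<And>F. F \<subseteq> E \<Longrightarrow> 0 \<le> f F"
  shows "rand_prob E p (\<lambda>F. f F \<ge> a) \<le> rand_exp E p f / a"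
proof -
  have "rand_prob E p (\<lambda>F. f F \<ge> a) \<le> rand_exp E p (\<lambda>F. f F * (1 / a))"
    unfolding rand_prob_def using assms by (intro rand_exp_mono) (auto simp: field_simps)
  then show ?thesis by (simp only: rand_exp_multc) simp
qed

section \<open>Independence of disjoint edge sets and of exposure rounds\<close>

lemma rand_exp_Un:
  assumes "finite A" "finite B" "A \<inter> B = {}"
  shows "rand_exp (A \<union> B) p f = rand_exp A p (\<lambda>F. rand_exp B p (\<lambda>F'. f (F \<union> F')))"
  using assms
proof (induction A arbitrary: f)
  case (insert e A)
  have "rand_exp (insert e A \<union> B) p f = (1 - p) * rand_exp (A \<union> B) p f
      + p * rand_exp (A \<union> B) p (\<lambda>F. f (insert e F))"
    using insert by (simp add: rand_exp_insert)
  then show ?case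
    using insert by (simp add: rand_exp_insert)
qed simp

lemma rand_exp_split:
  assumes "finite E" "D \<subseteq> E"
  shows "rand_exp E p f = rand_exp D p (\<lambda>F. rand_exp (E - D) p (\<lambda>F'. f (F \<union> F')))"
proof -
  have "E = D \<union> (E - D)" using assms by auto
  then show ?thesis
    using rand_exp_Un[of D "E - D" p f] assms by (metis Diff_disjoint finite_Diff finite_subset)
qed

lemma rand_exp_restrict:
  assumes "finite E" "D \<subseteq> E" "\<And>F. F \<subseteq> E \<Longrightarrow> f F = g (F \<inter> D)"
  shows "rand_exp E p f = rand_exp D p g"
proof -
  have "rand_exp E p f = rand_exp D p (\<lambda>F. rand_exp (E - D) p (\<lambda>F'. f (F \<union> F')))"
    using assms by (intro rand_exp_split)
  also have "\<dots> = rand_exp D p (\<lambda>F. rand_exp (E - D) p (\<lambda>F'. g F))"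
  proof (intro rand_exp_cong)
    fix F F' assume F: "F \<subseteq> D" and F': "F' \<subseteq> E - D"
    have "(F \<union> F') \<inter> D = F" "F \<union> F' \<subseteq> E" using F F' assms by auto
    then show "f (F \<union> F') = g F" using assms(3) by metis
  qed
  also have "\<dots> = rand_exp D p g" using assms by simp
  finally show ?thesis .
qed

lemma rand_prob_restrict:
  assumes "finite E" "D \<subseteq> E" "\<And>F. F \<subseteq> E \<Longrightarrow> P F \<longleftrightarrow> Q (F \<inter> D)"
  shows "rand_prob E p P = rand_prob D p Q"
  unfolding rand_prob_def using assms by (intro rand_exp_restrict) auto

lemma rand_exp_prod:
  assumes "finite I" "finite E" "\<And>i. i \<in> I \<Longrightarrow> D i \<subseteq> E" "disjoint_family_on D I"
    and "\<And>i F. i \<in> I \<Longrightarrow> F \<subseteq> E \<Longrightarrow> f i F = f i (F \<inter> D i)"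
  shows "rand_exp E p (\<lambda>F. \<Prod>i\<in>I. f i F) = (\<Prod>i\<in>I. rand_exp (D i) p (f i))"
  using assms
proof (induction I arbitrary: E)
  case (insert i I)
  have disj: "D j \<inter> D i = {}" if "j \<in> I" for j
    using insert.prems(3) insert.hyps(2) that unfolding disjoint_family_on_def by auto
  have Di: "D i \<subseteq> E" using insert.prems by auto
  have "rand_exp E p (\<lambda>F. \<Prod>j\<in>insert i I. f j F)
      = rand_exp (D i) p (\<lambda>F. rand_exp (E - D i) p (\<lambda>F'. \<Prod>j\<in>insert i I. f j (F \<union> F')))"
    using insert.prems by (intro rand_exp_split) auto
  also have "\<dots> = rand_exp (D i) p (\<lambda>F. rand_exp (E - D i) p (\<lambda>F'. f i F * (\<Prod>j\<in>I. f j F')))"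
  proof (intro rand_exp_cong)
    fix F F' assume F: "F \<subseteq> D i" and F': "F' \<subseteq> E - D i"
    have 1: "F \<union> F' \<subseteq> E" "F' \<subseteq> E" "F \<subseteq> E" using F F' Di by auto
    have "(F \<union> F') \<inter> D i = F \<inter> D i" using F' by auto
    then have "f i (F \<union> F') = f i F" using insert.prems(4) 1 by (metis insertI1)
    moreover have "f j (F \<union> F') = f j F'" if "j \<in> I" for j
    proof -
      have "(F \<union> F') \<inter> D j = F' \<inter> D j" using F disj[OF that] by auto
      then show ?thesis using insert.prems(4) 1 that by (metis insertI2)
    qed
    ultimately show "(\<Prod>j\<in>insert i I. f j (F \<union> F')) = f i F * (\<Prod>j\<in>I. f j F')"
      using insert.hyps by simp
  qed
  also have "\<dots> = rand_exp (D i) p (f i) * rand_exp (E - D i) p (\<lambda>F'. \<Prod>j\<in>I. f j F')"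
    by (simp add: rand_exp_cmult rand_exp_multc)
  also have "rand_exp (E - D i) p (\<lambda>F'. \<Prod>j\<in>I. f j F') = (\<Prod>j\<in>I. rand_exp (D j) p (f j))"
  proof (intro insert.IH)
    show "disjoint_family_on D I"
      using insert.prems(3) by (auto simp: disjoint_family_on_def)
    show "D j \<subseteq> E - D i" if "j \<in> I" for j using insert.prems(2) disj that by blast
    show "f j F = f j (F \<inter> D j)" if "j \<in> I" "F \<subseteq> E - D i" for j F
    proof (rule insert.prems(4)) qed (use that in auto)
  qed (use insert.prems in auto)
  finally show ?case using insert.hyps by simp
qed simp

text \<open>The probability generating function of a binomial variable. It is evaluated at 0 for
  missing a set, at \<rho> for extinction and at \<open>exp 1\<close> for the degree tail.\<close>

lemma rand_exp_card:
  assumes "finite E" "D \<subseteq> E"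
  shows "rand_exp E p (\<lambda>F. c ^ card (F \<inter> D)) = (1 - p + p * c) ^ card D"
proof -
  have fin: "finite D" using assms finite_subset by blast
  have "rand_exp E p (\<lambda>F. c ^ card (F \<inter> D)) = rand_exp D p (\<lambda>F. c ^ card F)"
    using assms by (intro rand_exp_restrict) auto
  also have "\<dots> = (1 - p + p * c) ^ card D"
    using fin
  proof (induction D)
    case (insert e D)
    have "rand_exp (insert e D) p (\<lambda>F. c ^ card F)
        = (1 - p) * rand_exp D p (\<lambda>F. c ^ card F) + p * rand_exp D p (\<lambda>F. c ^ card (insert e F))"
      using insert by (simp add: rand_exp_insert)
    also have "rand_exp D p (\<lambda>F. c ^ card (insert e F)) = rand_exp D p (\<lambda>F. c * c ^ card F)"
    proof (intro rand_exp_cong)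
      fix F assume "F \<subseteq> D"
      then have "finite F" "e \<notin> F" using insert finite_subset by auto
      then show "c ^ card (insert e F) = c * c ^ card F" by simp
    qed
    finally show ?case using insert by (simp add: rand_exp_cmult algebra_simps)
  qed simp
  finally show ?thesis .
qed

lemma rand_prob_disjoint:
  assumes "finite E" "D \<subseteq> E"
  shows "rand_prob E p (\<lambda>F. F \<inter> D = {}) = (1 - p) ^ card D"
proof -
  have fin: "finite (F \<inter> D)" for F using assms by (meson finite_Int finite_subset)
  \<comment> \<open>Since \<open>0 ^ 0 = 1\<close>, this power of 0 is the indicator of an empty
    intersection.\<close>
  have "rand_prob E p (\<lambda>F. F \<inter> D = {}) = rand_exp E p (\<lambda>F. 0 ^ card (F \<inter> D))"
    unfolding rand_prob_def using fin by (intro rand_exp_cong) (auto simp: power_0_left)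
  then show ?thesis using rand_exp_card[OF assms, of p 0] by simp
qed

text \<open>An edge is absent from the union of two independent rounds exactly when both miss it,
  which has probability \<open>(1 - p) * (1 - q)\<close>.\<close>

lemma rand_exp_sprinkle:
  assumes "finite E"
  shows "rand_exp E (1 - (1 - p) * (1 - q)) f = rand_exp E p (\<lambda>F. rand_exp E q (\<lambda>F'. f (F \<union> F')))"
  using assms
proof (induction E arbitrary: f)
  case (insert e E)
  have ring: "(1 - q) * ((1 - p) * a + p * b) + q * ((1 - p) * b + p * b)
      = (1 - p) * ((1 - q) * a + q * b) + p * ((1 - q) * b + q * b)" for a b :: real
    by algebra
  have "rand_exp (insert e E) p (\<lambda>F. rand_exp (insert e E) q (\<lambda>F'. f (F \<union> F')))
    = (1 - p) * ((1 - q) * rand_exp E p (\<lambda>F. rand_exp E q (\<lambda>F'. f (F \<union> F')))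
        + q * rand_exp E p (\<lambda>F. rand_exp E q (\<lambda>F'. f (insert e (F \<union> F')))))
    + p * ((1 - q) * rand_exp E p (\<lambda>F. rand_exp E q (\<lambda>F'. f (insert e (F \<union> F'))))
        + q * rand_exp E p (\<lambda>F. rand_exp E q (\<lambda>F'. f (insert e (F \<union> F')))))"
    using insert.hyps by (simp add: rand_exp_insert rand_exp_add rand_exp_cmult, intro ring)
  then show ?case
    using insert by (simp add: rand_exp_insert algebra_simps)
qed simp

text \<open>The rounds stay separate because a connecting path has three edges, each of which is
  looked for in a round of its own.\<close>

definition triple_prob :: "'e set \<Rightarrow> real \<Rightarrow> ('e set \<Rightarrow> 'e set \<Rightarrow> 'e set \<Rightarrow> bool) \<Rightarrow> real" where
  "triple_prob E p P = rand_exp E p (\<lambda>F1. rand_exp E p (\<lambda>F2. rand_prob E p (P F1 F2)))"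

lemma triple_prob_le_1:
  assumes "finite E" "0 \<le> p" "p \<le> 1"
  shows "triple_prob E p P \<le> 1"
proof -
  have "triple_prob E p P \<le> rand_exp E p (\<lambda>F1. rand_exp E p (\<lambda>F2. 1))"
    unfolding triple_prob_def using assms by (intro rand_exp_mono rand_prob_le_1)
  then show ?thesis using assms by simp
qed

lemma triple_prob_mono:
  assumes "0 \<le> p" "p \<le> 1" "\<And>F1 F2 F3. P F1 F2 F3 \<Longrightarrow> Q F1 F2 F3"
  shows "triple_prob E p P \<le> triple_prob E p Q"
  unfolding triple_prob_def using assms by (intro rand_exp_mono rand_prob_mono)

lemma triple_prob_union_bound:
  assumes p: "0 \<le> p" "p \<le> 1" and I: "finite I"
    and cover: "\<And>F1 F2 F3. P F1 F2 F3 \<Longrightarrow> \<exists>i\<in>I. Q i F1 F2 F3"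
    and b: "\<And>i. i \<in> I \<Longrightarrow> triple_prob E p (Q i) \<le> b"
  shows "triple_prob E p P \<le> real (card I) * b"
proof -
  have "triple_prob E p P \<le> rand_exp E p (\<lambda>F1. rand_exp E p (\<lambda>F2. \<Sum>i\<in>I. rand_prob E p (Q i F1 F2)))"
    unfolding triple_prob_def using cover by (intro rand_exp_mono rand_prob_le_sum p I)
  also have "\<dots> = (\<Sum>i\<in>I. triple_prob E p (Q i))"
    by (simp add: rand_exp_sum triple_prob_def)
  also have "\<dots> \<le> (\<Sum>i\<in>I. b)" by (intro sum_mono b)
  finally show ?thesis by simp
qed

text \<open>The exponential moment is taken at parameter \<open>1/b\<close>, where \<open>1 - exp (-x) \<ge> x/2\<close> linearises it.\<close>

lemma rand_prob_lower_tail: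
  fixes w :: "'i \<Rightarrow> real"
  assumes "finite I" "finite E" "\<And>i. i \<in> I \<Longrightarrow> D i \<subseteq> E" "disjoint_family_on D I"
    and dep: "\<And>i F. i \<in> I \<Longrightarrow> F \<subseteq> E \<Longrightarrow> Y i F \<longleftrightarrow> Y i (F \<inter> D i)"
    and p: "0 \<le> p" "p \<le> 1"
    and q: "\<And>i. i \<in> I \<Longrightarrow> q \<le> rand_prob (D i) p (Y i)"
    and w: "\<And>i. i \<in> I \<Longrightarrow> 0 \<le> w i" "\<And>i. i \<in> I \<Longrightarrow> w i \<le> b" and b: "b > 0"
  shows "rand_prob E p (\<lambda>F. (\<Sum>i\<in>I. w i * of_bool (Y i F)) \<le> q / 4 * sum w I)
           \<le> exp (- (q * sum w I / (4 * b)))"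
proof -
  define f where "f i F = exp (- (w i / b * of_bool (Y i F)))" for i F
  have f: "rand_exp (D i) p (f i) \<le> exp (- (q * w i / (2 * b)))" if i: "i \<in> I" for i
  proof -
    have fin: "finite (D i)" using assms i by (meson finite_subset)
    define z where "z = w i / b"
    have z: "0 \<le> z" "z \<le> 1" using w[OF i] b by (auto simp: z_def)
    \<comment> \<open>The product is \<open>1 + (z - z * z) / 2\<close>, and
      \<open>z * z \<le> z\<close> on the unit interval.\<close>
    have "1 \<le> (1 - z / 2) * (1 + z)"
      using z mult_left_mono[of z 1 z] by (simp add: algebra_simps)
    also have "\<dots> \<le> (1 - z / 2) * exp z"
      using z exp_ge_add_one_self[of z] by (intro mult_left_mono) auto
    finally have "exp (-z) \<le> 1 - z / 2"
      by (simp add: exp_minus field_simps)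
    define r where "r = rand_prob (D i) p (Y i)"
    have r: "q \<le> r" "0 \<le> r" using q[OF i] rand_prob_nonneg[OF p] by (auto simp: r_def)
    have "rand_exp (D i) p (f i) = rand_exp (D i) p (\<lambda>F. 1 + (exp (-z) - 1) * of_bool (Y i F))"
      by (intro rand_exp_cong) (auto simp: f_def z_def)
    also have "\<dots> = 1 + (exp (-z) - 1) * r"
      using fin by (simp add: rand_exp_add rand_exp_cmult r_def rand_prob_def)
    also have "\<dots> \<le> 1 - z / 2 * r"
      using mult_right_mono[OF \<open>exp (-z) \<le> 1 - z / 2\<close> r(2)] by (simp add: algebra_simps)
    also have "\<dots> \<le> 1 - z / 2 * q"
      using mult_left_mono[OF r(1), of "z / 2"] z by simp
    also have "\<dots> \<le> exp (- (z / 2 * q))"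
      using exp_ge_add_one_self[of "- (z / 2 * q)"] by simp
    finally show ?thesis by (simp add: z_def algebra_simps)
  qed
  have pos: "0 \<le> rand_exp (D i) p (f i)" for i
    by (intro rand_exp_nonneg p) (simp add: f_def)
  have prod_f: "(\<Prod>i\<in>I. f i F) = exp (- ((\<Sum>i\<in>I. w i * of_bool (Y i F)) / b))" for F
    unfolding f_def sum_divide_distrib using assms(1)
    by (simp add: exp_sum[symmetric] sum_negf[symmetric])
  have "rand_prob E p (\<lambda>F. (\<Sum>i\<in>I. w i * of_bool (Y i F)) \<le> q / 4 * sum w I)
      \<le> rand_prob E p (\<lambda>F. (\<Prod>i\<in>I. f i F) \<ge> exp (- (q / 4 * sum w I / b)))"
  proof (intro rand_prob_mono p)
    fix F assume "(\<Sum>i\<in>I. w i * of_bool (Y i F)) \<le> q / 4 * sum w I"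
    then have "(\<Sum>i\<in>I. w i * of_bool (Y i F)) / b \<le> q / 4 * sum w I / b"
      using b by (intro divide_right_mono) auto
    then show "exp (- (q / 4 * sum w I / b)) \<le> (\<Prod>i\<in>I. f i F)"
      unfolding prod_f by simp
  qed
  also have "\<dots> \<le> rand_exp E p (\<lambda>F. \<Prod>i\<in>I. f i F) / exp (- (q / 4 * sum w I / b))"
    by (intro rand_prob_markov p) (auto simp: f_def intro!: prod_nonneg)
  also have "rand_exp E p (\<lambda>F. \<Prod>i\<in>I. f i F) = (\<Prod>i\<in>I. rand_exp (D i) p (f i))"
  proof (rule rand_exp_prod[OF assms(1-4)])
    show "f i F = f i (F \<inter> D i)" if "i \<in> I" "F \<subseteq> E" for i F
      using dep[OF that] by (simp add: f_def)
  qed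
  also have "\<dots> \<le> (\<Prod>i\<in>I. exp (- (q * w i / (2 * b))))"
    by (intro prod_mono conjI f pos)
  also have "\<dots> = exp (- (q * sum w I / (2 * b)))"
    using assms(1) by (simp add: exp_sum[symmetric] sum_negf sum_distrib_left sum_divide_distrib)
  \<comment> \<open>The moment bound gives the rate \<open>q / (2 * b)\<close>; the threshold
    \<open>q / 4\<close> gives back half of it.\<close>
  also have "exp (- (q * sum w I / (2 * b))) / exp (- (q / 4 * sum w I / b)) = exp (- (q * sum w I / (4 * b)))"
    by (simp add: exp_diff[symmetric] field_simps)
  finally show ?thesis by (simp add: divide_right_mono)
qed

section \<open>Complete minors in graphs without sparse separators\<close>

lemma induced_connected_singleton: "induced_connected E {x}"
  by (auto simp: induced_connected_def)

lemma induced_connected_UN: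
  assumes "\<And>i. i \<in> I \<Longrightarrow> induced_connected E (P i)" "\<And>i. i \<in> I \<Longrightarrow> x \<in> P i"
  shows "induced_connected E (\<Union>i\<in>I. P i)"
proof -
  let ?r = "\<lambda>S. {(x, y). x \<in> S \<and> y \<in> S \<and> {x, y} \<in> E}"
  have "(u, x) \<in> (?r (\<Union>i\<in>I. P i))\<^sup>* \<and> (x, u) \<in> (?r (\<Union>i\<in>I. P i))\<^sup>*" if u: "u \<in> (\<Union>i\<in>I. P i)" for u
  proof -
    obtain i where i: "i \<in> I" "u \<in> P i" using u by auto
    have "?r (P i) \<subseteq> ?r (\<Union>i\<in>I. P i)" using i by auto
    then have "(?r (P i))\<^sup>* \<subseteq> (?r (\<Union>i\<in>I. P i))\<^sup>*" by (rule rtrancl_mono)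
    moreover have "(u, x) \<in> (?r (P i))\<^sup>*" "(x, u) \<in> (?r (P i))\<^sup>*"
      using assms i unfolding induced_connected_def by blast+
    ultimately show ?thesis by blast
  qed
  then show ?thesis
    unfolding induced_connected_def by (meson rtrancl_trans)
qed

lemma induced_connected_Un:
  assumes "induced_connected E A" "induced_connected E B" "x \<in> A" "x \<in> B"
  shows "induced_connected E (A \<union> B)"
  using induced_connected_UN[of "{A, B}" E "\<lambda>X. X" x] assms by auto

lemma induced_connected_insert:
  assumes "induced_connected E A" "x \<in> A" "{x, y} \<in> E"
  shows "induced_connected E (insert y A)"
proof -
  have "{y, x} \<in> E" using assms(3) by (simp add: insert_commute)
  then have "induced_connected E {x, y}"
    using assms(3) unfolding induced_connected_def by (auto intro!: r_into_rtrancl)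
  then have "induced_connected E (A \<union> {x, y})"
    by (rule induced_connected_Un[OF assms(1)]) (use assms in auto)
  moreover have "A \<union> {x, y} = insert y A" using assms(2) by auto
  ultimately show ?thesis by simp
qed

primrec graph_ball :: "'a set set \<Rightarrow> 'a set \<Rightarrow> 'a \<Rightarrow> nat \<Rightarrow> 'a set" where
  "graph_ball E W x 0 = {x}"
| "graph_ball E W x (Suc i) = graph_ball E W x i \<union> {y \<in> W. \<exists>z\<in>graph_ball E W x i. {z, y} \<in> E}"

lemma graph_ball_subset: "x \<in> W \<Longrightarrow> graph_ball E W x i \<subseteq> W"
  by (induction i) auto

lemma graph_ball_mono: "i \<le> j \<Longrightarrow> graph_ball E W x i \<subseteq> graph_ball E W x j"
  by (induction rule: dec_induct) auto

lemma center_in_graph_ball: "x \<in> graph_ball E W x i"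
  using graph_ball_mono[of 0 i E W x] by auto

text \<open>\<open>P\<close> is the vertex set of a path of length at most \<open>i\<close>, hence
  the bound \<open>Suc i\<close>. Only connectedness and size are recorded, since \<open>P\<close>
  will be a piece of a branch set.\<close>

lemma graph_ball_path:
  assumes "x \<in> W" "y \<in> graph_ball E W x i"
  shows "\<exists>P. P \<subseteq> W \<and> finite P \<and> induced_connected E P \<and> x \<in> P \<and> y \<in> P \<and> card P \<le> Suc i"
  using assms
proof (induction i arbitrary: y)
  case 0
  then show ?case
    by (intro exI[of _ "{x}"]) (auto simp: induced_connected_singleton)
next
  case (Suc i)
  show ?case
  proof (cases "y \<in> graph_ball E W x i")
    case True
    then show ?thesis using Suc by (meson le_SucI)
  next
    case False
    then obtain z where z: "z \<in> graph_ball E W x i" "{z, y} \<in> E" "y \<in> W"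
      using Suc.prems by auto
    then obtain P where P: "P \<subseteq> W" "finite P" "induced_connected E P" "x \<in> P" "z \<in> P" "card P \<le> Suc i"
      using Suc by meson
    show ?thesis
      using P z induced_connected_insert[OF P(3,5) z(2)]
      by (intro exI[of _ "insert y P"]) (auto simp: card_insert_if)
  qed
qed

declare graph_ball.simps(2) [simp del]

text \<open>Otherwise each of the \<open>r\<close> steps enlarges the ball by a factor above
  \<open>1 + 1 / l\<close>, and it outgrows \<open>W\<close>.\<close>

lemma graph_ball_thin_layer:
  fixes l r :: nat
  assumes "finite W" "x \<in> W" "l > 0" "real (card W) < (1 + 1 / real l) ^ r"
  shows "\<exists>i<r. l * card (graph_ball E W x (Suc i) - graph_ball E W x i) \<le> card (graph_ball E W x i)"
proof (rule ccontr)
  let ?B = "graph_ball E W x"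
  assume "\<not> ?thesis"
  then have thick: "card (?B i) < l * card (?B (Suc i) - ?B i)" if "i < r" for i
    using that by force
  have fin: "finite (?B i)" for i
    using graph_ball_subset[OF assms(2)] assms(1) finite_subset by blast
  have "(1 + 1 / real l) ^ i \<le> real (card (?B i))" if "i \<le> r" for i
    using that
  proof (induction i)
    case (Suc i)
    have "card (?B (Suc i)) = card (?B i) + card (?B (Suc i) - ?B i)"
      using fin graph_ball_mono[of i "Suc i" E W x]
      by (metis card_Un_disjoint Diff_disjoint Diff_partition finite_Diff le_SucI order_refl)
    moreover have "real (card (?B i)) / real l \<le> real (card (?B (Suc i) - ?B i))"
    proof -
      have "real (card (?B i)) \<le> real (l * card (?B (Suc i) - ?B i))"
        using thick[of i] Suc.prems by (intro of_nat_mono) linarith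
      then show ?thesis using assms(3) by (simp add: divide_le_eq mult.commute)
    qed
    ultimately have "(1 + 1 / real l) * real (card (?B i)) \<le> real (card (?B (Suc i)))"
      by (simp add: algebra_simps)
    moreover have "(1 + 1 / real l) * (1 + 1 / real l) ^ i \<le> (1 + 1 / real l) * real (card (?B i))"
      using Suc by (intro mult_left_mono) auto
    ultimately show ?case by simp
  qed simp
  from this[of r] assms(4) have "real (card W) < real (card (?B r))" by linarith
  then have "card W < card (?B r)" by simp
  then show False
    using card_mono[OF assms(1) graph_ball_subset[OF assms(2)]] by (metis leD)
qed

text \<open>An intermediate state of the Plotkin--Rao--Smith procedure: \<open>R\<close> is the part that has been
  cut off, \<open>S\<close> the separator paid for so far, \<open>Bs\<close> the current branch sets and \<open>W\<close> the unexplored rest.\<close>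

definition minor_state ::
  "'a set \<Rightarrow> 'a set set \<Rightarrow> 'a set \<Rightarrow> nat \<Rightarrow> nat \<Rightarrow> nat \<Rightarrow> nat \<Rightarrow> 'a set \<Rightarrow> 'a set \<Rightarrow> 'a set set \<Rightarrow> 'a set \<Rightarrow> bool" where
  "minor_state V E U l m t b R S Bs W \<longleftrightarrow>
     R \<union> S \<union> \<Union>Bs \<union> W = V \<and> R \<inter> S = {} \<and> R \<inter> \<Union>Bs = {} \<and> R \<inter> W = {} \<and>
     S \<inter> \<Union>Bs = {} \<and> S \<inter> W = {} \<and> \<Union>Bs \<inter> W = {} \<and>
     (\<forall>x\<in>R. \<forall>y\<in>W. {x, y} \<notin> E) \<and> l * card S \<le> card R \<and>
     card Bs \<le> t \<and>
     (\<forall>A\<in>Bs. A \<noteq> {} \<and> induced_connected E A \<and> card A \<le> b) \<and>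
     (\<forall>A\<in>Bs. \<forall>B\<in>Bs. A \<noteq> B \<longrightarrow> A \<inter> B = {} \<and> (\<exists>u\<in>A. \<exists>v\<in>B. {u, v} \<in> E)) \<and>
     card (U \<inter> R) < m"

lemma minor_state_has_K_minor:
  assumes "minor_state V E U l m t b R S Bs W" "card Bs = t" "finite V"
  shows "has_K_minor V E t"
proof -
  have part: "R \<union> S \<union> \<Union>Bs \<union> W = V"
    and B1: "\<forall>A\<in>Bs. A \<noteq> {} \<and> induced_connected E A \<and> card A \<le> b"
    and B2: "\<forall>A\<in>Bs. \<forall>B\<in>Bs. A \<noteq> B \<longrightarrow> A \<inter> B = {} \<and> (\<exists>u\<in>A. \<exists>v\<in>B. {u, v} \<in> E)"
    using assms(1) unfolding minor_state_def by - (elim conjE, assumption)+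
  have st: "\<Union>Bs \<subseteq> V" "\<And>A. A \<in> Bs \<Longrightarrow> A \<noteq> {} \<and> induced_connected E A"
    "\<And>A B. A \<in> Bs \<Longrightarrow> B \<in> Bs \<Longrightarrow> A \<noteq> B \<Longrightarrow> A \<inter> B = {} \<and> (\<exists>u\<in>A. \<exists>v\<in>B. {u, v} \<in> E)"
    using part B1 B2 by auto
  have "finite Bs" using st(1) assms(3) by (meson finite_UnionD finite_subset)
  then obtain f where f: "bij_betw f {0..<t} Bs"
    using ex_bij_betw_nat_finite[of Bs] assms(2) by auto
  have mem: "f i \<in> Bs" if "i < t" for i
    using f that by (auto simp: bij_betw_def)
  have neq: "f i \<noteq> f j" if "i < t" "j < t" "i \<noteq> j" for i j
    using f that unfolding bij_betw_def inj_on_def by auto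
  show ?thesis
    unfolding has_K_minor_def
  proof (intro exI[of _ f] conjI allI impI)
    fix i j assume "i < t" "j < t" "i \<noteq> j"
    then have "f i \<in> Bs" "f j \<in> Bs" "f i \<noteq> f j" using mem neq by auto
    then have "f i \<inter> f j = {} \<and> (\<exists>u\<in>f i. \<exists>v\<in>f j. {u, v} \<in> E)" by (rule st(3))
    then show "f i \<inter> f j = {}" "\<exists>u\<in>f i. \<exists>v\<in>f j. {u, v} \<in> E" by auto
  next
    fix i assume "i < t"
    then have "f i \<in> Bs" by (rule mem)
    then show "f i \<noteq> {}" "f i \<subseteq> V" "induced_connected E (f i)"
      using st(1,2) by auto
  qed
qed

text \<open>Three moves are possible. A branch set without edges into \<open>W\<close> is thrown
  into \<open>R\<close>. If every branch set has a neighbour in \<open>W\<close> and these terminals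
  are close together, the union of short paths between them is a new branch set. If two terminals
  are far apart, a ball around one of them is cut off along a thin layer: the ball joins
  \<open>R\<close> and the layer joins \<open>S\<close>, which preserves
  \<open>l * card S \<le> card R\<close>. The measure falls in each case, as vertices of
  \<open>W\<close> weigh more than all branch sets together.\<close>

lemma minor_state_step:
  fixes l r m s t :: nat
  assumes fin: "finite V" and UV: "U \<subseteq> V"
    and sep: "\<And>R S W. R \<union> S \<union> W = V \<Longrightarrow> R \<inter> S = {} \<Longrightarrow> R \<inter> W = {} \<Longrightarrow> S \<inter> W = {} \<Longrightarrow>
                \<forall>x\<in>R. \<forall>y\<in>W. {x, y} \<notin> E \<Longrightarrow> card S \<le> s \<Longrightarrow> card (U \<inter> R) < m \<or> card (U \<inter> W) < m"
    and U: "3 * m + 3 * s \<le> card U" and m: "m > 0" and l: "l > 0"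
    and size: "card V + l * (t * (t * (2 * r + 1))) \<le> l * s"
    and growth: "real (card V) < (1 + 1 / real l) ^ r"
    and st: "minor_state V E U l m t (t * (2 * r + 1)) R S Bs W" and "card Bs < t"
  shows "\<exists>R' S' Bs' W'. minor_state V E U l m t (t * (2 * r + 1)) R' S' Bs' W'
           \<and> card W' * Suc t + card Bs' < card W * Suc t + card Bs"
proof -
  let ?link = "\<lambda>u v P. P \<subseteq> W \<and> finite P \<and> induced_connected E P \<and> u \<in> P \<and> v \<in> P"
  let ?b = "t * (2 * r + 1)"
  let ?state = "minor_state V E U l m t ?b"
  have part: "R \<union> S \<union> \<Union>Bs \<union> W = V"
    and disj: "R \<inter> S = {}" "R \<inter> \<Union>Bs = {}" "R \<inter> W = {}" "S \<inter> \<Union>Bs = {}" "S \<inter> W = {}" "\<Union>Bs \<inter> W = {}"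
    and noRW: "\<forall>x\<in>R. \<forall>y\<in>W. {x, y} \<notin> E" and lS: "l * card S \<le> card R"
    and B1: "\<forall>A\<in>Bs. A \<noteq> {} \<and> induced_connected E A \<and> card A \<le> ?b"
    and B2: "\<forall>A\<in>Bs. \<forall>B\<in>Bs. A \<noteq> B \<longrightarrow> A \<inter> B = {} \<and> (\<exists>u\<in>A. \<exists>v\<in>B. {u, v} \<in> E)"
    and UR: "card (U \<inter> R) < m"
    using st unfolding minor_state_def by - (elim conjE, assumption)+
  have fins: "finite R" "finite S" "finite W" "finite (\<Union>Bs)" "finite U"
  proof -
    have "finite (R \<union> S \<union> \<Union>Bs \<union> W)" unfolding part by (rule fin)
    then show "finite R" "finite S" "finite W" "finite (\<Union>Bs)" unfolding finite_Un by blast+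
    show "finite U" using UV fin by (rule finite_subset)
  qed
  have finB: "finite Bs" using fins(4) by (rule finite_UnionD)
  define Y where "Y = \<Union>Bs"
  note dY = disj[folded Y_def] and pY = part[folded Y_def]
  have sizeB: "card (\<Union>\<C>) \<le> t * ?b" if "\<C> \<subseteq> Bs" for \<C>
  proof -
    have "card (\<Union>\<C>) \<le> (\<Sum>A\<in>\<C>. card A)"
      using that finB finite_subset by (intro card_Union_le_sum_card)
    also have "\<dots> \<le> (\<Sum>A\<in>\<C>. ?b)" using that B1 by (intro sum_mono) auto
    also have "\<dots> = card \<C> * ?b" by simp
    also have "\<dots> \<le> t * ?b"
      using card_mono[OF finB that] \<open>card Bs < t\<close> by (intro mult_right_mono) auto
    finally show ?thesis .
  qed
  have sep_size: "card X + t * ?b \<le> s" if "l * card X \<le> card Y" "Y \<subseteq> V" for X Y :: "'a set"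
  proof -
    have "l * card X \<le> card V" using that card_mono[OF fin that(2)] by linarith
    then have "l * (card X + t * ?b) \<le> l * s"
      using size by (simp add: algebra_simps)
    then show ?thesis using l by simp
  qed
  \<comment> \<open>\<open>R\<close> holds fewer than \<open>m\<close> vertices of \<open>U\<close>,
    and \<open>S\<close> with all branch sets at most \<open>s\<close>, so the bulk of
    \<open>U\<close> is in \<open>W\<close>. In every separation below, the part of \<open>W\<close>
    that remains is therefore the heavy side, which forces the other side below
    \<open>m\<close>.\<close>
  have UW: "card U < m + s + card (U \<inter> W)"
  proof -
    have "U = (U \<inter> R) \<union> (U \<inter> (S \<union> \<Union>Bs)) \<union> (U \<inter> W)" using part UV by auto
    then have "card U = card ((U \<inter> R) \<union> (U \<inter> (S \<union> \<Union>Bs)) \<union> (U \<inter> W))" by simp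
    also have "\<dots> \<le> card (U \<inter> R) + card (U \<inter> (S \<union> \<Union>Bs)) + card (U \<inter> W)"
      using card_Un_le[of "(U \<inter> R) \<union> (U \<inter> (S \<union> \<Union>Bs))" "U \<inter> W"] card_Un_le[of "U \<inter> R" "U \<inter> (S \<union> \<Union>Bs)"]
      by linarith
    finally have "card U \<le> card (U \<inter> R) + card (U \<inter> (S \<union> \<Union>Bs)) + card (U \<inter> W)" .
    moreover have "card (U \<inter> (S \<union> \<Union>Bs)) \<le> card (S \<union> \<Union>Bs)"
      using fins by (intro card_mono) auto
    moreover have "card (S \<union> \<Union>Bs) \<le> card S + t * ?b"
      using card_Un_le[of S "\<Union>Bs"] sizeB[of Bs] by simp
    moreover have "card S + t * ?b \<le> s" using sep_size[OF lS] part by blast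
    ultimately show ?thesis using UR by linarith
  qed
  show ?thesis
  proof (cases "\<exists>A\<in>Bs. \<forall>x\<in>A. \<forall>y\<in>W. {x, y} \<notin> E")
    case True
    then obtain A where A: "A \<in> Bs" "\<forall>x\<in>A. \<forall>y\<in>W. {x, y} \<notin> E" by blast
    define X where "X = \<Union>(Bs - {A})"
    have "A \<inter> B = {}" if "B \<in> Bs - {A}" for B
      using B2[rule_format, of A B] that A(1) by blast
    then have AX: "\<Union>Bs = A \<union> X" "A \<inter> X = {}" using A(1) unfolding X_def by blast+
    note p = part[unfolded AX(1)] and d = disj[unfolded AX(1)]
    have no: "\<forall>x\<in>R \<union> A. \<forall>y\<in>W. {x, y} \<notin> E" using A(2) noRW by auto
    have "card R \<le> card (R \<union> A)"
      using fins AX(1) by (intro card_mono) auto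
    then have lS': "l * card S \<le> card (R \<union> A)" using lS by linarith
    \<comment> \<open>The remaining branch sets count as part of the separator; the summand
      \<open>t * ?b\<close> in the budget is reserved for them.\<close>
    have "card (U \<inter> (R \<union> A)) < m \<or> card (U \<inter> W) < m"
    proof (rule sep[of _ "S \<union> X"])
      have "card (S \<union> X) \<le> card S + t * ?b"
        using card_Un_le[of S X] sizeB[of "Bs - {A}"] by (fastforce simp: X_def)
      also have "\<dots> \<le> s" using sep_size[OF lS] part by blast
      finally show "card (S \<union> X) \<le> s" .
      show "R \<union> A \<union> (S \<union> X) \<union> W = V" unfolding p[symmetric] by blast
      show "(R \<union> A) \<inter> (S \<union> X) = {}" "(R \<union> A) \<inter> W = {}" "(S \<union> X) \<inter> W = {}"
        using d AX(2) by blast+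
    qed (fact no)
    then have UR': "card (U \<inter> (R \<union> A)) < m" using UW U by linarith
    have "?state (R \<union> A) S (Bs - {A}) W"
      unfolding minor_state_def X_def[symmetric]
    proof (intro conjI)
      show "card (Bs - {A}) \<le> t" using \<open>card Bs < t\<close> by (meson card_Diff1_le le_trans less_imp_le)
      show "\<forall>A'\<in>Bs - {A}. A' \<noteq> {} \<and> induced_connected E A' \<and> card A' \<le> ?b" using B1 by (meson DiffD1)
      show "\<forall>A'\<in>Bs - {A}. \<forall>B\<in>Bs - {A}. A' \<noteq> B \<longrightarrow> A' \<inter> B = {} \<and> (\<exists>u\<in>A'. \<exists>v\<in>B. {u, v} \<in> E)"
        using B2 by (meson DiffD1)
      show "R \<union> A \<union> S \<union> X \<union> W = V" unfolding p[symmetric] by blast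
      show "(R \<union> A) \<inter> S = {}" "(R \<union> A) \<inter> X = {}" "(R \<union> A) \<inter> W = {}" "S \<inter> X = {}" "X \<inter> W = {}"
        using d AX(2) by blast+
    qed (fact no lS' UR' disj(5))+
    moreover have "card (Bs - {A}) < card Bs" using finB A(1) by (rule card_Diff1_less)
    ultimately show ?thesis by (intro exI[of _ "R \<union> A"] exI[of _ S] exI[of _ "Bs - {A}"] exI[of _ W]) simp
  next
    case False
    then have "\<forall>A\<in>Bs. \<exists>y\<in>W. \<exists>x\<in>A. {x, y} \<in> E" by blast
    then obtain g where g: "\<And>A. A \<in> Bs \<Longrightarrow> g A \<in> W \<and> (\<exists>x\<in>A. {x, g A} \<in> E)" by metis
    have "card (U \<inter> W) > 0" using UW U m by linarith
    then have "U \<inter> W \<noteq> {}" by (metis card.empty less_irrefl)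
    then obtain w where w: "w \<in> W" by blast
    \<comment> \<open>With no branch set present, a single arbitrary vertex of \<open>W\<close> is
      the terminal and starts the first one.\<close>
    define T where "T = (if Bs = {} then {w} else g ` Bs)"
    have T: "T \<subseteq> W" "T \<noteq> {}" "finite T" "card T \<le> max 1 (card Bs)"
      using g w finB by (auto simp: T_def card_image_le le_max_iff_disj)
    then obtain v0 where v0: "v0 \<in> T" "v0 \<in> W" by blast
    show ?thesis
    proof (cases "\<forall>v\<in>T. \<exists>P. ?link v0 v P \<and> card P \<le> 2 * r + 1")
      case True
      then obtain P where P: "\<And>v. v \<in> T \<Longrightarrow> ?link v0 v (P v) \<and> card (P v) \<le> 2 * r + 1"
        by metis
      define N where "N = (\<Union>v\<in>T. P v)"
      have N: "N \<subseteq> W" "N \<noteq> {}" "T \<subseteq> N" "finite N" using P T by (auto simp: N_def)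
      have Nconn: "induced_connected E N"
        unfolding N_def using P by (intro induced_connected_UN) auto
      have "card N \<le> (\<Sum>v\<in>T. card (P v))"
        unfolding N_def using T by (intro card_UN_le)
      also have "\<dots> \<le> (\<Sum>v\<in>T. 2 * r + 1)" using P by (intro sum_mono) auto
      also have "\<dots> = card T * (2 * r + 1)" by simp
      also have "\<dots> \<le> ?b" using T(4) \<open>card Bs < t\<close> by (intro mult_right_mono) auto
      finally have Nb: "card N \<le> ?b" .
      have Nnotin: "N \<notin> Bs" using N disj by blast
      have adj: "\<exists>u\<in>A. \<exists>v\<in>N. {u, v} \<in> E" if "A \<in> Bs" for A
      proof -
        have "g A \<in> T" using that by (auto simp: T_def)
        then have "g A \<in> N" using N(3) by blast
        then show ?thesis using g[OF that] by blast
      qed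
      have adj': "\<exists>u\<in>N. \<exists>v\<in>A. {u, v} \<in> E" if "A \<in> Bs" for A
        using adj[OF that] by (metis insert_commute)
      have disjN: "A \<inter> N = {}" "N \<inter> A = {}" if "A \<in> Bs" for A
      proof -
        have "A \<subseteq> Y" using that unfolding Y_def by (rule Union_upper)
        then show "A \<inter> N = {}" "N \<inter> A = {}" using dY(6) N(1) by blast+
      qed
      have cardB: "card (insert N Bs) = Suc (card Bs)" using Nnotin finB by simp
      have "?state R S (insert N Bs) (W - N)"
        unfolding minor_state_def
      proof (intro conjI)
        show "card (insert N Bs) \<le> t" using cardB \<open>card Bs < t\<close> by simp
        show "\<forall>A\<in>insert N Bs. A \<noteq> {} \<and> induced_connected E A \<and> card A \<le> ?b"
          using B1 N Nconn Nb by blast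
        show "\<forall>A\<in>insert N Bs. \<forall>B\<in>insert N Bs. A \<noteq> B \<longrightarrow> A \<inter> B = {} \<and> (\<exists>u\<in>A. \<exists>v\<in>B. {u, v} \<in> E)"
      proof (intro ballI impI)
        fix A B assume AB: "A \<in> insert N Bs" "B \<in> insert N Bs" "A \<noteq> B"
        then consider "A \<in> Bs" "B \<in> Bs" | "A = N" "B \<in> Bs" | "A \<in> Bs" "B = N" by auto
        then show "A \<inter> B = {} \<and> (\<exists>u\<in>A. \<exists>v\<in>B. {u, v} \<in> E)"
        proof cases
          case 1
          then show ?thesis using B2 AB(3) by meson
        qed (use adj adj' disjN in auto)
      qed
        show "R \<union> S \<union> \<Union>(insert N Bs) \<union> (W - N) = V"
          unfolding Union_insert Y_def[symmetric] pY[symmetric] using N(1) by blast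
        show "\<forall>x\<in>R. \<forall>y\<in>W - N. {x, y} \<notin> E" using noRW by simp
        show "R \<inter> \<Union>(insert N Bs) = {}"
          unfolding Union_insert Y_def[symmetric] using dY(2,3) N(1) by blast
        show "R \<inter> (W - N) = {}" using dY(3) by blast
        show "S \<inter> \<Union>(insert N Bs) = {}"
          unfolding Union_insert Y_def[symmetric] using dY(4,5) N(1) by blast
        show "S \<inter> (W - N) = {}" using dY(5) by blast
        show "\<Union>(insert N Bs) \<inter> (W - N) = {}"
          unfolding Union_insert Y_def[symmetric] using dY(6) N(1) by blast
      qed (fact lS UR disj(1))+
      moreover have "card (W - N) < card W"
        using N fins by (intro psubset_card_mono) auto
      \<comment> \<open>One lost vertex of \<open>W\<close> weighs \<open>Suc t\<close>, which
        outweighs the gained branch set.\<close>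
      then have "card (W - N) * Suc t + card (insert N Bs) < card W * Suc t + card Bs"
      proof -
        assume "card (W - N) < card W"
        then have "Suc (card (W - N)) * Suc t \<le> card W * Suc t" by (intro mult_right_mono) auto
        then show ?thesis using cardB \<open>card Bs < t\<close> by simp
      qed
      ultimately show ?thesis by blast
    next
      case far: False
      then obtain v1 where v1: "v1 \<in> T" "v1 \<in> W"
        and nopath: "\<nexists>P. ?link v0 v1 P \<and> card P \<le> 2 * r + 1"
        using T by blast
      let ?B = "graph_ball E W"
      have disjB: "?B v0 r \<inter> ?B v1 r = {}"
      proof (rule ccontr)
        assume "\<not> ?thesis"
        then obtain z where z: "z \<in> ?B v0 r" "z \<in> ?B v1 r" by blast
        from graph_ball_path[OF v0(2) z(1)]
        obtain P where P: "P \<subseteq> W" "finite P" "induced_connected E P" "v0 \<in> P" "z \<in> P" "card P \<le> Suc r" by blast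
        from graph_ball_path[OF v1(2) z(2)]
        obtain Q where Q: "Q \<subseteq> W" "finite Q" "induced_connected E Q" "v1 \<in> Q" "z \<in> Q" "card Q \<le> Suc r" by blast
        \<comment> \<open>Two sets of at most \<open>Suc r\<close> vertices share \<open>z\<close>,
          so the union has at most \<open>2 * Suc r - 1\<close> of them: exactly the limit that
          \<open>nopath\<close> excludes.\<close>
        have "card (P \<union> Q) + card (P \<inter> Q) = card P + card Q"
          using card_Un_Int[OF P(2) Q(2)] by simp
        moreover have "card (P \<inter> Q) \<ge> 1"
          using P Q by (metis IntI One_nat_def Suc_leI card_gt_0_iff empty_iff finite_Int)
        ultimately have "card (P \<union> Q) \<le> 2 * r + 1" using P Q by linarith
        moreover have "induced_connected E (P \<union> Q)" using P Q by (intro induced_connected_Un[of E P Q z])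
        ultimately show False
          using nopath P Q by (metis Un_iff finite_Un le_sup_iff)
      qed
      have ballW: "?B v0 r \<subseteq> W" "?B v1 r \<subseteq> W" by (rule graph_ball_subset, fact v0 v1)+
      have "card (U \<inter> ?B v0 r) + card (U \<inter> ?B v1 r) \<le> card (U \<inter> W)"
      proof -
        have "card (U \<inter> ?B v0 r) + card (U \<inter> ?B v1 r) = card ((U \<inter> ?B v0 r) \<union> (U \<inter> ?B v1 r))"
          using disjB fins by (intro card_Un_disjoint[symmetric]) auto
        also have "\<dots> \<le> card (U \<inter> W)"
          using fins ballW by (intro card_mono) auto
        finally show ?thesis .
      qed
      \<comment> \<open>The ball that is cut must leave enough of \<open>U\<close> outside; of two
        disjoint balls, one contains at most half of \<open>U \<inter> W\<close>.\<close>
      then have "2 * card (U \<inter> ?B v0 r) \<le> card (U \<inter> W) \<or> 2 * card (U \<inter> ?B v1 r) \<le> card (U \<inter> W)"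
        by linarith
      then obtain x where x: "x \<in> W" "2 * card (U \<inter> ?B x r) \<le> card (U \<inter> W)"
        using v0(2) v1(2) by blast
      have "card W \<le> card V" using part by (intro card_mono fin) auto
      then have "real (card W) < (1 + 1 / real l) ^ r" using growth by linarith
      then obtain i where i: "i < r" "l * card (?B x (Suc i) - ?B x i) \<le> card (?B x i)"
        using graph_ball_thin_layer[OF fins(3) x(1) l] by blast
      define C L where "C = ?B x i" and "L = ?B x (Suc i) - ?B x i"
      have CL: "C \<subseteq> W" "L \<subseteq> W" "C \<inter> L = {}" "x \<in> C" "C \<subseteq> ?B x r" "finite C" "finite L"
        unfolding C_def L_def
        using graph_ball_subset[OF x(1), of E i] graph_ball_subset[OF x(1), of E "Suc i"] center_in_graph_ball[of x E W i]
          graph_ball_mono[of i r E W x] i(1) finite_subset[OF _ fins(3)]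
        by auto
      have noC: "\<forall>x\<in>C. \<forall>y\<in>W - C - L. {x, y} \<notin> E"
        unfolding C_def L_def by (auto simp: graph_ball.simps(2))
      have no: "\<forall>x\<in>R \<union> C. \<forall>y\<in>W - C - L. {x, y} \<notin> E" using noC noRW by auto
      have disjoint: "R \<inter> C = {}" "S \<inter> L = {}" using disj CL by auto
      have "card (S \<union> L) = card S + card L" "card (R \<union> C) = card R + card C"
        using disjoint fins CL by (auto intro: card_Un_disjoint)
      then have lS': "l * card (S \<union> L) \<le> card (R \<union> C)"
        using lS i(2)[folded L_def, folded C_def] by (simp add: distrib_left)
      have s': "card (S \<union> L) + t * ?b \<le> s" using sep_size[OF lS'] part CL(1) by auto
      have "card (U \<inter> (R \<union> C)) < m \<or> card (U \<inter> (W - C - L)) < m"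
      proof (rule sep[of _ "S \<union> L \<union> \<Union>Bs"])
        show "card (S \<union> L \<union> \<Union>Bs) \<le> s"
          using card_Un_le[of "S \<union> L" "\<Union>Bs"] sizeB[of Bs] s' by simp
        show "R \<union> C \<union> (S \<union> L \<union> \<Union>Bs) \<union> (W - C - L) = V"
          unfolding Y_def[symmetric] pY[symmetric] using CL(1,2) by blast
        show "(R \<union> C) \<inter> (S \<union> L \<union> \<Union>Bs) = {}" "(R \<union> C) \<inter> (W - C - L) = {}"
          "(S \<union> L \<union> \<Union>Bs) \<inter> (W - C - L) = {}"
          unfolding Y_def[symmetric] using dY CL(1-3) by blast+
      qed (fact no)
      \<comment> \<open>More than \<open>2 * m + 2 * s\<close> vertices of \<open>U\<close> lie in
        \<open>W\<close>. At least half of them are outside the ball, and the layer takes at most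
        \<open>s\<close>.\<close>
      moreover have "m \<le> card (U \<inter> (W - C - L))"
      proof -
        have "card (U \<inter> W) \<le> card ((U \<inter> (W - C - L)) \<union> (U \<inter> ?B x r) \<union> L)"
          using fins CL by (intro card_mono) (auto intro: finite_subset[OF graph_ball_subset[OF x(1)]])
        also have "\<dots> \<le> card (U \<inter> (W - C - L)) + card (U \<inter> ?B x r) + card L"
          using card_Un_le[of "(U \<inter> (W - C - L)) \<union> (U \<inter> ?B x r)" L]
            card_Un_le[of "U \<inter> (W - C - L)" "U \<inter> ?B x r"] by linarith
        finally have "card (U \<inter> W) \<le> card (U \<inter> (W - C - L)) + card (U \<inter> ?B x r) + card L" .
        moreover have "card L \<le> s" using s' card_mono[of "S \<union> L" L] fins CL by simp
        ultimately show ?thesis using x(2) UW U by linarith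
      qed
      ultimately have UR': "card (U \<inter> (R \<union> C)) < m" by linarith
      have "?state (R \<union> C) (S \<union> L) Bs (W - C - L)"
        unfolding minor_state_def
      proof (intro conjI)
        show "card Bs \<le> t" using \<open>card Bs < t\<close> by simp
        show "R \<union> C \<union> (S \<union> L) \<union> \<Union>Bs \<union> (W - C - L) = V"
          unfolding Y_def[symmetric] pY[symmetric] using CL(1,2) by blast
        show  "(R \<union> C) \<inter> (S \<union> L) = {}" "(R \<union> C) \<inter> \<Union>Bs = {}" "(R \<union> C) \<inter> (W - C - L) = {}"
          "(S \<union> L) \<inter> \<Union>Bs = {}" "(S \<union> L) \<inter> (W - C - L) = {}" "\<Union>Bs \<inter> (W - C - L) = {}"
          unfolding Y_def[symmetric] using dY CL(1-3) by blast+
      qed (fact no lS' UR' B1 B2)+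
      moreover have "card (W - C - L) < card W"
        using CL x fins by (intro psubset_card_mono) auto
      then have "card (W - C - L) * Suc t + card Bs < card W * Suc t + card Bs"
        by (simp only: add_less_cancel_right mult_less_cancel2 zero_less_Suc simp_thms)
      ultimately show ?thesis by blast
    qed
  qed
qed

text \<open>The steps are iterated from the state in which all of \<open>V\<close> is unexplored.
  The hypothesis \<open>size\<close> splits the allowance \<open>s\<close>:
  \<open>card V / l\<close> for the layers, charged to the vertices cut off, and \<open>t\<close>
  times the maximal size of a branch set.\<close>

lemma complete_minor_of_no_sparse_separator:
  fixes l r m s t :: nat
  assumes fin: "finite V" and UV: "U \<subseteq> V"
    and sep: "\<And>R S W. R \<union> S \<union> W = V \<Longrightarrow> R \<inter> S = {} \<Longrightarrow> R \<inter> W = {} \<Longrightarrow> S \<inter> W = {} \<Longrightarrow>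
                \<forall>x\<in>R. \<forall>y\<in>W. {x, y} \<notin> E \<Longrightarrow> card S \<le> s \<Longrightarrow> card (U \<inter> R) < m \<or> card (U \<inter> W) < m"
    and U: "3 * m + 3 * s \<le> card U" and m: "m > 0" and l: "l > 0"
    and size: "card V + l * (t * (t * (2 * r + 1))) \<le> l * s"
    and growth: "real (card V) < (1 + 1 / real l) ^ r"
  shows "has_K_minor V E t"
proof -
  let ?st = "minor_state V E U l m t (t * (2 * r + 1))"
  have "\<exists>R S Bs W. ?st R S Bs W \<and> card Bs = t" if "?st R S Bs W" for R S Bs W
    using that
  proof (induction "card W * Suc t + card Bs" arbitrary: R S Bs W rule: less_induct)
    case less
    show ?case
    proof (cases "card Bs = t")
      case False
      moreover have "card Bs \<le> t" using less.prems by (simp add: minor_state_def)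
      ultimately have "card Bs < t" by simp
      have "\<exists>R' S' Bs' W'. ?st R' S' Bs' W' \<and> card W' * Suc t + card Bs' < card W * Suc t + card Bs"
        by (rule minor_state_step[OF fin UV _ U m l size growth less.prems \<open>card Bs < t\<close>]) (rule sep; assumption)
      then obtain R' S' Bs' W' where st': "?st R' S' Bs' W'"
        and lt: "card W' * Suc t + card Bs' < card W * Suc t + card Bs"
        by blast
      show ?thesis using less.hyps[OF lt st'] .
    qed (use less.prems in blast)
  qed
  moreover have "?st {} {} {} V" using m by (simp add: minor_state_def)
  ultimately obtain R S Bs W where "?st R S Bs W" "card Bs = t" by blast
  then show ?thesis using minor_state_has_K_minor fin by blast
qed

section \<open>Percolation on graphs of large minimum degree\<close>

text \<open>The union of the components meeting \<open>A\<close>, for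
  \<open>A \<subseteq> V\<close>. Every step has to end in \<open>V\<close>, so deleting vertices
  amounts to shrinking \<open>V\<close> while \<open>F\<close> stays the same.\<close>

inductive_set reach :: "'a set \<Rightarrow> 'a set set \<Rightarrow> 'a set \<Rightarrow> 'a set" for V F A where
  base: "a \<in> A \<Longrightarrow> a \<in> reach V F A"
| step: "x \<in> reach V F A \<Longrightarrow> y \<in> V \<Longrightarrow> {x, y} \<in> F \<Longrightarrow> y \<in> reach V F A"

lemma reach_subset: "A \<subseteq> V \<Longrightarrow> reach V F A \<subseteq> V"
proof
  fix x assume "A \<subseteq> V" "x \<in> reach V F A"
  from this(2,1) show "x \<in> V" by induction auto
qed

lemma reach_mono:
  assumes "A \<subseteq> reach V' F' A'" "A \<subseteq> V" "V \<subseteq> V'"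
    and "\<And>x y. x \<in> V \<Longrightarrow> y \<in> V \<Longrightarrow> {x, y} \<in> F \<Longrightarrow> {x, y} \<in> F'"
  shows "reach V F A \<subseteq> reach V' F' A'"
proof
  fix x assume "x \<in> reach V F A"
  then show "x \<in> reach V' F' A'"
  proof induction
    case (step x y)
    have "x \<in> V" using step.hyps(1) reach_subset[OF assms(2)] by blast
    then show ?case using step assms by (meson reach.step subsetD)
  qed (use assms in blast)
qed

lemma reach_mono_edges: "A \<subseteq> V \<Longrightarrow> F \<subseteq> F' \<Longrightarrow> reach V F A \<subseteq> reach V F' A"
  by (rule reach_mono) (auto intro: reach.base)

lemma reach_restrict:
  assumes "A \<subseteq> V" "\<And>x y. x \<in> V \<Longrightarrow> y \<in> V \<Longrightarrow> {x, y} \<in> F \<longleftrightarrow> {x, y} \<in> F'"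
  shows "reach V F A = reach V F' A"
  using assms by (intro subset_antisym reach_mono) (auto intro: reach.base)

text \<open>Reveal the edges at one active vertex at a time: an active vertex \<open>a\<close> is replaced by the newly
  found ones, so \<open>\<rho> ^ card A\<close> plays the role of the extinction probability of a branching process.\<close>

lemma percolation_growth:
  assumes "finite E" "finite V" "A \<subseteq> V" and p: "0 \<le> p" "p \<le> 1" and \<rho>: "0 \<le> \<rho>" "\<rho> \<le> 1"
    and D: "(1 - p + p * \<rho>) ^ D \<le> \<rho>"
    and deg: "\<And>v. v \<in> V \<Longrightarrow> D + k \<le> card {u \<in> V. {v, u} \<in> E}"
  shows "rand_prob E p (\<lambda>F. card (reach V F A) < k) \<le> \<rho> ^ card A"
  using assms(1-3) deg
proof (induction k arbitrary: E V A)
  case 0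
  then show ?case using \<rho> by (simp add: rand_prob_def)
next
  case (Suc k)
  have finA: "finite A" using Suc.prems finite_subset by blast
  consider "A = {}" | "Suc k \<le> card A" | "A \<noteq> {}" "card A \<le> k" by linarith
  then show ?case
  proof cases
    case 1
    then show ?thesis using rand_prob_le_1[OF Suc.prems(1) p] by simp
  next
    case 2
    have "\<not> card (reach V F A) < Suc k" for F
    proof -
      have "card A \<le> card (reach V F A)"
        using reach_subset[OF Suc.prems(3)] Suc.prems(2)
        by (intro card_mono) (auto intro: finite_subset reach.base)
      then show ?thesis using 2 by simp
    qed
    then have "rand_prob E p (\<lambda>F. card (reach V F A) < Suc k) = 0"
      using Suc.prems(1) by (simp add: rand_prob_def)
    then show ?thesis using \<rho> by simp
  next
    case 3
    then obtain a where a: "a \<in> A" "a \<in> V" using Suc.prems(3) by blast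
    define N where "N = {u \<in> V - A. {a, u} \<in> E}"
    define Ea where "Ea = (\<lambda>u. {a, u}) ` N"
    have finN: "finite N" using Suc.prems(2) by (simp add: N_def)
    have inj: "inj_on (\<lambda>u. {a, u}) N" by (auto simp: inj_on_def doubleton_eq_iff)
    \<comment> \<open>At most \<open>k\<close> vertices are active, so of the
      \<open>D + Suc k\<close> neighbours of \<open>a\<close> at least \<open>D\<close> are
      new.\<close>
    have "{u \<in> V. {a, u} \<in> E} \<subseteq> N \<union> A" by (auto simp: N_def)
    then have "card {u \<in> V. {a, u} \<in> E} \<le> card N + card A"
      using finN finA by (meson card_Un_le card_mono finite_UnI order_trans)
    then have "D \<le> card N" using Suc.prems(4)[OF a(2)] 3(2) by linarith
    then have cardEa: "D \<le> card Ea" unfolding Ea_def using card_image[OF inj] by simp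
    have Ea: "Ea \<subseteq> E" "finite Ea"
      using finN by (auto simp: Ea_def) (auto simp: N_def)
    define T where "T F1 = {u \<in> N. {a, u} \<in> F1}" for F1
    define A' where "A' F1 = (A - {a}) \<union> T F1" for F1
    have cardA': "card (A' F1) = card A - 1 + card F1" if "F1 \<subseteq> Ea" for F1
    proof -
      have "F1 = (\<lambda>u. {a, u}) ` T F1" using that by (auto simp: T_def Ea_def)
      then have "card F1 = card (T F1)"
        using card_image[OF inj_on_subset[OF inj], of "T F1"] by (auto simp: T_def)
      moreover have "card (A' F1) = card (A - {a}) + card (T F1)"
        unfolding A'_def
      proof (intro card_Un_disjoint)
        show "finite (T F1)" using finN by (simp add: T_def)
      qed (use finA in \<open>auto simp: T_def N_def\<close>)
      ultimately show ?thesis using a finA by simp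
    qed
    \<comment> \<open>Once its edges are revealed, \<open>a\<close> is removed. It counts as one
      reached vertex, which is why the target drops from \<open>Suc k\<close> to
      \<open>k\<close>.\<close>
    let ?R = "\<lambda>F1 F2. reach (V - {a}) F2 (A' F1)"
    have A'V: "A' F1 \<subseteq> V - {a}" for F1
      using Suc.prems(3) a by (auto simp: A'_def T_def N_def)
    have grow: "Suc (card (?R F1 F2)) \<le> card (reach V (F1 \<union> F2) A)" for F1 F2
    proof -
      have sub: "?R F1 F2 \<subseteq> V - {a}" by (rule reach_subset[OF A'V])
      have "T F1 \<subseteq> reach V (F1 \<union> F2) A"
        using a by (auto simp: T_def N_def intro: reach.step[OF reach.base])
      then have "?R F1 F2 \<subseteq> reach V (F1 \<union> F2) A"
        using A'V by (intro reach_mono) (auto simp: A'_def intro: reach.base)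
      then have "insert a (?R F1 F2) \<subseteq> reach V (F1 \<union> F2) A"
        using a by (auto intro: reach.base)
      moreover have "finite (reach V (F1 \<union> F2) A)"
        using reach_subset[OF Suc.prems(3)] Suc.prems(2) finite_subset by blast
      ultimately have "card (insert a (?R F1 F2)) \<le> card (reach V (F1 \<union> F2) A)"
        by (intro card_mono)
      moreover have "a \<notin> ?R F1 F2" "finite (?R F1 F2)"
        using sub Suc.prems(2) by (auto intro: finite_subset)
      ultimately show ?thesis by simp
    qed
    have IH: "rand_prob (E - Ea) p (\<lambda>F2. card (?R F1 F2) < k) \<le> \<rho> ^ card (A' F1)" for F1
    proof (intro Suc.IH)
      fix v assume v: "v \<in> V - {a}"
      \<comment> \<open>Apart from \<open>a\<close> itself no neighbour is lost: the revealed edges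
        all contain \<open>a\<close>. The degree hypothesis for \<open>k\<close> therefore
        survives.\<close>
      have "{u \<in> V. {v, u} \<in> E} \<subseteq> insert a {u \<in> V - {a}. {v, u} \<in> E - Ea}"
        using v by (auto simp: Ea_def doubleton_eq_iff)
      then have "card {u \<in> V. {v, u} \<in> E} \<le> card (insert a {u \<in> V - {a}. {v, u} \<in> E - Ea})"
        using Suc.prems(2) by (intro card_mono) auto
      also have "\<dots> \<le> Suc (card {u \<in> V - {a}. {v, u} \<in> E - Ea})" by (rule card_insert_le_m1) auto
      finally show "D + k \<le> card {u \<in> V - {a}. {v, u} \<in> E - Ea}"
        using Suc.prems(4)[of v] v by simp
    qed (use Suc.prems A'V in auto)
    let ?P = "\<lambda>F1. rand_prob (E - Ea) p (\<lambda>F2. card (reach V (F1 \<union> F2) A) < Suc k)"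
    have "rand_prob E p (\<lambda>F. card (reach V F A) < Suc k)
        = rand_exp Ea p ?P"
      unfolding rand_prob_def by (rule rand_exp_split[OF Suc.prems(1) Ea(1)])
    also have "\<dots> \<le> rand_exp Ea p (\<lambda>F1. \<rho> ^ (card A - 1) * \<rho> ^ card F1)"
    proof (intro rand_exp_mono p)
      fix F1 assume F1: "F1 \<subseteq> Ea"
      have "?P F1
          \<le> rand_prob (E - Ea) p (\<lambda>F2. card (?R F1 F2) < k)"
        using grow by (intro rand_prob_mono p) (meson Suc_less_SucD le_less_trans)
      also have "\<dots> \<le> \<rho> ^ (card A - 1 + card F1)"
        using IH[of F1] cardA'[OF F1] by simp
      finally show "?P F1
          \<le> \<rho> ^ (card A - 1) * \<rho> ^ card F1" by (simp add: power_add)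
    qed
    also have "\<dots> = \<rho> ^ (card A - 1) * (1 - p + p * \<rho>) ^ card Ea"
    proof -
      have "rand_exp Ea p (\<lambda>F1. \<rho> ^ card F1) = rand_exp Ea p (\<lambda>F1. \<rho> ^ card (F1 \<inter> Ea))"
        by (intro rand_exp_cong) (simp add: Int_absorb2)
      then show ?thesis using rand_exp_card[OF Ea(2), of Ea p \<rho>] by (simp add: rand_exp_cmult)
    qed
    \<comment> \<open>The hypothesis \<open>D\<close> says that one generation of binomial offspring
      does not raise \<rho>; further trials only lower the generating function.\<close>
    also have "\<dots> \<le> \<rho> ^ (card A - 1) * \<rho>"
    proof -
      have "0 \<le> p * \<rho>" "p * \<rho> \<le> p" using p \<rho> by (auto intro: mult_left_le)
      then have "(1 - p + p * \<rho>) ^ card Ea \<le> (1 - p + p * \<rho>) ^ D"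
        using cardEa p by (intro power_decreasing) auto
      then have "(1 - p + p * \<rho>) ^ card Ea \<le> \<rho>" using D by linarith
      then show ?thesis using \<rho> by (intro mult_left_mono) auto
    qed
    also have "\<dots> = \<rho> ^ card A"
    proof -
      have "card A > 0" using 3 finA by (simp add: card_gt_0_iff)
      then show ?thesis by (metis Suc_diff_1 power_Suc2)
    qed
    finally show ?thesis .
  qed
qed

section \<open>Growth of components in the hypercube\<close>

definition flip :: "nat \<Rightarrow> nat set \<Rightarrow> nat set" where
  "flip j x = sym_diff x {j}"

lemma mem_flip: "i \<in> flip j x \<longleftrightarrow> (i \<in> x) \<noteq> (i = j)"
  by (auto simp: flip_def)

lemma flip_flip [simp]: "flip j (flip j x) = x"
  by (auto simp: set_eq_iff mem_flip)

lemma flip_eq_iff [simp]: "flip i x = flip j x \<longleftrightarrow> i = j"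
  by (auto simp: set_eq_iff mem_flip)

lemma flip_eq_iff2 [simp]: "flip j x = flip j y \<longleftrightarrow> x = y"
  by (metis flip_flip)

lemma flip_neq [simp]: "flip j x \<noteq> x" "x \<noteq> flip j x"
  by (auto simp: set_eq_iff mem_flip)

lemma flip_in_cube: "x \<in> cube_verts d \<Longrightarrow> j < d \<Longrightarrow> flip j x \<in> cube_verts d"
  by (auto simp: cube_verts_def mem_flip)

lemma finite_cube_verts [simp]: "finite (cube_verts d)"
  by (simp add: cube_verts_def)

lemma card_cube_verts [simp]: "card (cube_verts d) = 2 ^ d"
  by (simp add: cube_verts_def card_Pow)

lemma card_sym_diff_eq_1: "card (sym_diff u v) = 1 \<longleftrightarrow> (\<exists>j. v = flip j u)"
proof
  assume "card (sym_diff u v) = 1"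
  then obtain j where j: "sym_diff u v = {j}" by (auto simp: card_1_singleton_iff)
  have "v = flip j u"
  proof (rule set_eqI)
    fix i
    have "(i \<in> u) \<noteq> (i \<in> v) \<longleftrightarrow> i = j" using j by (auto simp: set_eq_iff)
    then show "i \<in> v \<longleftrightarrow> i \<in> flip j u" by (auto simp: mem_flip)
  qed
  then show "\<exists>j. v = flip j u" ..
next
  assume "\<exists>j. v = flip j u"
  then obtain j where "v = flip j u" ..
  then have "sym_diff u v = {j}" by (auto simp: set_eq_iff mem_flip)
  then show "card (sym_diff u v) = 1" by simp
qed

lemma cube_edge_iff:
  "{u, v} \<in> cube_edges d \<longleftrightarrow> u \<in> cube_verts d \<and> v \<in> cube_verts d \<and> (\<exists>j. v = flip j u)"
proof -
  have "{u, v} \<in> cube_edges d \<longleftrightarrow> (\<exists>a b. {u, v} = {a, b} \<and> a \<in> cube_verts d \<and> b \<in> cube_verts d \<and> (\<exists>j. b = flip j a))"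
    unfolding cube_edges_def card_sym_diff_eq_1 by blast
  also have "\<dots> \<longleftrightarrow> u \<in> cube_verts d \<and> v \<in> cube_verts d \<and> (\<exists>j. v = flip j u)"
    by (auto simp: doubleton_eq_iff) (metis flip_flip)
  finally show ?thesis .
qed

lemma cube_edgeE:
  assumes "e \<in> cube_edges d"
  obtains u j where "e = {u, flip j u}" "u \<in> cube_verts d" "flip j u \<in> cube_verts d"
  using assms unfolding cube_edges_def card_sym_diff_eq_1 by blast

lemma flip_in_cube_less: "x \<in> cube_verts d \<Longrightarrow> flip j x \<in> cube_verts d \<Longrightarrow> j < d"
  by (auto simp: cube_verts_def mem_flip subset_iff)

lemma flip_edge: "x \<in> cube_verts d \<Longrightarrow> j < d \<Longrightarrow> {x, flip j x} \<in> cube_edges d"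
  by (auto simp: cube_edge_iff flip_in_cube)

lemma cube_edges_subset: "cube_edges d \<subseteq> Pow (cube_verts d)"
  by (auto simp: cube_edges_def)

lemma finite_cube_edges [simp]: "finite (cube_edges d)"
  by (rule finite_subset[OF cube_edges_subset]) simp

lemma cube_nbrs: "x \<in> cube_verts d \<Longrightarrow> {y \<in> cube_verts d. {x, y} \<in> cube_edges d} = (\<lambda>j. flip j x) ` {..<d}"
  by (auto simp: cube_edge_iff flip_in_cube dest: flip_in_cube_less)

abbreviation cube_degree :: "nat \<Rightarrow> nat set set \<Rightarrow> nat set \<Rightarrow> nat" where
  "cube_degree d X x \<equiv> card {u \<in> X. {x, u} \<in> cube_edges d}"

lemma card_cube_nbrs: "x \<in> cube_verts d \<Longrightarrow> cube_degree d (cube_verts d) x = d"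
  by (simp add: cube_nbrs card_image inj_on_def)

definition subcube :: "nat set \<Rightarrow> nat set \<Rightarrow> nat set set" where
  "subcube w I = {x. x - I = w - I}"

definition edges_in :: "nat \<Rightarrow> nat set set \<Rightarrow> nat set set set" where
  "edges_in d X = {e \<in> cube_edges d. e \<subseteq> X}"

lemma subcube_self [simp]: "w \<in> subcube w I"
  by (simp add: subcube_def)

lemma subcube_in_cube: "w \<in> cube_verts d \<Longrightarrow> I \<subseteq> {..<d} \<Longrightarrow> subcube w I \<subseteq> cube_verts d"
  by (auto simp: subcube_def cube_verts_def set_eq_iff subset_iff)

lemma subcube_mono: "I \<subseteq> J \<Longrightarrow> subcube w I \<subseteq> subcube w J"
  by (auto simp: subcube_def set_eq_iff)

lemma subcube_eq: "u \<in> subcube w I \<Longrightarrow> subcube u I = subcube w I"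
  by (auto simp: subcube_def)

lemma flip_diff: "flip j x - I = (if j \<in> I then x - I else flip j (x - I))"
  by (auto simp: set_eq_iff mem_flip)

lemma flip_in_subcube: "u \<in> subcube w I \<Longrightarrow> j \<in> I \<Longrightarrow> flip j u \<in> subcube w I"
  by (auto simp: subcube_def flip_diff)

lemma flip_in_subcube_flip: "u \<in> subcube w I \<Longrightarrow> flip j u \<in> subcube (flip j w) I"
  by (auto simp: subcube_def flip_diff)

lemma flip_notin_subcube: "u \<in> subcube w I \<Longrightarrow> j \<notin> I \<Longrightarrow> flip j u \<notin> subcube w I"
  by (auto simp: subcube_def flip_diff)

lemma subcube_flip_subset: "subcube (flip j w) I \<subseteq> subcube w (insert j I)"
  by (auto simp: subcube_def set_eq_iff mem_flip)

lemma subcube_flip_disjoint: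
  "i \<notin> I \<Longrightarrow> j \<notin> I \<Longrightarrow> i \<noteq> j \<Longrightarrow> subcube (flip i w) I \<inter> subcube (flip j w) I = {}"
  by (auto simp: subcube_def flip_diff)

lemma finite_edges_in [simp]: "finite (edges_in d X)"
  by (simp add: edges_in_def)

lemma edges_in_mono: "X \<subseteq> Y \<Longrightarrow> edges_in d X \<subseteq> edges_in d Y"
  by (auto simp: edges_in_def)

lemma edges_in_disjoint: "X \<inter> Y = {} \<Longrightarrow> edges_in d X \<inter> edges_in d Y = {}"
  by (auto simp: edges_in_def elim!: cube_edgeE)

text \<open>All degrees in the subcube are at least \<open>card I\<close>: \<open>k\<close>
  directions make up for vertices already found, \<open>D\<close> feed the branching
  process.\<close>

lemma subcube_growth:
  assumes I: "I \<subseteq> {..<d}" and w: "w \<in> cube_verts d" and k: "D + k \<le> card I"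
    and p: "0 \<le> p" "p \<le> 1" and \<rho>: "0 \<le> \<rho>" "\<rho> \<le> 1" and D: "(1 - p + p * \<rho>) ^ D \<le> \<rho>"
  shows "1 - \<rho> \<le> rand_prob (edges_in d (subcube w I)) p (\<lambda>F. k \<le> card (reach (subcube w I) F {w}))"
proof -
  have fin: "finite (subcube w I)"
    by (rule finite_subset[OF subcube_in_cube[OF w I]]) simp
  have "rand_prob (edges_in d (subcube w I)) p (\<lambda>F. card (reach (subcube w I) F {w}) < k) \<le> \<rho> ^ card {w}"
  proof (rule percolation_growth[OF _ fin _ p \<rho> D])
    fix v assume v: "v \<in> subcube w I"
    have "(\<lambda>j. flip j v) ` I \<subseteq> {u \<in> subcube w I. {v, u} \<in> edges_in d (subcube w I)}"
      using v I subcube_in_cube[OF w I] flip_in_subcube[OF v]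
      by (auto simp: edges_in_def intro!: flip_edge)
    then have "card ((\<lambda>j. flip j v) ` I) \<le> card {u \<in> subcube w I. {v, u} \<in> edges_in d (subcube w I)}"
      using fin by (intro card_mono) auto
    then show "D + k \<le> card {u \<in> subcube w I. {v, u} \<in> edges_in d (subcube w I)}"
      using k by (simp add: card_image inj_on_def)
  qed auto
  then show ?thesis
    using rand_prob_not[OF finite_edges_in, of d "subcube w I" p "\<lambda>F. k \<le> card (reach (subcube w I) F {w})"]
    by (simp add: not_le)
qed

text \<open>Let the component of \<open>w\<close> in the base subcube have at least \<open>k\<close>
  vertices. For each \<open>j \<in> J\<close> it sends as many potential edges into the parallel
  copy in direction \<open>j\<close>; one is present and lands in a component of size
  \<open>k\<close> there with probability at least \<open>q\<close>. The copies are independent and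
  disjoint, so about \<open>q * card J\<close> successes multiply the size \<open>k\<close>.\<close>

lemma subcube_growth_square:
  assumes IJ: "I \<subseteq> {..<d}" "J \<subseteq> {..<d}" "I \<inter> J = {}" and w: "w \<in> cube_verts d" and k: "D + k \<le> card I"
    and p: "0 \<le> p" "p \<le> 1" and \<rho>: "0 \<le> \<rho>" "\<rho> \<le> 1" and D: "(1 - p + p * \<rho>) ^ D \<le> \<rho>"
    and q: "q = (1 - (1 - p) ^ k) * (1 - \<rho>)" and K: "real K \<le> real k * (q / 4 * real (card J))"
  shows "(1 - \<rho>) * (1 - exp (- (q * real (card J) / 4)))
      \<le> rand_prob (edges_in d (subcube w (I \<union> J))) p (\<lambda>F. K \<le> card (reach (subcube w (I \<union> J)) F {w}))"
proof -
  let ?Q = "\<lambda>j. subcube (flip j w) I" and ?r = "\<lambda>j F u. reach (subcube (flip j w) I) F {flip j u}"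
    and ?IJ = "subcube w (I \<union> J)"
    and ?x = "exp (- (q * real (card J) / 4))"
  define E where "E = edges_in d (subcube w (I \<union> J))"
  define D0 where "D0 = edges_in d (subcube w I)"
  \<comment> \<open>The block of direction \<open>j\<close> consists of the matching edges between
    the base subcube and the copy, and the edges of the copy. Removing \<open>D0\<close> makes the
    blocks disjoint and keeps them fresh after the base has been revealed.\<close>
  define Dj where "Dj j = edges_in d (subcube w (insert j I)) - D0" for j
  have sub: "subcube w I \<subseteq> cube_verts d" "subcube w (I \<union> J) \<subseteq> cube_verts d"
    using IJ by (intro subcube_in_cube w; simp)+
  have subj: "?Q j \<subseteq> subcube w (I \<union> J)" if "j \<in> J" for j
    using subcube_flip_subset[of j w I] subcube_mono[of "insert j I" "I \<union> J" w] that by blast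
  have finJ: "finite J" using IJ finite_subset by blast
  have D0E: "D0 \<subseteq> E" unfolding D0_def E_def by (intro edges_in_mono subcube_mono) auto
  have finE: "finite E" "finite D0" by (simp_all add: E_def D0_def)
  have DjE: "Dj j \<subseteq> E - D0" if "j \<in> J" for j
    unfolding Dj_def E_def using that by (intro Diff_mono edges_in_mono subcube_mono) auto
  have inner_j: "{x, y} \<in> Dj j \<longleftrightarrow> {x, y} \<in> cube_edges d"
    if "j \<in> J" "x \<in> ?Q j" "y \<in> ?Q j" for j x y
  proof -
    have "x \<notin> subcube w I" using that IJ flip_notin_subcube[of w w I j] subcube_eq
      by (metis disjoint_iff subcube_self)
    then show ?thesis using that subcube_flip_subset[of j w I] by (auto simp: Dj_def D0_def edges_in_def)
  qed
  have cross_j: "{u, flip j u} \<in> Dj j" if "j \<in> J" "u \<in> subcube w I" for j u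
  proof -
    have "flip j u \<notin> subcube w I" using that IJ by (intro flip_notin_subcube) auto
    moreover have "flip j u \<in> subcube w (insert j I)" "u \<in> subcube w (insert j I)"
      using that subcube_mono[of I "insert j I" w] by (auto intro!: flip_in_subcube)
    moreover have "{u, flip j u} \<in> cube_edges d" using that sub IJ by (intro flip_edge) auto
    ultimately show ?thesis by (auto simp: Dj_def D0_def edges_in_def)
  qed
  have disj: "disjoint_family_on Dj J"
    unfolding disjoint_family_on_def
  proof (intro ballI impI)
    fix i j assume ij: "i \<in> J" "j \<in> J" "i \<noteq> j"
    have "subcube w (insert i I) \<inter> subcube w (insert j I) \<subseteq> subcube w I"
      using ij by (auto simp: subcube_def set_eq_iff)
    then show "Dj i \<inter> Dj j = {}" by (auto simp: Dj_def D0_def edges_in_def)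
  qed
  have main: "1 - ?x
      \<le> rand_prob (E - D0) p (\<lambda>F'. K \<le> card (reach ?IJ (F0 \<union> F') {w}))"
    if F0: "F0 \<subseteq> D0" and C: "k \<le> card (reach (subcube w I) F0 {w})" for F0
  proof -
    define C where "C = reach (subcube w I) F0 {w}"
    have Csub: "C \<subseteq> subcube w I" unfolding C_def by (rule reach_subset) auto
    define Y where "Y j F' \<longleftrightarrow> (\<exists>u\<in>C. {u, flip j u} \<in> F' \<and> k \<le> card (?r j F' u))"
      for j F'
    have Yprob: "q \<le> rand_prob (Dj j) p (Y j)" if j: "j \<in> J" for j
    proof -
      \<comment> \<open>The matching edges at \<open>C\<close> are revealed before those of the
        copy. A single one that is present provides a start vertex, and growth from it is a new
        experiment.\<close>
      define X where "X = (\<lambda>u. {u, flip j u}) ` C"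
      have "inj_on (\<lambda>u. {u, flip j u}) C"
      proof (rule inj_onI)
        fix u v assume "u \<in> C" "v \<in> C" "{u, flip j u} = {v, flip j v}"
        moreover have "flip j v \<notin> C" using Csub \<open>v \<in> C\<close> j IJ flip_notin_subcube[of v w I j] by blast
        ultimately show "u = v" by (auto simp: doubleton_eq_iff)
      qed
      then have cardX: "card X = card C" unfolding X_def by (rule card_image)
      have XD: "X \<subseteq> Dj j" using Csub cross_j[OF j] by (auto simp: X_def)
      have finX: "finite X" "finite (Dj j)" using XD DjE[OF j] finE by (meson finite_Diff finite_subset)+
      have "rand_prob X p (\<lambda>F. F \<noteq> {}) * (1 - \<rho>) = rand_exp X p (\<lambda>F1. of_bool (F1 \<noteq> {}) * (1 - \<rho>))"
        by (simp add: rand_prob_def rand_exp_multc)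
      also have "\<dots> \<le> rand_exp X p (\<lambda>F1. rand_prob (Dj j - X) p (\<lambda>F2. Y j (F1 \<union> F2)))"
      proof (intro rand_exp_mono p)
        fix F1 assume F1: "F1 \<subseteq> X"
        show "of_bool (F1 \<noteq> {}) * (1 - \<rho>) \<le> rand_prob (Dj j - X) p (\<lambda>F2. Y j (F1 \<union> F2))"
        proof (cases "F1 = {}")
          case False
          then obtain u where u: "u \<in> C" "{u, flip j u} \<in> F1" using F1 by (auto simp: X_def)
          have fu: "flip j u \<in> ?Q j" using u Csub by (intro flip_in_subcube_flip) auto
          have "1 - \<rho> \<le> rand_prob (edges_in d (subcube (flip j u) I)) p
              (\<lambda>F. k \<le> card (reach (subcube (flip j u) I) F {flip j u}))"
            using fu subj[OF j] sub by (intro subcube_growth[OF IJ(1) _ k p \<rho> D]) auto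
          also have "\<dots> = rand_prob (Dj j - X) p (\<lambda>F2. k \<le> card (?r j F2 u))"
            unfolding subcube_eq[OF fu]
          proof (intro rand_prob_restrict[symmetric])
            show "edges_in d (?Q j) \<subseteq> Dj j - X"
            proof
              fix e assume "e \<in> edges_in d (?Q j)"
              then have e: "e \<in> cube_edges d" "e \<subseteq> ?Q j" by (simp_all add: edges_in_def)
              from e(1) obtain x i where "e = {x, flip i x}" by (rule cube_edgeE)
              then have x: "e = {x, flip i x}" "{x, flip i x} \<in> cube_edges d"
                "x \<in> ?Q j" "flip i x \<in> ?Q j"
                using e by simp_all
              \<comment> \<open>Every edge of \<open>X\<close> has an end in the base subcube and no
                edge of the copy has one, so the experiment in the copy uses unrevealed edges
                only.\<close>
              have "v \<notin> e" if "v \<in> subcube w I" for v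
                using that x(1,3,4) j IJ flip_notin_subcube[of w w I j] subcube_eq
                by (metis disjoint_iff insertE singletonD subcube_self)
              then have "e \<notin> X" using Csub by (auto simp: X_def)
              then show "e \<in> Dj j - X" using inner_j[OF j x(3,4)] x by auto
            qed
            fix F assume F: "F \<subseteq> Dj j - X"
            have "F \<subseteq> cube_edges d" using F by (auto simp: Dj_def edges_in_def)
            then have "?r j F u
                = reach (?Q j) (F \<inter> edges_in d (?Q j)) {flip j u}"
              using fu by (intro reach_restrict) (auto simp: edges_in_def)
            then show "k \<le> card (?r j F u) \<longleftrightarrow>
              k \<le> card (reach (?Q j) (F \<inter> edges_in d (?Q j)) {flip j u})"
              by simp
          qed (use finX in auto)
          also have "\<dots> \<le> rand_prob (Dj j - X) p (\<lambda>F2. Y j (F1 \<union> F2))"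
          proof (intro rand_prob_mono p)
            fix F2 assume "k \<le> card (?r j F2 u)"
            also have "\<dots> \<le> card (?r j (F1 \<union> F2) u)"
            proof (intro card_mono reach_mono_edges)
              show "finite (?r j (F1 \<union> F2) u)"
                using reach_subset[of "{flip j u}" "?Q j" "F1 \<union> F2"] fu subj[OF j] sub(2)
                by (meson empty_subsetI finite_cube_verts finite_subset insert_subset)
            qed (use fu in auto)
            finally show "Y j (F1 \<union> F2)" using u by (auto simp: Y_def)
          qed
          finally show ?thesis using False by simp
        qed (simp add: rand_prob_nonneg p)
      qed
      also have "\<dots> = rand_prob (Dj j) p (Y j)"
        unfolding rand_prob_def by (rule rand_exp_split[OF finX(2) XD, symmetric])
      finally have "rand_prob X p (\<lambda>F. F \<noteq> {}) * (1 - \<rho>) \<le> rand_prob (Dj j) p (Y j)" .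
      moreover have "rand_prob X p (\<lambda>F. F \<noteq> {}) = 1 - (1 - p) ^ card C"
      proof -
        have "rand_prob X p (\<lambda>F. F = {}) = rand_prob X p (\<lambda>F. F \<inter> X = {})"
          by (intro rand_prob_cong) auto
        then show ?thesis
          using rand_prob_not[OF finX(1), of p "\<lambda>F. F = {}"] rand_prob_disjoint[OF finX(1), of X p] cardX by simp
      qed
      moreover have "(1 - (1 - p) ^ k) * (1 - \<rho>) \<le> (1 - (1 - p) ^ card C) * (1 - \<rho>)"
        using C p \<rho> by (intro mult_right_mono) (auto simp: C_def intro!: power_decreasing)
      ultimately show ?thesis by (simp add: q)
    qed
    have dep: "Y j F' \<longleftrightarrow> Y j (F' \<inter> Dj j)" if j: "j \<in> J" and F': "F' \<subseteq> E - D0" for j F'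
    proof -
      have F'c: "F' \<subseteq> cube_edges d" using F' by (auto simp: E_def edges_in_def)
      have "{u, flip j u} \<in> F' \<longleftrightarrow> {u, flip j u} \<in> F' \<inter> Dj j" if "u \<in> C" for u
        using cross_j[OF j, of u] that Csub by auto
      moreover have "?r j F' u = ?r j (F' \<inter> Dj j) u"
        if "u \<in> C" for u
      proof (rule reach_restrict)
        show "{flip j u} \<subseteq> ?Q j" using that Csub flip_in_subcube_flip by auto
        show "{x, y} \<in> F' \<longleftrightarrow> {x, y} \<in> F' \<inter> Dj j"
          if "x \<in> ?Q j" "y \<in> ?Q j" for x y
          using inner_j[OF j that] F'c by auto
      qed
      ultimately show ?thesis unfolding Y_def by (metis (no_types, lifting))
    qed
    have "rand_prob (E - D0) p (\<lambda>F'. (\<Sum>j\<in>J. 1 * of_bool (Y j F')) \<le> q / 4 * (\<Sum>j\<in>J. 1))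
        \<le> exp (- (q * (\<Sum>j\<in>J. 1) / (4 * 1)))"
      by (rule rand_prob_lower_tail[where D = Dj]) (use finJ finE DjE disj dep p Yprob in auto)
    then have tail: "rand_prob (E - D0) p (\<lambda>F'. real (card {j\<in>J. Y j F'}) \<le> q / 4 * real (card J))
        \<le> ?x"
      using finJ by (simp add: Int_def of_bool_def sum.If_cases)
    have count: "real (card {j\<in>J. Y j F'}) \<le> q / 4 * real (card J)"
      if small: "\<not> K \<le> card (reach ?IJ (F0 \<union> F') {w})" for F'
    proof (rule ccontr)
      let ?R = "reach ?IJ (F0 \<union> F') {w}"
      assume "\<not> ?thesis"
      then have many: "q / 4 * real (card J) \<le> real (card {j\<in>J. Y j F'})" by simp
      define Z where "Z = {j\<in>J. Y j F'}"
      have "\<forall>j\<in>Z. \<exists>u\<in>C. {u, flip j u} \<in> F' \<and> k \<le> card (?r j F' u)"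
        by (auto simp: Z_def Y_def)
      then obtain u where u: "\<And>j. j \<in> Z \<Longrightarrow> u j \<in> C \<and> {u j, flip j (u j)} \<in> F'
          \<and> k \<le> card (?r j F' (u j))" by metis
      define Rj where "Rj j = ?r j F' (u j)" for j
      have CR: "C \<subseteq> ?R"
        unfolding C_def using subcube_mono[of I "I \<union> J" w] by (intro reach_mono) (auto intro: reach.base)
      have Rsub: "Rj j \<subseteq> ?Q j" if "j \<in> Z" for j
        unfolding Rj_def using u[OF that] Csub flip_in_subcube_flip by (intro reach_subset) auto
      have RR: "Rj j \<subseteq> ?R" if j: "j \<in> Z" for j
      proof -
        have jJ: "j \<in> J" using j by (simp add: Z_def)
        have 1: "flip j (u j) \<in> ?Q j" using u[OF j] Csub flip_in_subcube_flip by auto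
        have "flip j (u j) \<in> ?R"
        proof (rule reach.step)
          show "u j \<in> ?R" using u[OF j] CR by blast
          show "flip j (u j) \<in> subcube w (I \<union> J)" using 1 subj[OF jJ] by blast
          show "{u j, flip j (u j)} \<in> F0 \<union> F'" using u[OF j] by blast
        qed
        then show ?thesis
          unfolding Rj_def using 1 subj[OF jJ] by (intro reach_mono) auto
      qed
      have finZ: "finite Z" using finJ by (simp add: Z_def)
      have finR: "finite ?R" using reach_subset[of "{w}" ?IJ "F0 \<union> F'"] sub(2)
        by (meson empty_subsetI finite_cube_verts finite_subset insert_subset subcube_self)
      have "real k * real (card Z) = real (\<Sum>j\<in>Z. k)" by simp
      also have "\<dots> \<le> real (\<Sum>j\<in>Z. card (Rj j))"
        using u by (intro of_nat_mono sum_mono) (auto simp: Rj_def)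
      \<comment> \<open>The grown sets lie in different parallel copies, so their sizes add
        up.\<close>
      also have "(\<Sum>j\<in>Z. card (Rj j)) = card (\<Union>j\<in>Z. Rj j)"
      proof (intro card_UN_disjoint[symmetric] finZ ballI impI)
        show "finite (Rj j)" if "j \<in> Z" for j using RR[OF that] finR finite_subset by blast
        fix i j assume "i \<in> Z" "j \<in> Z" "i \<noteq> j"
        then show "Rj i \<inter> Rj j = {}"
          using Rsub subcube_flip_disjoint[of i I j w] IJ by (auto simp: Z_def) blast
      qed
      also have "real (card (\<Union>j\<in>Z. Rj j)) \<le> real (card ?R)"
        using RR finR by (intro of_nat_mono card_mono) auto
      finally have "real k * real (card Z) \<le> real (card ?R)" .
      moreover have "real k * (q / 4 * real (card J)) \<le> real k * real (card Z)"
        using many by (intro mult_left_mono) (auto simp: Z_def)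
      ultimately have "real K \<le> real (card ?R)" using K by linarith
      then show False using small by simp
    qed
    have "rand_prob (E - D0) p (\<lambda>F'. \<not> K \<le> card (reach ?IJ (F0 \<union> F') {w}))
        \<le> ?x"
      by (rule order_trans[OF rand_prob_mono[OF p] tail]) (rule count)
    then show ?thesis using rand_prob_not[of "E - D0" p] finE by (simp add: field_simps)
  qed
  have e1: "0 \<le> 1 - ?x"
  proof -
    have "0 \<le> q" using p \<rho> by (auto simp: q intro!: mult_nonneg_nonneg power_le_one)
    then show ?thesis by simp
  qed
  have "(1 - \<rho>) * (1 - ?x)
      \<le> rand_prob D0 p (\<lambda>F. k \<le> card (reach (subcube w I) F {w})) * (1 - ?x)"
    unfolding D0_def using e1 by (intro mult_right_mono subcube_growth[OF IJ(1) w k p \<rho> D]) auto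
  also have "\<dots> = rand_exp D0 p (\<lambda>F0. of_bool (k \<le> card (reach (subcube w I) F0 {w})) * (1 - ?x))"
    by (simp add: rand_prob_def rand_exp_multc)
  also have "\<dots> \<le> rand_exp D0 p (\<lambda>F0. rand_prob (E - D0) p (\<lambda>F'. K \<le> card (reach ?IJ (F0 \<union> F') {w})))"
  proof (intro rand_exp_mono p)
    fix F0 assume F0: "F0 \<subseteq> D0"
    then show "of_bool (k \<le> card (reach (subcube w I) F0 {w})) * (1 - ?x)
      \<le> rand_prob (E - D0) p (\<lambda>F'. K \<le> card (reach ?IJ (F0 \<union> F') {w}))"
      using main[OF F0] rand_prob_nonneg[OF p] by (cases "k \<le> card (reach (subcube w I) F0 {w})") auto
  qed
  also have "\<dots> = rand_prob E p (\<lambda>F. K \<le> card (reach ?IJ F {w}))"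
    unfolding rand_prob_def by (rule rand_exp_split[OF finE(1) D0E, symmetric])
  finally show ?thesis by (simp add: E_def)
qed

definition big_verts :: "nat \<Rightarrow> nat set set set \<Rightarrow> nat \<Rightarrow> nat set set" where
  "big_verts d F K = {x \<in> cube_verts d. K \<le> card (reach (cube_verts d) F {x})}"

text \<open>As \<open>M\<close> avoids \<open>L\<close>, the neighbours \<open>flip j v\<close> with
  \<open>j \<in> M\<close> lie in pairwise disjoint subcubes with directions \<open>L\<close>, and
  their growth is independent. A component within a subcube can only become larger in the whole
  cube.\<close>

lemma few_big_neighbours:
  assumes LM: "L \<subseteq> {..<d}" "M \<subseteq> {..<d}" "L \<inter> M = {}" and v: "v \<in> cube_verts d" and p: "0 \<le> p" "p \<le> 1"
    and q: "\<And>w. w \<in> cube_verts d \<Longrightarrow> q \<le> rand_prob (edges_in d (subcube w L)) p (\<lambda>F. K \<le> card (reach (subcube w L) F {w}))"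
  shows "rand_prob (cube_edges d) p
      (\<lambda>F. real (cube_degree d (big_verts d F K) v) \<le> q / 4 * real (card M))
    \<le> exp (- (q * real (card M) / 4))"
proof -
  let ?Q = "\<lambda>j. subcube (flip j v) L"
  define Y where "Y j F \<longleftrightarrow> K \<le> card (reach (?Q j) F {flip j v})" for j F
  have finM: "finite M" using LM finite_subset by blast
  have fv: "flip j v \<in> cube_verts d" if "j \<in> M" for j using that v LM by (auto intro: flip_in_cube)
  have sub: "?Q j \<subseteq> cube_verts d" if "j \<in> M" for j
    using subcube_in_cube[OF fv[OF that] LM(1)] .
  have tail: "rand_prob (cube_edges d) p (\<lambda>F. (\<Sum>j\<in>M. 1 * of_bool (Y j F)) \<le> q / 4 * (\<Sum>j\<in>M. 1))
        \<le> exp (- (q * (\<Sum>j\<in>M. 1) / (4 * 1)))"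
  proof (rule rand_prob_lower_tail[where D = "\<lambda>j. edges_in d (?Q j)"])
    show "disjoint_family_on (\<lambda>j. edges_in d (?Q j)) M"
      unfolding disjoint_family_on_def
      using LM by (intro ballI impI edges_in_disjoint subcube_flip_disjoint) auto
    show "Y j F \<longleftrightarrow> Y j (F \<inter> edges_in d (?Q j))" if "j \<in> M" "F \<subseteq> cube_edges d" for j F
    proof -
      have "reach (?Q j) F {flip j v} =
        reach (?Q j) (F \<inter> edges_in d (?Q j)) {flip j v}"
        using that by (intro reach_restrict) (auto simp: edges_in_def)
      then show ?thesis by (simp add: Y_def)
    qed
    show "q \<le> rand_prob (edges_in d (?Q j)) p (Y j)" if "j \<in> M" for j
      using q[OF fv[OF that]] unfolding Y_def .
  qed (use finM p in \<open>auto simp: edges_in_def\<close>)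
  have "rand_prob (cube_edges d) p
      (\<lambda>F. real (cube_degree d (big_verts d F K) v) \<le> q / 4 * real (card M))
    \<le> rand_prob (cube_edges d) p (\<lambda>F. (\<Sum>j\<in>M. 1 * of_bool (Y j F)) \<le> q / 4 * (\<Sum>j\<in>M. 1))"
  proof (intro rand_prob_mono p)
    fix F assume le: "real (cube_degree d (big_verts d F K) v) \<le> q / 4 * real (card M)"
    have "flip j v \<in> big_verts d F K" if "j \<in> M" "Y j F" for j
    proof -
      have "reach (?Q j) F {flip j v} \<subseteq> reach (cube_verts d) F {flip j v}"
        using sub[OF that(1)] by (intro reach_mono) (auto intro: reach.base)
      moreover have "reach (cube_verts d) F {flip j v} \<subseteq> cube_verts d"
        using fv[OF that(1)] by (intro reach_subset) auto
      ultimately have "card (reach (?Q j) F {flip j v}) \<le> card (reach (cube_verts d) F {flip j v})"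
        by (intro card_mono) (auto intro: finite_subset)
      then show ?thesis using that fv by (auto simp: big_verts_def Y_def)
    qed
    then have "(\<lambda>j. flip j v) ` {j \<in> M. Y j F} \<subseteq> {u \<in> big_verts d F K. {v, u} \<in> cube_edges d}"
      using v LM by (auto intro!: flip_edge)
    then have "card ((\<lambda>j. flip j v) ` {j \<in> M. Y j F}) \<le> cube_degree d (big_verts d F K) v"
      by (intro card_mono) (auto simp: big_verts_def)
    then have "real (card {j \<in> M. Y j F}) \<le> q / 4 * real (card M)"
      using le by (simp add: card_image inj_on_def)
    then show "(\<Sum>j\<in>M. 1 * of_bool (Y j F)) \<le> q / 4 * (\<Sum>j\<in>M. 1)"
      using finM by (simp add: Int_def of_bool_def sum.If_cases)
  qed
  also note tail
  finally show ?thesis by simp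
qed

section \<open>The first round of exposure\<close>

lemma rand_exp_card_Collect:
  assumes "finite V"
  shows "rand_exp E p (\<lambda>F. real (card {v \<in> V. P v F})) = (\<Sum>v\<in>V. rand_prob E p (P v))"
proof -
  have "real (card {v \<in> V. P v F}) = (\<Sum>v\<in>V. of_bool (P v F))" for F
    using assms by (simp add: Int_def of_bool_def sum.If_cases)
  then show ?thesis by (simp add: rand_exp_sum rand_prob_def)
qed

lemma rand_prob_count_markov:
  assumes "finite V" "0 \<le> p" "p \<le> 1" "x > 0" "\<And>v. v \<in> V \<Longrightarrow> rand_prob E p (P v) \<le> a"
  shows "rand_prob E p (\<lambda>F. x \<le> real (card {v \<in> V. P v F})) \<le> real (card V) * a / x"
proof -
  have "rand_prob E p (\<lambda>F. x \<le> real (card {v \<in> V. P v F}))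
      \<le> rand_exp E p (\<lambda>F. real (card {v \<in> V. P v F})) / x"
    using assms by (intro rand_prob_markov) auto
  also have "\<dots> = (\<Sum>v\<in>V. rand_prob E p (P v)) / x"
    using assms(1) by (simp add: rand_exp_card_Collect)
  also have "\<dots> \<le> (\<Sum>v\<in>V. a) / x"
    using assms by (intro divide_right_mono sum_mono) auto
  finally show ?thesis by simp
qed

lemma one_minus_power_le_exp:
  fixes x :: real
  assumes "0 \<le> x" "x \<le> 1"
  shows "(1 - x) ^ n \<le> exp (- (x * real n))"
proof -
  have "(1 - x) ^ n \<le> exp (- x) ^ n"
    using assms exp_ge_add_one_self[of "- x"] by (intro power_mono) auto
  then show ?thesis by (simp add: exp_of_nat_mult[symmetric] algebra_simps)
qed

text \<open>This is the supercritical Poisson law of mean \<open>1 + e\<close>. The function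
  \<open>exp (- ((1 + e) * x)) + x\<close> has value 1 and slope \<open>- e\<close> at 0, so it is
  below 1 for small positive \<open>x = 1 - \<rho>\<close>. The inequality suffices; no exact fixed
  point is sought.\<close>

lemma extinction_probability:
  fixes e :: real
  assumes "e > 0"
  obtains \<rho> where "0 < \<rho>" "\<rho> < 1" "exp (- ((1 + e) * (1 - \<rho>))) \<le> \<rho>"
proof -
  have "((\<lambda>x. exp (- ((1 + e) * x)) + x) has_real_derivative - e) (at 0)"
    by (auto intro!: derivative_eq_intros)
  from DERIV_neg_dec_right[OF this] assms
  obtain d where d: "d > 0" "\<And>h. 0 < h \<Longrightarrow> h < d \<Longrightarrow> exp (- ((1 + e) * h)) + h < 1"
    by auto
  define x where "x = min (d / 2) (1 / 2)"
  have "0 < x" "x < d" "x < 1" using d by (auto simp: x_def)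
  then show ?thesis using d(2)[of x] by (intro that[of "1 - x"]) auto
qed

lemma card_edges_at:
  assumes "v \<in> cube_verts d" "F \<subseteq> cube_edges d"
  shows "card {e \<in> F. v \<in> e} \<le> d"
proof -
  have "{e \<in> F. v \<in> e} \<subseteq> (\<lambda>j. {v, flip j v}) ` {..<d}"
  proof
    fix e assume "e \<in> {e \<in> F. v \<in> e}"
    then have "e \<in> cube_edges d" "v \<in> e" using assms by auto
    then obtain u j where e: "e = {u, flip j u}" "u \<in> cube_verts d" "flip j u \<in> cube_verts d" "v \<in> e"
      by (auto elim!: cube_edgeE)
    then have "e = {v, flip j v}" by auto
    moreover have "j < d" using e flip_in_cube_less by blast
    ultimately show "e \<in> (\<lambda>j. {v, flip j v}) ` {..<d}" by auto
  qed
  then show ?thesis using surj_card_le[of "{..<d}" "{e \<in> F. v \<in> e}"] by auto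
qed

text \<open>Markov's inequality for the exponential of the degree, with
  \<open>exp 1 - 1 \<le> 2\<close>. For bounded \<open>p * d\<close>, the choice
  \<open>x = 5 * ln d\<close> makes the bound of order d^(-5).\<close>

lemma vertex_degree_tail:
  assumes v: "v \<in> cube_verts d" and p: "0 \<le> p" "p \<le> 1"
  shows "rand_prob (cube_edges d) p (\<lambda>F. x \<le> real (card {e \<in> F. v \<in> e})) \<le> exp (2 * (p * real d) - x)"
proof -
  define D where "D = {e \<in> cube_edges d. v \<in> e}"
  have cD: "card D \<le> d" unfolding D_def using v by (rule card_edges_at) simp
  have D: "D \<subseteq> cube_edges d" by (auto simp: D_def)
  have FD: "{e \<in> F. v \<in> e} = F \<inter> D" if "F \<subseteq> cube_edges d" for F using that by (auto simp: D_def)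
  have "rand_prob (cube_edges d) p (\<lambda>F. x \<le> real (card {e \<in> F. v \<in> e}))
      \<le> rand_prob (cube_edges d) p (\<lambda>F. exp x \<le> exp 1 ^ card (F \<inter> D))"
    by (intro rand_prob_mono p) (simp add: FD exp_of_nat_mult[symmetric])
  also have "\<dots> \<le> rand_exp (cube_edges d) p (\<lambda>F. exp 1 ^ card (F \<inter> D)) / exp x"
    by (intro rand_prob_markov p) auto
  also have "rand_exp (cube_edges d) p (\<lambda>F. exp 1 ^ card (F \<inter> D)) = (1 + p * (exp 1 - 1)) ^ card D"
    using rand_exp_card[OF finite_cube_edges D, of p "exp 1"] by (simp add: algebra_simps)
  also have "\<dots> \<le> (1 + p * (exp 1 - 1)) ^ d"
    using p cD exp_ge_add_one_self[of "1::real"] by (intro power_increasing) auto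
  also have "\<dots> \<le> exp (p * 2) ^ d"
  proof (intro power_mono)
    have "p * (exp 1 - 1) \<le> p * 2" using p exp_le by (intro mult_left_mono) auto
    then show "1 + p * (exp 1 - 1) \<le> exp (p * 2)" using exp_ge_add_one_self[of "p * 2"] by linarith
    have "0 \<le> p * (exp 1 - 1)" using p exp_ge_add_one_self[of "1::real"] by (intro mult_nonneg_nonneg) auto
    then show "0 \<le> 1 + p * (exp 1 - 1)" by linarith
  qed
  also have "exp (p * 2) ^ d / exp x = exp (2 * (p * real d) - x)"
    by (simp add: exp_of_nat_mult[symmetric] exp_diff algebra_simps)
  finally show ?thesis by (simp add: divide_right_mono)
qed

text \<open>Both exceptional sets must be negligible after later losses. A poor vertex costs up to d
  cross pairs. A vertex of high degree, if deleted, costs up to d edges, each damaging C d vertices,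
  with a further factor of order d for pairs; so fewer than 2^d / d^4 of them cost O(2^d /
  d).\<close>

definition typical :: "real \<Rightarrow> nat \<Rightarrow> nat \<Rightarrow> nat set set set \<Rightarrow> bool" where
  "typical \<theta> C d F \<longleftrightarrow>
     real (card {v \<in> cube_verts d. real (cube_degree d (big_verts d F (C * d)) v) \<le> \<theta> * real d})
       < 2 ^ d / real d ^ 2 \<and>
     real (card {v \<in> cube_verts d. 5 * ln (real d) \<le> real (card {e \<in> F. v \<in> e})}) < 2 ^ d / real d ^ 4"

text \<open>The quantifier order matters: \<theta> is fixed before \<open>C\<close>, because
  \<open>C\<close> will be chosen large in terms of \<theta>. This is possible since growth to order
  d^2 eventually beats \<open>C * d\<close> for every \<open>C\<close>.\<close>

lemma first_round_typical:
  fixes e B :: real and p :: "nat \<Rightarrow> real"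
  assumes e: "e > 0"
    and p: "\<forall>\<^sub>F d in sequentially. 0 \<le> p d \<and> p d \<le> 1 \<and> 1 + e \<le> p d * real d \<and> p d * real d \<le> B"
  obtains \<theta> where "\<theta> > 0" "\<theta> \<le> 1"
    "\<And>C. (\<lambda>d. rand_prob (cube_edges d) (p d) (\<lambda>F. \<not> typical \<theta> C d F)) \<longlonglongrightarrow> 0"
proof -
  \<comment> \<open>About \<eta> d directions are given up three times: for the blocks
    \<open>J\<close> and \<open>M\<close> and for the spare degree of the branching. The mean
    offspring must remain \<open>1 + e / 2\<close>.\<close>
  define \<eta> where "\<eta> = e / (6 * (1 + e))"
  have \<eta>: "0 < \<eta>" "\<eta> < 1 / 6" "(1 + e) * (1 - 3 * \<eta>) = 1 + e / 2"
    using e by (auto simp: \<eta>_def field_simps)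
  obtain \<rho> where \<rho>: "0 < \<rho>" "\<rho> < 1" "exp (- ((1 + e / 2) * (1 - \<rho>))) \<le> \<rho>"
    using extinction_probability[of "e / 2"] e by auto
  \<comment> \<open>The eventual lower bound for the success probability \<open>q\<close> of one
    copy: \<open>p d * h d\<close> tends to at least \<open>(1 + e) * \<eta>\<close>, so it
    eventually exceeds \<open>\<eta> / 2\<close>.\<close>
  define q0 where "q0 = (1 - exp (- (\<eta> / 2))) * (1 - \<rho>)"
  have q0: "q0 > 0" using \<eta> \<rho> by (simp add: q0_def)
  define c2 where "c2 = (1 - \<rho>) / 2"
  have c2: "c2 > 0" "c2 < 1" using \<rho> by (auto simp: c2_def)
  \<comment> \<open>This is \<open>c2 / 4\<close>, the fraction kept by the lower tail, times
    \<open>\<eta> / 2\<close>, an eventual lower bound for \<open>card M / d\<close>.\<close>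
  define \<theta> where "\<theta> = c2 * \<eta> / 8"
  have \<theta>: "\<theta> > 0" using c2 \<eta> by (simp add: \<theta>_def)
  have "c2 * \<eta> < 1 * 1" using c2 \<eta> by (intro mult_strict_mono) auto
  then have \<theta>1: "\<theta> \<le> 1" by (simp add: \<theta>_def)
  define h where "h d = nat \<lfloor>\<eta> * real d\<rfloor>" for d
  have h: "real (h d) \<le> \<eta> * real d" "\<eta> * real d - 1 \<le> real (h d)" for d
    using \<eta> by (auto simp: h_def)
  show ?thesis
  proof (rule that[OF \<theta> \<theta>1])
    fix C :: nat
    have ev: "\<forall>\<^sub>F d in sequentially. \<eta> / 2 \<le> (1 + e) / real d * (\<eta> * real d - 1)"
      "\<forall>\<^sub>F d in sequentially. real C * real d \<le> (\<eta> * real d - 1) * (q0 / 4 * (\<eta> * real d - 1))"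
      "\<forall>\<^sub>F d in sequentially. exp (- (q0 * (\<eta> * real d - 1) / 4)) \<le> 1 / 2"
      "\<forall>\<^sub>F d in sequentially. \<eta> / 2 * real d \<le> \<eta> * real d - 1"
      "\<forall>\<^sub>F d in sequentially. (1::real) \<le> \<eta> * real d"
      using e \<eta> q0 by real_asymp+
    have bound: "\<forall>\<^sub>F d in sequentially. rand_prob (cube_edges d) (p d) (\<lambda>F. \<not> typical \<theta> C d F)
        \<le> real d ^ 2 * exp (- (\<theta> * real d)) + exp (2 * B) / real d"
      using p ev eventually_gt_at_top[of 0]
    proof eventually_elim
      case (elim d)
      define I J M where "I = {..<d - 2 * h d}" and "J = {d - 2 * h d..<d - h d}" and "M = {d - h d..<d}"
      have hd: "real (3 * h d) < real d"
      proof -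
        have "\<eta> * real d < 1 / 6 * real d" using \<eta>(2) elim(7) by (intro mult_strict_right_mono) auto
        then show ?thesis using h(1)[of d] by simp
      qed
      then have hd': "3 * h d < d" by (simp only: of_nat_less_iff)
      have cards: "card I = d - 2 * h d" "card J = h d" "card M = h d" using hd' by (auto simp: I_def J_def M_def)
      let ?pr = "rand_prob (cube_edges d) (p d)" and ?deg = "\<lambda>F v. real (cube_degree d (big_verts d F (C * d)) v)"
      have sets: "I \<subseteq> {..<d}" "J \<subseteq> {..<d}" "I \<inter> J = {}" "I \<union> J \<subseteq> {..<d}" "M \<subseteq> {..<d}" "(I \<union> J) \<inter> M = {}"
        by (auto simp: I_def J_def M_def)
      have p': "0 \<le> p d" "p d \<le> 1" "1 + e \<le> p d * real d" "p d * real d \<le> B" using elim by auto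
      have pd: "(1 + e) / real d \<le> p d" using p'(3) elim(7) by (simp add: divide_le_eq)
      define D where "D = d - 3 * h d"
      have D: "(1 - p d + p d * \<rho>) ^ D \<le> \<rho>"
      proof -
        have "(1 + e) * (1 - 3 * \<eta>) = (1 + e) / real d * (real d - 3 * (\<eta> * real d))"
          using elim(7) by (simp add: field_simps)
        then have "1 + e / 2 = (1 + e) / real d * (real d - 3 * (\<eta> * real d))"
          using \<eta>(3) by linarith
        also have "\<dots> \<le> p d * real D"
          using pd h(1)[of d] hd' p' e \<eta> by (intro mult_mono) (auto simp: D_def of_nat_diff)
        finally have "(1 + e / 2) * (1 - \<rho>) \<le> p d * real D * (1 - \<rho>)"
          using \<rho> by (intro mult_right_mono) auto
        then have "exp (- (p d * (1 - \<rho>) * real D)) \<le> exp (- ((1 + e / 2) * (1 - \<rho>)))"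
          by (simp add: algebra_simps)
        moreover have "(1 - p d * (1 - \<rho>)) ^ D \<le> exp (- (p d * (1 - \<rho>) * real D))"
          using p' \<rho> by (intro one_minus_power_le_exp) (auto intro!: mult_nonneg_nonneg mult_le_one)
        moreover have "1 - p d + p d * \<rho> = 1 - p d * (1 - \<rho>)" by (simp add: algebra_simps)
        ultimately show ?thesis using \<rho>(3) by (simp only:)
      qed
      define q where "q = (1 - (1 - p d) ^ h d) * (1 - \<rho>)"
      have "q0 \<le> q"
      proof -
        have "\<eta> / 2 \<le> (1 + e) / real d * (\<eta> * real d - 1)" by (fact elim)
        also have "\<dots> \<le> p d * real (h d)"
          using pd h(2)[of d] p' elim(6) by (intro mult_mono) auto
        finally have "(1 - p d) ^ h d \<le> exp (- (\<eta> / 2))"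
          using one_minus_power_le_exp[OF p'(1,2), of "h d"] by (smt (verit) exp_le_cancel_iff)
        then show ?thesis unfolding q_def q0_def using \<rho> by (intro mult_right_mono) auto
      qed
      have "c2 \<le> rand_prob (edges_in d (subcube w (I \<union> J))) (p d) (\<lambda>F. C * d \<le> card (reach (subcube w (I \<union> J)) F {w}))"
        if w: "w \<in> cube_verts d" for w
      proof -
        have "exp (- (q * real (card J) / 4)) \<le> exp (- (q0 * (\<eta> * real d - 1) / 4))"
          using \<open>q0 \<le> q\<close> h(2)[of d] q0 elim(6) by (auto simp: cards intro!: mult_mono)
        also have "\<dots> \<le> 1 / 2" by (fact elim)
        finally have "(1 - \<rho>) * (1 / 2) \<le> (1 - \<rho>) * (1 - exp (- (q * real (card J) / 4)))"
          using \<rho> by (intro mult_left_mono) auto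
        also have "\<dots> \<le> rand_prob (edges_in d (subcube w (I \<union> J))) (p d) (\<lambda>F. C * d \<le> card (reach (subcube w (I \<union> J)) F {w}))"
        proof (rule subcube_growth_square[OF sets(1-3) w _ p'(1,2) _ _ D q_def])
          have "real (C * d) \<le> (\<eta> * real d - 1) * (q0 / 4 * (\<eta> * real d - 1))" using elim by simp
          also have "\<dots> \<le> real (h d) * (q / 4 * real (card J))"
            using h(2)[of d] \<open>q0 \<le> q\<close> q0 elim(6) by (intro mult_mono) (auto simp: cards)
          finally show "real (C * d) \<le> real (h d) * (q / 4 * real (card J))" .
          show "D + h d \<le> card I" using hd' by (simp add: cards D_def)
        qed (use \<rho> in auto)
        finally show ?thesis by (simp add: c2_def)
      qed
      note nbr = few_big_neighbours[OF sets(4-6) _ p'(1,2) this]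
      have \<theta>h: "\<theta> * real d \<le> c2 / 4 * real (card M)"
      proof -
        have "\<eta> / 2 * real d \<le> real (h d)" using elim(5) h(2)[of d] by linarith
        then have "c2 / 4 * (\<eta> / 2 * real d) \<le> c2 / 4 * real (h d)" using c2 by (intro mult_left_mono) auto
        then show ?thesis by (simp add: \<theta>_def cards)
      qed
      have b1: "?pr
          (\<lambda>F. ?deg F v \<le> \<theta> * real d) \<le> exp (- (\<theta> * real d))"
        if v: "v \<in> cube_verts d" for v
      proof -
        have "?pr
          (\<lambda>F. ?deg F v \<le> \<theta> * real d)
          \<le> ?pr
          (\<lambda>F. ?deg F v \<le> c2 / 4 * real (card M))"
          using \<theta>h by (intro rand_prob_mono p') auto
        also have "\<dots> \<le> exp (- (c2 * real (card M) / 4))" by (rule nbr[OF v])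
        also have "\<dots> \<le> exp (- (\<theta> * real d))" using \<theta>h by simp
        finally show ?thesis .
      qed
      have b2: "?pr (\<lambda>F. 5 * ln (real d) \<le> real (card {e \<in> F. v \<in> e}))
          \<le> exp (2 * B) / real d ^ 5" if v: "v \<in> cube_verts d" for v
      proof -
        have "exp (2 * (p d * real d) - 5 * ln (real d)) \<le> exp (2 * B - 5 * ln (real d))"
          using p' by simp
        also have "\<dots> = exp (2 * B) / exp (ln (real d)) ^ 5"
          by (simp add: exp_diff exp_of_nat_mult[symmetric])
        finally show ?thesis using vertex_degree_tail[OF v p'(1,2), of "5 * ln (real d)"] elim(7) by simp
      qed
      let ?poor = "\<lambda>F. 2 ^ d / real d ^ 2
          \<le> real (card {v \<in> cube_verts d. ?deg F v \<le> \<theta> * real d})"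
        and ?high = "\<lambda>F. 2 ^ d / real d ^ 4
          \<le> real (card {v \<in> cube_verts d. 5 * ln (real d) \<le> real (card {e \<in> F. v \<in> e})})"
      have "?pr (\<lambda>F. \<not> typical \<theta> C d F)
          \<le> ?pr (\<lambda>F. ?poor F \<or> ?high F)"
        by (intro rand_prob_mono p') (auto simp: typical_def)
      also have "\<dots> \<le> ?pr ?poor + ?pr ?high"
        by (intro rand_prob_disj_le p')
      also have "\<dots> \<le> real (card (cube_verts d)) * exp (- (\<theta> * real d)) / (2 ^ d / real d ^ 2)
          + real (card (cube_verts d)) * (exp (2 * B) / real d ^ 5) / (2 ^ d / real d ^ 4)"
        using elim(7) by (intro add_mono rand_prob_count_markov p' b1 b2) auto
      also have "\<dots> = real d ^ 2 * exp (- (\<theta> * real d)) + exp (2 * B) / real d"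
        using elim(7) by (simp add: field_simps power_numeral_reduce)
      finally show ?case .
    qed
    have nonneg: "\<forall>\<^sub>F d in sequentially. 0 \<le> rand_prob (cube_edges d) (p d) (\<lambda>F. \<not> typical \<theta> C d F)"
      using p by eventually_elim (auto intro: rand_prob_nonneg)
    have "(\<lambda>d. real d ^ 2 * exp (- (\<theta> * real d)) + exp (2 * B) / real d) \<longlonglongrightarrow> 0"
      using \<theta> by real_asymp
    then show "(\<lambda>d. rand_prob (cube_edges d) (p d) (\<lambda>F. \<not> typical \<theta> C d F)) \<longlonglongrightarrow> 0"
      by (rule tendsto_sandwich[OF nonneg bound tendsto_const])
  qed
qed

section \<open>Isoperimetry and damaged components\<close>

lemma flip_commute: "flip i (flip j x) = flip j (flip i x)"
  by (auto simp: set_eq_iff mem_flip)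

lemma cube_verts_Suc: "cube_verts (Suc d) = cube_verts d \<union> flip d ` cube_verts d"
proof (intro subset_antisym subsetI)
  fix x assume x: "x \<in> cube_verts (Suc d)"
  show "x \<in> cube_verts d \<union> flip d ` cube_verts d"
  proof (cases "d \<in> x")
    case True
    then have "flip d x \<in> cube_verts d" using x by (auto simp: cube_verts_def mem_flip subset_iff less_Suc_eq)
    then have "flip d (flip d x) \<in> flip d ` cube_verts d" by (rule imageI)
    then show ?thesis by simp
  next
    case False
    then show ?thesis using x by (auto simp: cube_verts_def subset_iff less_Suc_eq)
  qed
qed (auto simp: cube_verts_def mem_flip subset_iff less_Suc_eq)

text \<open>Equivalent to the spectral gap 2 of the cube Laplacian. In the induction the halves
  \<open>A0\<close>, \<open>A1\<close> contribute their own boundaries, and the new direction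
  contributes the size of their symmetric difference.\<close>

lemma edge_isoperimetry:
  assumes "A \<subseteq> cube_verts d"
  shows "2 * real (card A) * (2 ^ d - real (card A)) \<le> 2 ^ d * real (\<Sum>j<d. card {x \<in> A. flip j x \<notin> A})"
  using assms
proof (induction d arbitrary: A)
  case 0
  then have "A = {} \<or> A = {{}}" by (auto simp: cube_verts_def)
  then show ?case by auto
next
  case (Suc d)
  define A0 where "A0 = A \<inter> cube_verts d"
  define A1 where "A1 = {x \<in> cube_verts d. flip d x \<in> A}"
  have sub: "A0 \<subseteq> cube_verts d" "A1 \<subseteq> cube_verts d" by (auto simp: A0_def A1_def)
  then have fin: "finite A0" "finite A1" by (auto intro: finite_subset)
  have inj: "inj_on (flip d) X" for X by (auto simp: inj_on_def)
  have disj: "X \<inter> flip d ` Y = {}" if "X \<subseteq> cube_verts d" "Y \<subseteq> cube_verts d" for X Y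
    using that by (fastforce simp: cube_verts_def mem_flip)
  have AA: "A = A0 \<union> flip d ` A1"
    using Suc.prems unfolding cube_verts_Suc A0_def A1_def by auto
  have cardA: "card A = card A0 + card A1"
    unfolding AA using fin disj[OF sub] by (simp add: card_Un_disjoint card_image[OF inj])
  have split: "card {x \<in> A. flip j x \<notin> A} = card {x \<in> A0. flip j x \<notin> A0} + card {x \<in> A1. flip j x \<notin> A1}"
    if j: "j < d" for j
  proof -
    have 0: "flip j x \<in> A \<longleftrightarrow> flip j x \<in> A0" if "x \<in> cube_verts d" for x
      using flip_in_cube[OF that j] by (auto simp: A0_def)
    have 1: "flip j (flip d x) \<in> A \<longleftrightarrow> flip j x \<in> A1" if "x \<in> cube_verts d" for x
      using flip_in_cube[OF that j] by (auto simp: A1_def flip_commute[of j d])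
    have "{x \<in> A. flip j x \<notin> A} = {x \<in> A0. flip j x \<notin> A} \<union> flip d ` {x \<in> A1. flip j (flip d x) \<notin> A}"
      by (subst AA) auto
    also have "{x \<in> A0. flip j x \<notin> A} = {x \<in> A0. flip j x \<notin> A0}" using 0 sub by blast
    also have "{x \<in> A1. flip j (flip d x) \<notin> A} = {x \<in> A1. flip j x \<notin> A1}" using 1 sub by blast
    finally show ?thesis
      using fin sub by (simp add: card_Un_disjoint card_image[OF inj] disj subset_iff)
  qed
  have last: "card {x \<in> A. flip d x \<notin> A} = card (A0 - A1) + card (A1 - A0)"
  proof -
    have "{x \<in> A. flip d x \<notin> A} = {x \<in> A0. flip d x \<notin> A} \<union> flip d ` {x \<in> A1. x \<notin> A}"
      by (subst AA) auto
    also have "{x \<in> A0. flip d x \<notin> A} = A0 - A1" using sub by (auto simp: A1_def)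
    also have "{x \<in> A1. x \<notin> A} = A1 - A0" using sub by (auto simp: A0_def)
    finally show ?thesis
      using fin sub by (simp add: card_Un_disjoint card_image[OF inj] disj subset_iff)
  qed
  define m a0 a1 b0 b1 \<delta> :: real where "m = 2 ^ d" and "a0 = card A0" and "a1 = card A1"
    and "b0 = (\<Sum>j<d. card {x \<in> A0. flip j x \<notin> A0})" and "b1 = (\<Sum>j<d. card {x \<in> A1. flip j x \<notin> A1})"
    and "\<delta> = card (A0 - A1) + card (A1 - A0)"
  have IH: "2 * a0 * (m - a0) \<le> m * b0" "2 * a1 * (m - a1) \<le> m * b1"
    unfolding m_def a0_def a1_def b0_def b1_def using Suc.IH sub by auto
  have \<delta>: "\<bar>a0 - a1\<bar> \<le> \<delta>" "\<delta> \<ge> 0"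
  proof -
    have "card A0 \<le> card (A0 - A1) + card A1" "card A1 \<le> card (A1 - A0) + card A0"
      using fin by (metis add.commute card_Diff_subset_Int card_Un_le card_mono diff_card_le_card_Diff finite_Int le_diff_conv)+
    then show "\<bar>a0 - a1\<bar> \<le> \<delta>" "\<delta> \<ge> 0" by (simp_all add: a0_def a1_def \<delta>_def)
  qed
  have am: "\<bar>a0 - a1\<bar> \<le> m"
  proof -
    have "card A0 \<le> 2 ^ d" "card A1 \<le> 2 ^ d"
      using card_mono[OF finite_cube_verts sub(1)] card_mono[OF finite_cube_verts sub(2)] by simp_all
    then have "a0 \<le> m" "a1 \<le> m" "0 \<le> a0" "0 \<le> a1"
      unfolding a0_def a1_def m_def by (metis of_nat_le_iff of_nat_numeral of_nat_power of_nat_0_le_iff)+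
    then show ?thesis by linarith
  qed
  have "(a0 - a1)\<^sup>2 = \<bar>a0 - a1\<bar> * \<bar>a0 - a1\<bar>" by (simp add: power2_eq_square)
  also have "\<dots> \<le> m * \<delta>" using am \<delta> by (intro mult_mono) auto
  finally have sq: "(a0 - a1)\<^sup>2 \<le> m * \<delta>" .
  \<comment> \<open>The defect \<open>(a0 - a1)\<^sup>2\<close> between the two scales is exactly
    what the edges of the new direction pay for.\<close>
  have "2 * (a0 + a1) * (2 * m - (a0 + a1)) = 2 * (2 * a0 * (m - a0)) + 2 * (2 * a1 * (m - a1)) + 2 * (a0 - a1)\<^sup>2"
    by (simp add: power2_eq_square algebra_simps)
  also have "\<dots> \<le> 2 * (m * b0) + 2 * (m * b1) + 2 * (m * \<delta>)" using IH sq by linarith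
  also have "\<dots> = 2 * m * (b0 + b1 + \<delta>)" by (simp add: algebra_simps)
  finally have "2 * (a0 + a1) * (2 * m - (a0 + a1)) \<le> 2 * m * (b0 + b1 + \<delta>)" .
  moreover have "real (\<Sum>j<Suc d. card {x \<in> A. flip j x \<notin> A}) = b0 + b1 + \<delta>"
    by (simp add: split last b0_def b1_def \<delta>_def sum.distrib)
  moreover have "real (card A) = a0 + a1" by (simp add: cardA a0_def a1_def)
  ultimately show ?case by (simp add: m_def)
qed

text \<open>\<open>A\<close> and \<open>B\<close> may overlap and may fail to cover the cube. A set
  \<open>T\<close> between the complement of \<open>B\<close> and \<open>A \<union> Z\<close> has
  all its boundary edges leading from \<open>A \<union> Z\<close> into \<open>B\<close>; those
  starting in \<open>Z\<close> or touching \<open>S\<close> at either end are discarded.\<close>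

lemma many_cross_pairs:
  assumes AB: "A \<subseteq> cube_verts d" "B \<subseteq> cube_verts d" and S: "S \<subseteq> cube_verts d"
    and a: "a \<le> card A" "a \<le> card B" "2 * a \<le> 2 ^ d"
  shows "a \<le> card {(x, y). x \<in> A - S \<and> y \<in> B - S \<and> {x, y} \<in> cube_edges d}
            + d * card (cube_verts d - (A \<union> B)) + 2 * d * card S"
proof -
  let ?V = "cube_verts d"
  define H where "H = {(x, y). x \<in> A - S \<and> y \<in> B - S \<and> {x, y} \<in> cube_edges d}"
  define Z where "Z = ?V - (A \<union> B)"
  have fin: "finite A" "finite B" "finite S" "finite Z" using AB S by (auto intro: finite_subset simp: Z_def)
  have "H \<subseteq> A \<times> B" by (auto simp: H_def)
  then have finH: "finite H" using fin by (meson finite_SigmaI finite_subset)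
  have "\<exists>T. ?V - B \<subseteq> T \<and> T \<subseteq> A \<union> Z \<and> a \<le> card T \<and> card T \<le> 2 ^ d - a"
  proof -
    have c1: "card (?V - B) = 2 ^ d - card B" using AB fin by (simp add: card_Diff_subset)
    have c2: "a \<le> card (A \<union> Z)" using a(1) card_mono[of "A \<union> Z" A] fin by simp
    have sub: "?V - B \<subseteq> A \<union> Z" by (auto simp: Z_def)
    \<comment> \<open>Both entries are at most \<open>2 ^ d - a\<close>, by
      \<open>a \<le> card B\<close> and \<open>2 * a \<le> 2 ^ d\<close>, so \<open>T\<close> is
      neither too small nor too large.\<close>
    define k where "k = max a (card (?V - B))"
    have "k \<le> card (A \<union> Z)" using c2 card_mono[OF _ sub] fin by (simp add: k_def)
    then obtain T where "?V - B \<subseteq> T" "T \<subseteq> A \<union> Z" "card T = k"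
      using exists_subset_between[of "?V - B" k "A \<union> Z"] sub fin by (auto simp: k_def)
    then show ?thesis using a c1 by (intro exI[of _ T]) (auto simp: k_def)
  qed
  then obtain T where T: "?V - B \<subseteq> T" "T \<subseteq> A \<union> Z" "a \<le> card T" "card T \<le> 2 ^ d - a" by blast
  have TV: "T \<subseteq> ?V" using T AB by (auto simp: Z_def)
  then have finT: "finite T" by (auto intro: finite_subset)
  define P where "P = (SIGMA j:{..<d}. {x \<in> T. flip j x \<notin> T})"
  have cardP: "card P = (\<Sum>j<d. card {x \<in> T. flip j x \<notin> T})"
    unfolding P_def using finT by (intro card_SigmaI) auto
  let ?H = "(\<lambda>(j, x). (x, flip j x)) -` H \<inter> ({..<d} \<times> T)"
  let ?Q = "?H \<union> {..<d} \<times> Z \<union> {..<d} \<times> S \<union> (SIGMA j:{..<d}. flip j ` S)"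
  have "real a * 2 ^ d \<le> 2 * real (card T) * (2 ^ d - real (card T))"
  proof -
    define t n :: real where "t = card T" and "n = 2 ^ d"
    have "card T + a \<le> 2 ^ d" using T(4) a(3) by linarith
    then have "t + a \<le> n" unfolding t_def n_def by (metis of_nat_add of_nat_le_iff of_nat_numeral of_nat_power)
    moreover have "a \<le> t" using T by (simp add: t_def)
    moreover have "2 * a \<le> n" unfolding n_def using a(3) by (metis of_nat_le_iff of_nat_numeral of_nat_power)
    \<comment> \<open>The first product gives \<open>t * (n - t) \<ge> a * (n - a)\<close>, the
      second \<open>2 * a * (n - a) \<ge> a * n\<close>.\<close>
    ultimately have "0 \<le> (t - a) * (n - t - a)" "0 \<le> real a * (n - 2 * real a)"
      by (auto intro!: mult_nonneg_nonneg)
    then show ?thesis by (simp add: t_def[symmetric] n_def[symmetric] algebra_simps)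
  qed
  also have "\<dots> \<le> 2 ^ d * real (card P)" unfolding cardP by (rule edge_isoperimetry[OF TV])
  finally have "real a \<le> real (card P)" by (simp add: mult.commute)
  then have "a \<le> card P" by simp
  also have "P \<subseteq> ?Q"
  proof
    fix jx assume "jx \<in> P"
    then obtain j x where jx: "jx = (j, x)" "j < d" "x \<in> T" "flip j x \<notin> T" by (auto simp: P_def)
    have xV: "x \<in> ?V" using jx TV by auto
    then have "flip j x \<in> ?V" using jx by (intro flip_in_cube)
    then have "flip j x \<in> B" using jx T by blast
    moreover have "x \<in> A \<or> x \<in> Z" using jx T by blast
    moreover have "{x, flip j x} \<in> cube_edges d" using xV jx by (intro flip_edge)
    moreover have "x \<in> flip j ` S" if "flip j x \<in> S" using that by (metis flip_flip imageI)
    ultimately show "jx \<in> ?Q"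
      using jx by (auto simp: H_def)
  qed
  then have "card P \<le> card ?Q"
    using fin finT by (intro card_mono) auto
  also have "\<dots> \<le> card ?H + card ({..<d} \<times> Z) + card ({..<d} \<times> S)
      + card (SIGMA j:{..<d}. flip j ` S)"
    by (intro order_trans[OF card_Un_le] add_mono order_refl)
  also have "card ?H \<le> card H"
    using finH by (intro card_vimage_inj_on_le) (auto simp: inj_on_def)
  also have "card (SIGMA j:{..<d}. flip j ` S) = d * card S"
    using fin by (simp add: card_SigmaI card_image inj_on_def)
  finally show ?thesis by (simp add: H_def Z_def card_cartesian_product)
qed

lemma sum_card_swap:
  assumes "finite X" "finite Y"
  shows "(\<Sum>x\<in>X. card {y \<in> Y. P x y}) = (\<Sum>y\<in>Y. card {x \<in> X. P x y})"
proof -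
  have "(\<Sum>x\<in>X. card {y \<in> Y. P x y}) = (\<Sum>x\<in>X. \<Sum>y\<in>Y. of_bool (P x y))"
    using assms by (simp add: Int_def of_bool_def sum.If_cases)
  also have "\<dots> = (\<Sum>y\<in>Y. \<Sum>x\<in>X. of_bool (P x y))" by (rule sum.swap)
  also have "\<dots> = (\<Sum>y\<in>Y. card {x \<in> X. P x y})"
    using assms by (simp add: Int_def of_bool_def sum.If_cases)
  finally show ?thesis .
qed

lemma sum_card_cube_nbrs:
  assumes "Y \<subseteq> cube_verts d"
  shows "(\<Sum>x\<in>cube_verts d. cube_degree d Y x) = d * card Y"
proof -
  have "(\<Sum>x\<in>cube_verts d. cube_degree d Y x)
      = (\<Sum>y\<in>Y. card {x \<in> cube_verts d. {x, y} \<in> cube_edges d})"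
    using assms by (intro sum_card_swap) (auto intro: finite_subset)
  also have "\<dots> = (\<Sum>y\<in>Y. d)"
    using assms by (intro sum.cong refl) (auto simp: insert_commute[of _ _ "{}"] card_cube_nbrs subset_iff)
  finally show ?thesis by simp
qed

section \<open>Components under deletion of vertices\<close>

lemma reach_sym:
  assumes "x \<in> V" "y \<in> reach V F {x}"
  shows "x \<in> reach V F {y}"
  using assms(2)
proof induction
  case (step z y)
  have "z \<in> V" using step.hyps(1) reach_subset[of "{x}" V F] assms(1) by auto
  have "z \<in> reach V F {y}"
  proof (rule reach.step)
    show "y \<in> reach V F {y}" by (simp add: reach.base)
    show "{y, z} \<in> F" using step.hyps(3) by (simp add: insert_commute)
  qed fact
  then have "reach V F {z} \<subseteq> reach V F {y}" using \<open>z \<in> V\<close> by (intro reach_mono) auto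
  then show ?case using step.IH by blast
qed (auto intro: reach.base)

lemma reach_eq:
  assumes "x \<in> V" "y \<in> reach V F {x}"
  shows "reach V F {y} = reach V F {x}"
proof -
  have "y \<in> V" using assms reach_subset[of "{x}" V F] by auto
  then show ?thesis
    using assms reach_sym[OF assms] by (intro subset_antisym reach_mono) auto
qed

definition big_parts :: "'a set \<Rightarrow> 'a set set \<Rightarrow> nat \<Rightarrow> 'a set" where
  "big_parts V F K = {x \<in> V. K \<le> card (reach V F {x})}"

lemma big_verts_eq: "big_verts d F K = big_parts (cube_verts d) F K"
  by (simp add: big_verts_def big_parts_def)

text \<open>A vertex whose component shrinks below \<open>K\<close> when \<open>S\<close> is deleted lies in a small component
  hanging off some edge at \<open>S\<close>.\<close>

lemma card_damaged:
  assumes "finite V" "finite F" "S \<subseteq> V"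
  shows "card (big_parts V F K - big_parts (V - S) F K) \<le> card S + K * (\<Sum>s\<in>S. card {e \<in> F. s \<in> e})"
proof -
  let ?B = "big_parts V F K - big_parts (V - S) F K"
  define N where "N s = {x \<in> V - S. {s, x} \<in> F \<and> card (reach (V - S) F {x}) < K}" for s
  have finS: "finite S" using assms finite_subset by blast
  have finN: "finite (N s)" for s using assms(1) by (simp add: N_def)
  have cardN: "card (N s) \<le> card {e \<in> F. s \<in> e}" for s
  proof -
    have "inj_on (\<lambda>x. {s, x}) (N s)" by (auto simp: inj_on_def doubleton_eq_iff)
    then have "card (N s) = card ((\<lambda>x. {s, x}) ` N s)" by (simp add: card_image)
    also have "\<dots> \<le> card {e \<in> F. s \<in> e}" using assms(2) by (intro card_mono) (auto simp: N_def)
    finally show ?thesis .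
  qed
  let ?N = "\<Union>s\<in>S. \<Union>x\<in>N s. reach (V - S) F {x}"
  have "?B \<subseteq> S \<union> ?N"
  proof
    fix v assume v: "v \<in> ?B"
    show "v \<in> S \<union> ?N"
    proof (cases "v \<in> S")
      case False
      let ?C = "reach (V - S) F {v}"
      have vV: "v \<in> V - S" "v \<in> V" and big: "K \<le> card (reach V F {v})" and small: "card ?C < K"
        using v False by (auto simp: big_parts_def)
      have CV: "?C \<subseteq> V - S" using vV by (intro reach_subset) auto
      \<comment> \<open>Without an edge to \<open>S\<close>, the component would already have been
        this small before the deletion.\<close>
      have "\<exists>x\<in>?C. \<exists>s\<in>S. {x, s} \<in> F"
      proof (rule ccontr)
        assume no: "\<not> ?thesis"
        have "x \<in> ?C" if "x \<in> reach V F {v}" for x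
          using that
        proof induction
          case (step x y)
          then have "y \<notin> S" using no by blast
          then have "y \<in> V - S" using step.hyps(2) by blast
          then show ?case by (rule reach.step[OF step.IH _ step.hyps(3)])
        qed (auto intro: reach.base)
        then have "reach V F {v} \<subseteq> ?C" by blast
        then have "card (reach V F {v}) \<le> card ?C"
          using CV assms(1) by (intro card_mono) (auto intro: finite_subset)
        then show False using big small by simp
      qed
      then obtain x s where xs: "x \<in> ?C" "s \<in> S" "{s, x} \<in> F" by (auto simp: insert_commute)
      have "reach (V - S) F {x} = ?C" using xs vV by (intro reach_eq)
      then have "x \<in> N s" using xs CV small by (auto simp: N_def)
      moreover have "v \<in> reach (V - S) F {x}" using reach_sym[OF vV(1) xs(1)] .
      ultimately show ?thesis using xs by blast
    qed simp
  qed
  then have "card ?B \<le> card (S \<union> ?N)"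
  proof (rule card_mono[rotated])
    have "finite (reach (V - S) F {x})" if "x \<in> N s" for x s
      using that reach_subset[of "{x}" "V - S" F] assms(1) finite_subset by (fastforce simp: N_def)
    then show "finite (S \<union> ?N)" using finS finN by auto
  qed
  also have "\<dots> \<le> card S + (\<Sum>s\<in>S. \<Sum>x\<in>N s. card (reach (V - S) F {x}))"
    using finS finN by (intro order_trans[OF card_Un_le] add_mono order_refl order_trans[OF card_UN_le] sum_mono) auto
  also have "(\<Sum>s\<in>S. \<Sum>x\<in>N s. card (reach (V - S) F {x})) \<le> (\<Sum>s\<in>S. \<Sum>x\<in>N s. K)"
    by (intro sum_mono) (auto simp: N_def)
  also have "\<dots> = K * (\<Sum>s\<in>S. card (N s))" by (simp add: sum_distrib_left mult.commute)
  also have "\<dots> \<le> K * (\<Sum>s\<in>S. card {e \<in> F. s \<in> e})"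
    by (intro mult_left_mono sum_mono cardN) auto
  finally show ?thesis by simp
qed

definition components_of :: "'a set \<Rightarrow> 'a set set \<Rightarrow> 'a set \<Rightarrow> 'a set set" where
  "components_of V F X = (\<lambda>x. reach V F {x}) ` X"

text \<open>Distinct components are disjoint. The resulting bound on their number is the exponent in
  the count of bipartitions.\<close>

lemma card_big_components:
  assumes "finite V"
  shows "K * card (components_of V F (big_parts V F K)) \<le> card V"
proof -
  let ?\<C> = "components_of V F (big_parts V F K)"
  have sub: "C \<subseteq> V" "K \<le> card C" if "C \<in> ?\<C>" for C
  proof -
    from that obtain x where x: "x \<in> V" "K \<le> card (reach V F {x})" "C = reach V F {x}"
      by (auto simp: components_of_def big_parts_def)
    then show "C \<subseteq> V" "K \<le> card C" using reach_subset[of "{x}" V F] by auto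
  qed
  have "finite (big_parts V F K)" using assms by (simp add: big_parts_def)
  then have fin: "finite ?\<C>" by (simp add: components_of_def)
  have "K * card ?\<C> = (\<Sum>C\<in>?\<C>. K)" by simp
  also have "\<dots> \<le> (\<Sum>C\<in>?\<C>. card C)" using sub by (intro sum_mono) auto
  also have "\<dots> = card (\<Union>?\<C>)"
  proof (intro card_Union_disjoint[symmetric])
    show "pairwise disjnt ?\<C>"
    proof (intro pairwiseI)
      fix C D assume CD: "C \<in> ?\<C>" "D \<in> ?\<C>" "C \<noteq> D"
      then obtain x y where xy: "C = reach V F {x}" "D = reach V F {y}" "x \<in> V" "y \<in> V"
        by (auto simp: components_of_def big_parts_def)
      show "disjnt C D"
      proof (rule ccontr)
        assume "\<not> disjnt C D"
        then obtain z where "z \<in> reach V F {x}" "z \<in> reach V F {y}" using xy by (auto simp: disjnt_def)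
        then show False using reach_eq xy CD by metis
      qed
    qed
  qed (use sub assms finite_subset in blast)
  also have "\<dots> \<le> card V" using sub assms by (intro card_mono) auto
  finally show ?thesis .
qed

text \<open>No component crosses a separation, so its trace on the large components is determined by
  a set of components. This replaces arbitrary separations by a family small enough for the union
  bound.\<close>

lemma big_parts_side:
  assumes "V = R \<union> W" "R \<inter> W = {}" "\<forall>x\<in>R. \<forall>y\<in>W. {x, y} \<notin> F"
  shows "big_parts V F K \<inter> R \<in> \<Union> ` Pow (components_of V F (big_parts V F K))"
proof -
  have "big_parts V F K \<inter> R = \<Union> (components_of V F (big_parts V F K \<inter> R))"
  proof (intro subset_antisym subsetI)
    fix x assume "x \<in> \<Union> (components_of V F (big_parts V F K \<inter> R))"
    then obtain y where y: "y \<in> V" "y \<in> R" "K \<le> card (reach V F {y})" "x \<in> reach V F {y}"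
      by (auto simp: components_of_def big_parts_def)
    have "x \<in> R"
      using y(4)
    proof induction
      case (step x z)
      then show ?case using assms by blast
    qed (use y in auto)
    moreover have "x \<in> V" using \<open>x \<in> R\<close> assms by auto
    moreover have "reach V F {x} = reach V F {y}" using y by (intro reach_eq)
    ultimately show "x \<in> big_parts V F K \<inter> R" using y by (auto simp: big_parts_def)
  qed (auto simp: components_of_def intro: reach.base)
  moreover have "components_of V F (big_parts V F K \<inter> R) \<subseteq> components_of V F (big_parts V F K)"
    by (auto simp: components_of_def)
  ultimately show ?thesis by blast
qed

section \<open>Sprinkling across a separation\<close>

definition rich_verts :: "nat \<Rightarrow> real \<Rightarrow> nat set set \<Rightarrow> nat set set" where
  "rich_verts d \<tau> X = {x \<in> cube_verts d. \<tau> \<le> real (cube_degree d X x)}"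

text \<open>The ends need not lie in \<open>X\<close> and \<open>Y\<close>. Having many neighbours
  there is enough for a path of three sprinkled edges.\<close>

definition cross_pairs :: "nat \<Rightarrow> real \<Rightarrow> nat set set \<Rightarrow> nat set set \<Rightarrow> nat set set \<Rightarrow> (nat set \<times> nat set) set" where
  "cross_pairs d \<tau> S X Y =
     {(x, y). x \<in> rich_verts d \<tau> X - S \<and> y \<in> rich_verts d \<tau> Y - S \<and> {x, y} \<in> cube_edges d}"

lemma rich_verts_subset: "rich_verts d \<tau> X \<subseteq> cube_verts d"
  by (auto simp: rich_verts_def)

text \<open>Double counting of the cube edges into \<open>X\<close>: a rich vertex sees at most
  \<open>d\<close> of them, any other fewer than \<tau>.\<close>

lemma card_rich_verts:
  assumes "X \<subseteq> cube_verts d" "0 \<le> \<tau>"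
  shows "real d * real (card X) \<le> real d * real (card (rich_verts d \<tau> X)) + \<tau> * 2 ^ d"
proof -
  let ?V = "cube_verts d" and ?g = "\<lambda>x. cube_degree d X x"
  have g: "?g x \<le> d" if "x \<in> ?V" for x
  proof -
    have "?g x \<le> cube_degree d ?V x" using assms by (intro card_mono) auto
    then show ?thesis using card_cube_nbrs[OF that] by simp
  qed
  have "real d * real (card X) = (\<Sum>x\<in>?V. real (?g x))"
    unfolding of_nat_sum[symmetric] sum_card_cube_nbrs[OF assms(1)] by simp
  also have "\<dots> \<le> (\<Sum>x\<in>?V. real d * of_bool (x \<in> rich_verts d \<tau> X) + \<tau>)"
  proof (intro sum_mono)
    fix x assume x: "x \<in> ?V"
    then have "real (?g x) \<le> real d" using g by simp
    then show "real (?g x) \<le> real d * of_bool (x \<in> rich_verts d \<tau> X) + \<tau>"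
      using assms(2) x by (cases "x \<in> rich_verts d \<tau> X") (auto simp: rich_verts_def)
  qed
  also have "\<dots> = real d * real (card (rich_verts d \<tau> X)) + \<tau> * 2 ^ d"
  proof -
    have "(\<Sum>x\<in>?V. real d * of_bool (x \<in> rich_verts d \<tau> X)) = real d * real (card (?V \<inter> rich_verts d \<tau> X))"
      by (simp add: sum_distrib_left[symmetric] Int_def of_bool_def sum.If_cases)
    moreover have "?V \<inter> rich_verts d \<tau> X = rich_verts d \<tau> X" using rich_verts_subset by blast
    ultimately show ?thesis by (simp add: sum.distrib)
  qed
  finally show ?thesis .
qed

lemma card_big_verts_typical:
  assumes "typical \<theta> C d F" "\<theta> > 0" "d > 0"
  shows "\<theta> * (2 ^ d - 2 ^ d / real d ^ 2) \<le> real (card (big_verts d F (C * d)))"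
proof -
  let ?V = "cube_verts d" and ?U = "big_verts d F (C * d)"
  let ?g = "\<lambda>x. cube_degree d ?U x"
  define bad where "bad = {v \<in> ?V. real (?g v) \<le> \<theta> * real d}"
  have bad: "real (card bad) < 2 ^ d / real d ^ 2" "bad \<subseteq> ?V"
    using assms(1) by (auto simp: typical_def bad_def)
  have "\<theta> * real d * (2 ^ d - 2 ^ d / real d ^ 2) \<le> \<theta> * real d * real (card (?V - bad))"
  proof (intro mult_left_mono)
    have "real (card (?V - bad)) = 2 ^ d - real (card bad)"
      using bad(2) card_mono[OF finite_cube_verts bad(2)] finite_subset[OF bad(2) finite_cube_verts]
      by (simp add: card_Diff_subset of_nat_diff)
    then show "2 ^ d - 2 ^ d / real d ^ 2 \<le> real (card (?V - bad))" using bad(1) by linarith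
  qed (use assms in auto)
  also have "\<dots> = (\<Sum>x\<in>?V - bad. \<theta> * real d)" by simp
  also have "\<dots> \<le> (\<Sum>x\<in>?V - bad. real (?g x))" by (intro sum_mono) (auto simp: bad_def)
  also have "\<dots> \<le> (\<Sum>x\<in>?V. real (?g x))" by (intro sum_mono2) auto
  also have "\<dots> = real d * real (card ?U)"
    using sum_card_cube_nbrs[of ?U d] by (simp add: big_verts_def subset_iff flip: of_nat_sum)
  finally show ?thesis using assms(3) by (simp add: mult.assoc mult.left_commute[of \<theta>])
qed

text \<open>Deleting \<open>S\<close> damages at most \<delta> vertices of \<open>U\<close>. On each
  side the undamaged ones still produce \<open>a\<close> rich vertices, while a vertex rich for
  neither side is poor already in the first round or has many damaged neighbours, so
  \<open>Z\<close> is small. Isoperimetry between the two rich sets supplies the pairs.\<close>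

lemma separation_pairs:
  fixes \<theta> :: real and C d \<sigma> m a :: nat and R S W :: "nat set set" and F :: "nat set set set"
  defines "V \<equiv> cube_verts d" and "U \<equiv> big_verts d F (C * d)"
    and "U' \<equiv> big_parts (cube_verts d - S) F (C * d)"
    and "\<delta> \<equiv> real \<sigma> + real (C * d) * (5 * ln (real d) * real \<sigma> + real d * (2 ^ d / real d ^ 4))"
  assumes F: "F \<subseteq> cube_edges d" and ty: "typical \<theta> C d F" and \<theta>: "\<theta> > 0" and d: "d > 0"
    and part: "R \<union> S \<union> W = V" "R \<inter> S = {}" "R \<inter> W = {}" "S \<inter> W = {}"
    and S: "card S \<le> \<sigma>" and m: "m \<le> card (U \<inter> R)" "m \<le> card (U \<inter> W)"
    and a: "real a + \<delta> + \<theta> / 32 * 2 ^ d \<le> real m" "2 * a \<le> 2 ^ d"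
  shows "real a \<le> real (card (cross_pairs d (\<theta> / 32 * real d) S (U' \<inter> R) (U' \<inter> W)))
           + real d * (2 ^ d / real d ^ 2 + 2 * \<delta> / \<theta>) + 2 * real d * real \<sigma>"
proof -
  let ?D = "5 * ln (real d) * real \<sigma> + real d * (2 ^ d / real d ^ 4)"
  let ?\<tau> = "\<theta> / 32 * real d"
  define A where "A = rich_verts d ?\<tau> (U' \<inter> R)"
  define B where "B = rich_verts d ?\<tau> (U' \<inter> W)"
  define Z where "Z = V - (A \<union> B)"
  have SV: "S \<subseteq> V" using part by blast
  have fin: "finite V" "finite S" "finite F"
    using finite_subset[OF SV] finite_subset[OF F] by (auto simp: V_def)
  have sub: "A \<subseteq> V" "B \<subseteq> V" "U \<subseteq> V" "U' \<subseteq> V - S"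
    using rich_verts_subset by (auto simp: A_def B_def V_def U_def U'_def big_verts_def big_parts_def)
  have finU: "finite U" "finite U'" using sub fin by (auto intro: finite_subset)
  have "5 * ln (real d) \<ge> 0" using d by simp
  \<comment> \<open>Outside \<open>high\<close> each degree is below \<open>5 * ln d\<close>; the
    few exceptional vertices get the trivial bound \<open>d\<close>.\<close>
  have degsum: "real (\<Sum>s\<in>S. card {e \<in> F. s \<in> e}) \<le> ?D"
  proof -
    define high where "high = {v \<in> V. 5 * ln (real d) \<le> real (card {e \<in> F. v \<in> e})}"
    have high: "real (card high) < 2 ^ d / real d ^ 4" "finite high"
      using ty fin by (auto simp: typical_def high_def V_def)
    have "real (\<Sum>s\<in>S. card {e \<in> F. s \<in> e}) \<le> (\<Sum>s\<in>S. 5 * ln (real d) + real d * of_bool (s \<in> high))"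
      unfolding of_nat_sum
    proof (intro sum_mono)
      fix s assume "s \<in> S"
      then have "s \<in> V" using SV by blast
      then have "real (card {e \<in> F. s \<in> e}) \<le> real d"
        using card_edges_at[of s d F] F by (simp add: V_def)
      then show "real (card {e \<in> F. s \<in> e}) \<le> 5 * ln (real d) + real d * of_bool (s \<in> high)"
        using \<open>5 * ln (real d) \<ge> 0\<close> \<open>s \<in> V\<close> by (cases "s \<in> high") (auto simp: high_def)
    qed
    also have "\<dots> = 5 * ln (real d) * real (card S) + real d * real (card (S \<inter> high))"
      using fin by (simp add: sum.distrib sum_distrib_left[symmetric] Int_def of_bool_def sum.If_cases)
    also have "\<dots> \<le> 5 * ln (real d) * real \<sigma> + real d * real (card high)"
      using S d high by (intro add_mono mult_left_mono) (auto intro: card_mono)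
    also have "\<dots> \<le> ?D"
      using high by (intro add_left_mono mult_left_mono) auto
    finally show ?thesis .
  qed
  have damaged: "real (card (U - U')) \<le> \<delta>"
  proof -
    have "card (U - U') \<le> card S + C * d * (\<Sum>s\<in>S. card {e \<in> F. s \<in> e})"
      unfolding U_def U'_def big_verts_eq using card_damaged[OF _ fin(3), of "cube_verts d" S "C * d"] SV by (simp add: V_def)
    then have "real (card (U - U')) \<le> real (card S + C * d * (\<Sum>s\<in>S. card {e \<in> F. s \<in> e}))"
      by (rule of_nat_mono)
    also have "\<dots> = real (card S) + real (C * d) * real (\<Sum>s\<in>S. card {e \<in> F. s \<in> e})" by simp
    also have "\<dots> \<le> \<delta>" unfolding \<delta>_def using S degsum by (intro add_mono mult_left_mono) auto
    finally show ?thesis .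
  qed
  have large: "a \<le> card (rich_verts d ?\<tau> (U' \<inter> X))" if "m \<le> card (U \<inter> X)" for X
  proof -
    have "U \<inter> X \<subseteq> (U' \<inter> X) \<union> (U - U')" by blast
    then have "card (U \<inter> X) \<le> card ((U' \<inter> X) \<union> (U - U'))" using finU by (intro card_mono) auto
    also have "\<dots> \<le> card (U' \<inter> X) + card (U - U')" by (rule card_Un_le)
    finally have "real m \<le> real (card (U' \<inter> X)) + \<delta>" using that damaged by linarith
    then have "real a + \<theta> / 32 * 2 ^ d \<le> real (card (U' \<inter> X))" using a(1) by linarith
    then have "real d * (real a + \<theta> / 32 * 2 ^ d) \<le> real d * real (card (U' \<inter> X))"
      by (intro mult_left_mono) auto
    also have "\<dots> \<le> real d * real (card (rich_verts d ?\<tau> (U' \<inter> X))) + ?\<tau> * 2 ^ d"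
      using sub \<theta> by (intro card_rich_verts) (auto simp: V_def)
    finally have "real d * real a \<le> real d * real (card (rich_verts d ?\<tau> (U' \<inter> X)))"
      by (simp add: algebra_simps)
    then show ?thesis using d by simp
  qed
  have Zcard: "real (card Z) \<le> 2 ^ d / real d ^ 2 + 2 * \<delta> / \<theta>"
  proof -
    let ?g = "\<lambda>X x. cube_degree d X x"
    define bad where "bad = {v \<in> V. real (?g U v) \<le> \<theta> * real d}"
    have bad: "real (card bad) < 2 ^ d / real d ^ 2" "finite bad"
      using ty fin by (auto simp: typical_def bad_def U_def V_def)
    \<comment> \<open>More than \<open>\<theta> * d\<close> neighbours are in \<open>U\<close>, and
      each side holds fewer than a 32nd part of that number undamaged; hence at least half are
      damaged. Double counting below then bounds the number of such vertices.\<close>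
    have deg: "\<theta> * real d / 2 \<le> real (?g (U - U') x)" if x: "x \<in> Z - bad" for x
    proof -
      let ?n = "\<lambda>X. {u \<in> X. {x, u} \<in> cube_edges d}"
      have "?n U \<subseteq> ?n (U' \<inter> R)
          \<union> ?n (U' \<inter> W) \<union> ?n (U - U')"
        using sub(4) part(1) by blast
      then have "?g U x \<le> card (?n (U' \<inter> R)
          \<union> ?n (U' \<inter> W) \<union> ?n (U - U'))"
        using finU by (intro card_mono) auto
      also have "\<dots> \<le> ?g (U' \<inter> R) x + ?g (U' \<inter> W) x + ?g (U - U') x"
        by (intro order_trans[OF card_Un_le] add_mono order_refl)
      finally have "real (?g U x) \<le> real (?g (U' \<inter> R) x) + real (?g (U' \<inter> W) x) + real (?g (U - U') x)"
        by linarith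
      moreover have "real (?g (U' \<inter> R) x) < ?\<tau>" "real (?g (U' \<inter> W) x) < ?\<tau>"
        using x by (auto simp: Z_def A_def B_def rich_verts_def V_def)
      moreover have "\<theta> * real d < real (?g U x)" using x by (auto simp: bad_def Z_def)
      moreover have "0 < \<theta> * real d" using \<theta> d by simp
      ultimately show ?thesis by (simp add: field_simps)
    qed
    have "real (card (Z - bad)) * (\<theta> * real d / 2) = (\<Sum>x\<in>Z - bad. \<theta> * real d / 2)" by simp
    also have "\<dots> \<le> (\<Sum>x\<in>Z - bad. real (?g (U - U') x))" by (intro sum_mono deg)
    also have "\<dots> \<le> (\<Sum>x\<in>V. real (?g (U - U') x))" using fin by (intro sum_mono2) (auto simp: Z_def)
    also have "\<dots> = real d * real (card (U - U'))"
    proof -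
      have "U - U' \<subseteq> cube_verts d" using sub(3) by (auto simp: V_def)
      from sum_card_cube_nbrs[OF this] show ?thesis unfolding V_def of_nat_sum[symmetric] by simp
    qed
    also have "\<dots> \<le> real d * \<delta>" using damaged by (intro mult_left_mono) auto
    finally have "real (card (Z - bad)) \<le> 2 * \<delta> / \<theta>" using \<theta> d by (simp add: field_simps)
    moreover have "card Z \<le> card (Z - bad) + card bad"
      using card_mono[of "(Z - bad) \<union> bad" Z] card_Un_le[of "Z - bad" bad] fin bad by (fastforce simp: Z_def)
    ultimately show ?thesis using bad(1) by linarith
  qed
  have "a \<le> card {(x, y). x \<in> A - S \<and> y \<in> B - S \<and> {x, y} \<in> cube_edges d} + d * card Z + 2 * d * card S"
    unfolding Z_def V_def
    using sub SV a(2) large[OF m(1)] large[OF m(2)]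
    by (intro many_cross_pairs) (auto simp: V_def A_def B_def)
  then have "real a \<le> real (card (cross_pairs d ?\<tau> S (U' \<inter> R) (U' \<inter> W))) + real d * real (card Z) + 2 * real d * real (card S)"
    unfolding cross_pairs_def A_def B_def of_nat_le_iff[symmetric, where 'a = real] by simp
  moreover have "real d * real (card Z) \<le> real d * (2 ^ d / real d ^ 2 + 2 * \<delta> / \<theta>)"
    using Zcard by (intro mult_left_mono) auto
  moreover have "2 * real d * real (card S) \<le> 2 * real d * real \<sigma>"
    using S by (intro mult_left_mono) auto
  ultimately show ?thesis by linarith
qed

section \<open>Successive thinning of the cross pairs\<close>

lemma rand_exp_le_tail:
  assumes "finite E" "0 \<le> p" "p \<le> 1" "0 \<le> c"
    and "\<And>F. F \<subseteq> E \<Longrightarrow> f F \<le> 1" "\<And>F. F \<subseteq> E \<Longrightarrow> \<not> bad F \<Longrightarrow> f F \<le> c"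
  shows "rand_exp E p f \<le> rand_prob E p bad + c"
proof -
  have "rand_exp E p f \<le> rand_exp E p (\<lambda>F. of_bool (bad F) + c)"
  proof (intro rand_exp_mono assms)
    fix F assume "F \<subseteq> E"
    then show "f F \<le> of_bool (bad F) + c"
      using assms(4) assms(5)[of F] assms(6)[of F] by (cases "bad F") auto
  qed
  then show ?thesis using assms(1) by (simp add: rand_exp_add rand_prob_def)
qed

text \<open>Elements with the same image under \<pi> survive together. The independent trials are
  thus the fibres, weighted by their sizes, and the maximal size \<open>M\<close> is the loss in the
  exponent.\<close>

lemma thinning_tail:
  assumes "finite I" "finite E" "finite H" "\<pi> ` H \<subseteq> I"
    and D: "\<And>i. i \<in> I \<Longrightarrow> D i \<subseteq> E" "disjoint_family_on D I" "\<And>i. i \<in> I \<Longrightarrow> k \<le> card (D i)"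
    and p: "0 \<le> p" "p \<le> 1" and M: "M > 0" "\<And>i. i \<in> I \<Longrightarrow> card {h \<in> H. \<pi> h = i} \<le> M"
    and q: "q = 1 - (1 - p) ^ k"
  shows "rand_prob E p (\<lambda>F. real (card {h \<in> H. F \<inter> D (\<pi> h) \<noteq> {}}) \<le> q / 4 * real (card H))
    \<le> exp (- (q * real (card H) / (4 * real M)))"
proof -
  define w where "w i = real (card {h \<in> H. \<pi> h = i})" for i
  have group: "(\<Sum>i\<in>I. w i * of_bool (Q i)) = real (card {h \<in> H. Q (\<pi> h)})" for Q
  proof -
    have "{h \<in> H. Q (\<pi> h)} = (\<Union>i\<in>{i \<in> I. Q i}. {h \<in> H. \<pi> h = i})" using assms(4) by auto
    also have "card \<dots> = (\<Sum>i\<in>{i \<in> I. Q i}. card {h \<in> H. \<pi> h = i})"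
      using assms(1,3) by (intro card_UN_disjoint) auto
    also have "real \<dots> = (\<Sum>i\<in>{i \<in> I. Q i}. w i)" by (simp add: w_def)
    also have "\<dots> = (\<Sum>i\<in>I. w i * of_bool (Q i))"
      using assms(1) by (intro sum.mono_neutral_cong_left) auto
    finally show ?thesis by simp
  qed
  have total: "sum w I = real (card H)" using group[of "\<lambda>_. True"] by simp
  have "rand_prob E p (\<lambda>F. (\<Sum>i\<in>I. w i * of_bool (F \<inter> D i \<noteq> {})) \<le> q / 4 * sum w I)
    \<le> exp (- (q * sum w I / (4 * real M)))"
  proof (rule rand_prob_lower_tail[where D = D])
    fix i assume i: "i \<in> I"
    have fin: "finite (D i)" using D(1)[OF i] assms(2) finite_subset by blast
    have "rand_prob (D i) p (\<lambda>F. F \<inter> D i \<noteq> {}) = 1 - (1 - p) ^ card (D i)"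
      using rand_prob_not[OF fin, of p "\<lambda>F. F \<inter> D i = {}"] rand_prob_disjoint[OF fin, of "D i" p] by simp
    moreover have "(1 - p) ^ card (D i) \<le> (1 - p) ^ k" using p D(3)[OF i] by (intro power_decreasing) auto
    ultimately show "q \<le> rand_prob (D i) p (\<lambda>F. F \<inter> D i \<noteq> {})" by (simp add: q)
  qed (use assms in \<open>auto simp: w_def\<close>)
  then show ?thesis by (simp only: group total)
qed

text \<open>The round \<open>Fa\<close> keeps a fraction \<open>q / 4\<close> of the pairs,
  \<open>Fb\<close> the same fraction of those, and \<open>Fc\<close> has to miss all survivors. The
  three terms bound the failure of each round in turn.\<close>

lemma two_sided_thinning:
  assumes fin: "finite I" "finite J" "finite E" "finite H" and H: "H \<subseteq> I \<times> J"
    and D: "\<And>i. i \<in> I \<Longrightarrow> D i \<subseteq> E" "disjoint_family_on D I" "\<And>i. i \<in> I \<Longrightarrow> k \<le> card (D i)"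
    and D': "\<And>j. j \<in> J \<Longrightarrow> D' j \<subseteq> E" "disjoint_family_on D' J" "\<And>j. j \<in> J \<Longrightarrow> k \<le> card (D' j)"
    and e: "inj_on e H" "e ` H \<subseteq> E"
    and p: "0 \<le> p" "p \<le> 1" and M: "M > 0" "\<And>i. i \<in> I \<Longrightarrow> card {h \<in> H. fst h = i} \<le> M"
      "\<And>j. j \<in> J \<Longrightarrow> card {h \<in> H. snd h = j} \<le> M"
    and q: "q = 1 - (1 - p) ^ k"
  shows "triple_prob E p (\<lambda>Fa Fb Fc. \<forall>h\<in>H. Fa \<inter> D (fst h) = {} \<or> Fb \<inter> D' (snd h) = {} \<or> e h \<notin> Fc)
    \<le> exp (- (q * real (card H) / (4 * real M))) + exp (- (q\<^sup>2 * real (card H) / (16 * real M)))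
      + exp (- (p * (q\<^sup>2 * real (card H) / 16)))"
proof -
  let ?e2 = "exp (- (q\<^sup>2 * real (card H) / (16 * real M)))" and ?e3 = "exp (- (p * (q\<^sup>2 * real (card H) / 16)))"
  have q0: "0 \<le> q" using p by (auto simp: q intro!: power_le_one)
  define H1 where "H1 Fa = {h \<in> H. Fa \<inter> D (fst h) \<noteq> {}}" for Fa
  define H2 where "H2 Fa Fb = {h \<in> H1 Fa. Fb \<inter> D' (snd h) \<noteq> {}}" for Fa Fb
  let ?P = "\<lambda>Fa Fb. rand_prob E p (\<lambda>Fc. \<forall>h\<in>H. Fa \<inter> D (fst h) = {} \<or> Fb \<inter> D' (snd h) = {} \<or> e h \<notin> Fc)"
  have H1: "H1 Fa \<subseteq> H" "finite (H1 Fa)" for Fa using fin by (auto simp: H1_def)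
  have third: "?P Fa Fb \<le> exp (- (p * real (card (H2 Fa Fb))))" for Fa Fb
  proof -
    have sub: "H2 Fa Fb \<subseteq> H" by (auto simp: H2_def H1_def)
    have "?P Fa Fb = rand_prob E p (\<lambda>Fc. Fc \<inter> e ` H2 Fa Fb = {})"
      by (intro rand_prob_cong) (auto simp: H2_def H1_def)
    also have "\<dots> = (1 - p) ^ card (e ` H2 Fa Fb)"
      using fin(3) sub e(2) by (intro rand_prob_disjoint) auto
    also have "card (e ` H2 Fa Fb) = card (H2 Fa Fb)"
      using inj_on_subset[OF e(1) sub] by (rule card_image)
    also have "(1 - p) ^ card (H2 Fa Fb) \<le> exp (- (p * real (card (H2 Fa Fb))))"
      by (rule one_minus_power_le_exp[OF p])
    finally show ?thesis .
  qed
  have P1: "?P Fa Fb \<le> 1" for Fa Fb by (rule rand_prob_le_1[OF fin(3) p])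
  have second: "rand_exp E p (?P Fa) \<le> exp (- (q * real (card (H1 Fa)) / (4 * real M)))
      + exp (- (p * (q / 4 * real (card (H1 Fa)))))" for Fa
  proof -
    have "rand_exp E p (?P Fa) \<le> rand_prob E p (\<lambda>Fb. real (card (H2 Fa Fb)) \<le> q / 4 * real (card (H1 Fa)))
        + exp (- (p * (q / 4 * real (card (H1 Fa)))))"
    proof (rule rand_exp_le_tail[OF fin(3) p _ P1])
      fix Fb assume "\<not> real (card (H2 Fa Fb)) \<le> q / 4 * real (card (H1 Fa))"
      then have "p * (q / 4 * real (card (H1 Fa))) \<le> p * real (card (H2 Fa Fb))"
        using p by (intro mult_left_mono) auto
      then have "exp (- (p * real (card (H2 Fa Fb)))) \<le> exp (- (p * (q / 4 * real (card (H1 Fa)))))"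
        by simp
      then show "?P Fa Fb \<le> exp (- (p * (q / 4 * real (card (H1 Fa)))))" using third[of Fa Fb] by linarith
    qed simp
    also have "rand_prob E p (\<lambda>Fb. real (card (H2 Fa Fb)) \<le> q / 4 * real (card (H1 Fa)))
        \<le> exp (- (q * real (card (H1 Fa)) / (4 * real M)))"
      unfolding H2_def
    proof (rule thinning_tail[OF fin(2,3) H1(2) _ D' p M(1) _ q])
      show "snd ` H1 Fa \<subseteq> J" using H H1(1) by fastforce
      fix j assume "j \<in> J"
      have "card {h \<in> H1 Fa. snd h = j} \<le> card {h \<in> H. snd h = j}" using H1(1) fin by (intro card_mono) auto
      then show "card {h \<in> H1 Fa. snd h = j} \<le> M" using M(3)[OF \<open>j \<in> J\<close>] by linarith
    qed
    finally show ?thesis by simp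
  qed
  have "rand_exp E p (\<lambda>Fa. rand_exp E p (?P Fa)) \<le> rand_prob E p (\<lambda>Fa. real (card (H1 Fa)) \<le> q / 4 * real (card H))
      + (?e2 + ?e3)"
  proof (rule rand_exp_le_tail[OF fin(3) p])
    fix Fa
    have "rand_exp E p (?P Fa) \<le> rand_exp E p (\<lambda>Fb. 1)" by (intro rand_exp_mono p P1)
    then show "rand_exp E p (?P Fa) \<le> 1" using fin(3) by simp
    assume "\<not> real (card (H1 Fa)) \<le> q / 4 * real (card H)"
    then have "q * (q / 4 * real (card H)) \<le> q * real (card (H1 Fa))" using q0 by (intro mult_left_mono) auto
    then have b: "q\<^sup>2 * real (card H) / 4 \<le> q * real (card (H1 Fa))" by (simp add: power2_eq_square)
    then have "q\<^sup>2 * real (card H) / 4 / (4 * real M) \<le> q * real (card (H1 Fa)) / (4 * real M)"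
      by (intro divide_right_mono) auto
    moreover have "p * (q\<^sup>2 * real (card H) / 4 / 4) \<le> p * (q * real (card (H1 Fa)) / 4)"
      using b p by (intro mult_left_mono divide_right_mono) auto
    ultimately have "exp (- (q * real (card (H1 Fa)) / (4 * real M))) \<le> ?e2"
      "exp (- (p * (q / 4 * real (card (H1 Fa))))) \<le> ?e3"
      by simp_all
    then show "rand_exp E p (?P Fa) \<le> ?e2 + ?e3"
      using second[of Fa] by linarith
  qed simp
  moreover have "rand_prob E p (\<lambda>Fa. real (card (H1 Fa)) \<le> q / 4 * real (card H))
      \<le> exp (- (q * real (card H) / (4 * real M)))"
    unfolding H1_def
    by (rule thinning_tail[OF fin(1,3,4) _ D p M(1,2) q]) (use H in auto)
  ultimately show ?thesis by (simp add: triple_prob_def)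
qed

definition sprinkle_fails :: "nat \<Rightarrow> real \<Rightarrow> nat set set \<Rightarrow> nat set set \<Rightarrow> nat set set \<Rightarrow>
    nat set set set \<Rightarrow> nat set set set \<Rightarrow> nat set set set \<Rightarrow> bool" where
  "sprinkle_fails d \<tau> S X Y Fa Fb Fc \<longleftrightarrow>
     (\<forall>(x, y)\<in>cross_pairs d \<tau> S X Y. (\<forall>u\<in>X. {x, u} \<notin> Fa) \<or> (\<forall>u\<in>Y. {y, u} \<notin> Fb) \<or> {x, y} \<notin> Fc)"

lemma even_card_flip:
  assumes "finite x"
  shows "even (card (flip j x)) \<longleftrightarrow> odd (card x)"
proof (cases "j \<in> x")
  case True
  then have "x = insert j (flip j x)" "j \<notin> flip j x" by (auto simp: mem_flip)
  then have "card x = Suc (card (flip j x))"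
    using assms by (metis card_insert_disjoint finite_insert)
  then show ?thesis by simp
next
  case False
  then have "flip j x = insert j x" by (auto simp: mem_flip)
  then show ?thesis using False assms by simp
qed

lemma cube_edge_parity: "{x, y} \<in> cube_edges d \<Longrightarrow> even (card y) \<longleftrightarrow> odd (card x)"
proof -
  assume "{x, y} \<in> cube_edges d"
  then obtain j where "x \<in> cube_verts d" "y = flip j x" by (auto simp: cube_edge_iff)
  moreover have "finite x" using \<open>x \<in> cube_verts d\<close> by (auto simp: cube_verts_def intro: finite_subset)
  ultimately show ?thesis by (simp add: even_card_flip)
qed

text \<open>Only pairs with \<open>x\<close> of one parity are used: then no edge is tested for two different \<open>x\<close>.\<close>

lemma sprinkle_fails_prob:
  assumes XY: "X \<subseteq> cube_verts d" "Y \<subseteq> cube_verts d" and p: "0 \<le> p" "p \<le> 1" and d: "d > 0"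
    and w: "w \<le> real (card (cross_pairs d \<tau> S X Y))" and k: "real k \<le> \<tau>" and q: "q = 1 - (1 - p) ^ k"
    and w0: "0 \<le> w"
  shows "triple_prob (cube_edges d) p (sprinkle_fails d \<tau> S X Y)
    \<le> exp (- (q * w / (8 * real d))) + exp (- (q\<^sup>2 * w / (32 * real d))) + exp (- (p * (q\<^sup>2 * w / 32)))"
proof -
  let ?P = "cross_pairs d \<tau> S X Y"
  let ?E = "cube_edges d"
  define H where "H b = {(x, y) \<in> ?P. even (card x) = b}" for b
  define I where "I b = {x \<in> rich_verts d \<tau> X. even (card x) = b}" for b
  define J where "J b = {y \<in> rich_verts d \<tau> Y. even (card y) = (\<not> b)}" for b
  have finc: "finite (?P)"
  proof (rule finite_subset)
    show "?P \<subseteq> cube_verts d \<times> cube_verts d"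
      using rich_verts_subset by (auto simp: cross_pairs_def)
  qed simp
  have "card (?P) \<le> card (H True) + card (H False)"
  proof -
    have "?P \<subseteq> H True \<union> H False" by (auto simp: H_def)
    moreover have "finite (H True \<union> H False)" by (rule finite_subset[OF _ finc]) (auto simp: H_def)
    ultimately show ?thesis by (meson card_Un_le card_mono order_trans)
  qed
  \<comment> \<open>One parity class keeps half of the pairs; this doubles the denominators 4, 16,
    16 of the thinning bound to 8, 32, 32.\<close>
  then have "w / 2 \<le> real (card (H True)) \<or> w / 2 \<le> real (card (H False))" using w by linarith
  then obtain b where b: "w / 2 \<le> real (card (H b))" by blast
  have q0: "0 \<le> q" using p by (auto simp: q intro!: power_le_one)
  \<comment> \<open>Adjacent vertices have opposite parity, so an edge together with the parity of
    its leading end determines the ordered pair.\<close>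
  have edge_sym: "{x, y} = {x', y'} \<longleftrightarrow> x = x' \<and> y = y'"
    if "{x, y} \<in> ?E" "{x', y'} \<in> ?E" "even (card x) = even (card x')" for x y x' y' :: "nat set"
    using that cube_edge_parity by (metis doubleton_eq_iff)
  define N where "N T x = (\<lambda>u. {x, u}) ` {u \<in> T. {x, u} \<in> ?E}" for T and x :: "nat set"
  have cardN: "k \<le> card (N T x)" if "x \<in> rich_verts d \<tau> T" for T x
  proof -
    have "inj_on (\<lambda>u. {x, u}) {u \<in> T. {x, u} \<in> ?E}" by (auto simp: inj_on_def doubleton_eq_iff)
    then have "card (N T x) = cube_degree d T x" unfolding N_def by (rule card_image)
    then have "real k \<le> real (card (N T x))" using that k by (simp add: rich_verts_def)
    then show ?thesis by simp
  qed
  have disjN: "disjoint_family_on (N T) Q" if "\<And>x y. x \<in> Q \<Longrightarrow> y \<in> Q \<Longrightarrow> even (card x) = even (card y)" for T Q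
    unfolding disjoint_family_on_def
  proof (intro ballI impI equals0I)
    fix x y e assume xy: "x \<in> Q" "y \<in> Q" "x \<noteq> y" and e: "e \<in> N T x \<inter> N T y"
    from e have "e \<in> N T x" by (rule IntD1)
    then obtain u where u: "e = {x, u}" "{x, u} \<in> ?E" unfolding N_def by (elim imageE CollectE conjE) simp
    from e have "e \<in> N T y" by (rule IntD2)
    then obtain v where v: "e = {y, v}" "{y, v} \<in> ?E" unfolding N_def by (elim imageE CollectE conjE) simp
    have "{x, u} = {y, v}" using u(1) v(1) by simp
    then show False using edge_sym[OF u(2) v(2)] that[OF xy(1,2)] xy(3) by simp
  qed
  have HE: "{fst h, snd h} \<in> ?E" "fst h \<in> cube_verts d" "snd h \<in> cube_verts d" if "h \<in> H b" for h
  proof -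
    show "{fst h, snd h} \<in> ?E" using that by (auto simp: H_def cross_pairs_def)
    then show "fst h \<in> cube_verts d" "snd h \<in> cube_verts d" by (simp_all add: cube_edge_iff)
  qed
  have deg1: "card {h \<in> H b. fst h = x} \<le> d" if "x \<in> cube_verts d" for x
  proof -
    have "card {h \<in> H b. fst h = x} \<le> card ((\<lambda>y. (x, y)) ` {y \<in> cube_verts d. {x, y} \<in> ?E})"
    proof (intro card_mono subsetI)
      fix h assume "h \<in> {h \<in> H b. fst h = x}"
      then show "h \<in> (\<lambda>y. (x, y)) ` {y \<in> cube_verts d. {x, y} \<in> ?E}"
        using HE[of h] by (intro image_eqI[of _ _ "snd h"]) auto
    qed simp
    also have "\<dots> \<le> cube_degree d (cube_verts d) x" by (intro card_image_le) auto
    finally show ?thesis using card_cube_nbrs[OF that] by simp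
  qed
  have deg2: "card {h \<in> H b. snd h = y} \<le> d" if "y \<in> cube_verts d" for y
  proof -
    have "card {h \<in> H b. snd h = y} \<le> card ((\<lambda>x. (x, y)) ` {x \<in> cube_verts d. {y, x} \<in> ?E})"
    proof (intro card_mono subsetI)
      fix h assume "h \<in> {h \<in> H b. snd h = y}"
      then show "h \<in> (\<lambda>x. (x, y)) ` {x \<in> cube_verts d. {y, x} \<in> ?E}"
        using HE[of h] by (intro image_eqI[of _ _ "fst h"]) (auto simp: insert_commute)
    qed simp
    also have "\<dots> \<le> cube_degree d (cube_verts d) y" by (intro card_image_le) auto
    finally show ?thesis using card_cube_nbrs[OF that] by simp
  qed
  let ?h = "real (card (H b))"
  have "triple_prob ?E p (sprinkle_fails d \<tau> S X Y) \<le> triple_prob ?E p (\<lambda>Fa Fb Fc. \<forall>h\<in>H b. Fa \<inter> N X (fst h) = {} \<or> Fb \<inter> N Y (snd h) = {} \<or> {fst h, snd h} \<notin> Fc)"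
  proof (intro triple_prob_mono p ballI)
    fix Fa Fb Fc h assume f: "sprinkle_fails d \<tau> S X Y Fa Fb Fc" and h: "h \<in> H b"
    have "(fst h, snd h) \<in> ?P" using h by (auto simp: H_def)
    then have "(\<forall>u\<in>X. {fst h, u} \<notin> Fa) \<or> (\<forall>u\<in>Y. {snd h, u} \<notin> Fb) \<or> {fst h, snd h} \<notin> Fc"
      using f unfolding sprinkle_fails_def by (auto dest: bspec)
    moreover have "F \<inter> N T x = {}" if "\<forall>u\<in>T. {x, u} \<notin> F" for F T and x :: "nat set"
      using that by (auto simp: N_def)
    ultimately show "Fa \<inter> N X (fst h) = {} \<or> Fb \<inter> N Y (snd h) = {} \<or> {fst h, snd h} \<notin> Fc" by meson
  qed
  also have "\<dots> \<le> exp (- (q * ?h / (4 * real d))) + exp (- (q\<^sup>2 * ?h / (16 * real d)))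
      + exp (- (p * (q\<^sup>2 * ?h / 16)))"
  proof (rule two_sided_thinning[where I = "I b" and J = "J b", OF _ _ _ _ _ _ _ _ _ _ _ _ _ p d _ _ q])
    show "finite (I b)" "finite (J b)"
      by (rule finite_subset[OF _ finite_cube_verts[of d]]; force simp: I_def J_def rich_verts_def)+
    show "finite (H b)" by (rule finite_subset[OF _ finc]) (auto simp: H_def)
    show "H b \<subseteq> I b \<times> J b" by (auto simp: H_def I_def J_def cross_pairs_def dest: cube_edge_parity)
    show "disjoint_family_on (N X) (I b)" "disjoint_family_on (N Y) (J b)"
      by (auto intro!: disjN simp: I_def J_def)
    show "inj_on (\<lambda>h. {fst h, snd h}) (H b)"
      using edge_sym by (auto simp: inj_on_def H_def cross_pairs_def)
    show "(\<lambda>h. {fst h, snd h}) ` H b \<subseteq> ?E" by (auto simp: H_def cross_pairs_def)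
    show "card {h \<in> H b. fst h = i} \<le> d" if "i \<in> I b" for i
      using that by (intro deg1) (simp add: I_def rich_verts_def)
    show "card {h \<in> H b. snd h = j} \<le> d" if "j \<in> J b" for j
      using that by (intro deg2) (simp add: J_def rich_verts_def)
  qed (use cardN in \<open>auto simp: N_def I_def J_def\<close>)
  also have "\<dots> \<le> exp (- (q * w / (8 * real d))) + exp (- (q\<^sup>2 * w / (32 * real d))) + exp (- (p * (q\<^sup>2 * w / 32)))"
  proof -
    have m: "c * w / (2 * r) \<le> c * ?h / r" if "0 \<le> c" "0 < r" for c r
      using mult_left_mono[OF b that(1)] that by (simp add: field_simps)
    have "p * (q\<^sup>2 * w / 32) \<le> p * (q\<^sup>2 * ?h / 16)"
      using m[of "q\<^sup>2" 16] p by (intro mult_left_mono) auto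
    then show ?thesis
      using m[of q "4 * real d"] m[of "q\<^sup>2" "16 * real d"] q0 d by (intro add_mono) auto
  qed
  finally show ?thesis .
qed

section \<open>Union bound over separations\<close>

lemma rand_prob_sprinkle3:
  assumes "finite E" "1 - p = (1 - p1) * (1 - p2) ^ 3"
  shows "rand_prob E p P = rand_exp E p1 (\<lambda>F. triple_prob E p2 (\<lambda>F1 F2 F3. P (F \<union> F1 \<union> F2 \<union> F3)))"
proof -
  define r1 where "r1 = 1 - (1 - p1) * (1 - p2)"
  define r2 where "r2 = 1 - (1 - r1) * (1 - p2)"
  have "p = 1 - (1 - p1) * (1 - p2) ^ 3" using assms(2) by linarith
  then have p: "p = 1 - (1 - r2) * (1 - p2)" by (simp add: r1_def r2_def power3_eq_cube)
  show ?thesis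
    unfolding p triple_prob_def rand_prob_def rand_exp_sprinkle[OF assms(1)] r2_def r1_def ..
qed

text \<open>Give a set the weight \<open>\<beta> ^ card S\<close>: each counted set weighs at least
  \<open>\<beta> ^ \<sigma>\<close>, and all sets together weigh
  \<open>(1 + \<beta>) ^ card V\<close>.\<close>

lemma card_small_subsets:
  fixes \<beta> :: real
  assumes "finite V" "0 < \<beta>" "\<beta> \<le> 1"
  shows "real (card {S. S \<subseteq> V \<and> card S \<le> \<sigma>}) \<le> exp (real \<sigma> * ln (1 / \<beta>) + \<beta> * real (card V))"
proof -
  have pow: "(\<Sum>S\<in>Pow V. \<beta> ^ card S) = (1 + \<beta>) ^ card V"
    using prod_add[OF assms(1), of "\<lambda>_. \<beta>" "\<lambda>_. 1"] by (simp add: add.commute)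
  let ?A = "{S. S \<subseteq> V \<and> card S \<le> \<sigma>}"
  have "real (card ?A) * \<beta> ^ \<sigma> = (\<Sum>S\<in>?A. \<beta> ^ \<sigma>)" by simp
  also have "\<dots> \<le> (\<Sum>S\<in>?A. \<beta> ^ card S)" using assms by (intro sum_mono power_decreasing) auto
  also have "\<dots> \<le> (\<Sum>S\<in>Pow V. \<beta> ^ card S)" using assms by (intro sum_mono2) auto
  also have "\<dots> = (1 + \<beta>) ^ card V" by (rule pow)
  also have "\<dots> \<le> exp \<beta> ^ card V" using assms by (intro power_mono) auto
  also have "\<dots> = exp (\<beta> * real (card V))" by (simp add: exp_of_nat_mult[symmetric] mult.commute)
  finally have 1: "real (card ?A) * \<beta> ^ \<sigma> \<le> exp (\<beta> * real (card V))" .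
  have "\<beta> ^ \<sigma> = exp (real \<sigma> * ln \<beta>)" using assms by (simp add: exp_of_nat_mult)
  then have "real (card ?A) = real (card ?A) * \<beta> ^ \<sigma> * exp (real \<sigma> * ln (1 / \<beta>))"
    using assms by (simp add: ln_div exp_minus)
  also have "\<dots> \<le> exp (\<beta> * real (card V)) * exp (real \<sigma> * ln (1 / \<beta>))"
    using 1 by (intro mult_right_mono) auto
  finally show ?thesis by (simp add: exp_add[symmetric] add.commute)
qed

definition separated :: "nat \<Rightarrow> nat set set set \<Rightarrow> nat set set \<Rightarrow> nat \<Rightarrow> nat \<Rightarrow> nat set set \<Rightarrow> nat set set \<Rightarrow> nat set set \<Rightarrow> bool" where
  "separated d G U \<sigma> m R S W \<longleftrightarrow>
     R \<union> S \<union> W = cube_verts d \<and> R \<inter> S = {} \<and> R \<inter> W = {} \<and> S \<inter> W = {} \<and>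
     (\<forall>x\<in>R. \<forall>y\<in>W. {x, y} \<notin> G) \<and> card S \<le> \<sigma> \<and> m \<le> card (U \<inter> R) \<and> m \<le> card (U \<inter> W)"

text \<open>With the first round \<open>F\<close> fixed, the index family of pairs of a separator
  and a union of large components depends on \<open>F\<close> alone, so the union bound over the
  sprinkling applies. Every separation after sprinkling makes one index fail.\<close>

lemma second_round:
  fixes \<theta> w \<beta> p :: real and C d \<sigma> m a k :: nat and F :: "nat set set set"
  defines "\<delta> \<equiv> real \<sigma> + real (C * d) * (5 * ln (real d) * real \<sigma> + real d * (2 ^ d / real d ^ 4))"
  assumes F: "F \<subseteq> cube_edges d" and ty: "typical \<theta> C d F" and \<theta>: "\<theta> > 0" and d: "d > 0" and C: "C > 0"
    and a: "real a + \<delta> + \<theta> / 32 * 2 ^ d \<le> real m" "2 * a \<le> 2 ^ d"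
    and w: "0 \<le> w" "w \<le> real a - real d * (2 ^ d / real d ^ 2 + 2 * \<delta> / \<theta>) - 2 * real d * real \<sigma>"
    and p: "0 \<le> p" "p \<le> 1" and k: "real k \<le> \<theta> / 32 * real d" and q: "q = 1 - (1 - p) ^ k"
    and \<beta>: "0 < \<beta>" "\<beta> \<le> 1"
  shows "triple_prob (cube_edges d) p
      (\<lambda>F1 F2 F3. \<exists>R S W. separated d (F \<union> F1 \<union> F2 \<union> F3) (big_verts d F (C * d)) \<sigma> m R S W)
    \<le> exp (real \<sigma> * ln (1 / \<beta>) + \<beta> * 2 ^ d) * 2 powr (2 ^ d / (real C * real d))
      * (exp (- (q * w / (8 * real d))) + exp (- (q\<^sup>2 * w / (32 * real d))) + exp (- (p * (q\<^sup>2 * w / 32))))"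
proof -
  let ?N = "exp (real \<sigma> * ln (1 / \<beta>) + \<beta> * 2 ^ d) * 2 powr (2 ^ d / (real C * real d))"
  let ?V = "cube_verts d" and ?K = "C * d" and ?\<tau> = "\<theta> / 32 * real d"
  let ?b = "exp (- (q * w / (8 * real d))) + exp (- (q\<^sup>2 * w / (32 * real d))) + exp (- (p * (q\<^sup>2 * w / 32)))"
  define U' where "U' S = big_parts (?V - S) F ?K" for S
  define \<C> where "\<C> S = components_of (?V - S) F (U' S)" for S
  define \<S> where "\<S> = {S. S \<subseteq> ?V \<and> card S \<le> \<sigma>}"
  define \<I> where "\<I> = (SIGMA S:\<S>. \<Union> ` Pow (\<C> S))"
  \<comment> \<open>Only indices with enough cross pairs admit the exponential bound; those arising
    from separations are among them.\<close>
  define \<J> where "\<J> = {(S, X) \<in> \<I>. w \<le> real (card (cross_pairs d ?\<tau> S X (U' S - X)))}"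
  have fin\<S>: "finite \<S>" by (simp add: \<S>_def)
  have fin\<C>: "finite (\<C> S)" for S
    by (simp add: \<C>_def components_of_def U'_def big_parts_def)
  have fin\<I>: "finite \<I>" using fin\<S> fin\<C> by (auto simp: \<I>_def)
  have U'sub: "U' S \<subseteq> ?V" for S by (auto simp: U'_def big_parts_def)
  have Xsub: "X \<subseteq> ?V" if "(S, X) \<in> \<I>" for S X
  proof -
    have "Y \<subseteq> ?V" if "Y \<in> \<C> S" for Y
      using that reach_subset[of "{_}" "?V - S" F]
      by (fastforce simp: \<C>_def components_of_def U'_def big_parts_def)
    then show ?thesis using that by (auto simp: \<I>_def)
  qed
  have card\<I>: "real (card \<I>) \<le> ?N"
  proof -
    have each: "real (card (\<Union> ` Pow (\<C> S))) \<le> 2 powr (2 ^ d / (real C * real d))" for S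
    proof -
      have "?K * card (\<C> S) \<le> card (?V - S)"
        unfolding \<C>_def U'_def by (intro card_big_components) simp
      also have "\<dots> \<le> card ?V" by (intro card_mono) auto
      finally have "?K * card (\<C> S) \<le> 2 ^ d" by simp
      then have "real (?K * card (\<C> S)) \<le> 2 ^ d" by (metis of_nat_le_iff of_nat_numeral of_nat_power)
      then have "real (card (\<C> S)) \<le> 2 ^ d / (real C * real d)" using C d by (simp add: field_simps)
      moreover have "card (\<Union> ` Pow (\<C> S)) \<le> 2 ^ card (\<C> S)"
        using card_image_le[of "Pow (\<C> S)" \<Union>] fin\<C> by (simp add: card_Pow)
      then have "real (card (\<Union> ` Pow (\<C> S))) \<le> 2 powr real (card (\<C> S))"
        by (simp add: powr_realpow)
      ultimately show ?thesis by (meson order_trans powr_mono one_le_numeral)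
    qed
    have "real (card \<I>) = (\<Sum>S\<in>\<S>. real (card (\<Union> ` Pow (\<C> S))))"
      unfolding \<I>_def using fin\<S> fin\<C> by (simp add: card_SigmaI)
    also have "\<dots> \<le> (\<Sum>S\<in>\<S>. 2 powr (2 ^ d / (real C * real d)))" by (intro sum_mono each)
    also have "\<dots> = real (card \<S>) * 2 powr (2 ^ d / (real C * real d))" by simp
    also have "\<dots> \<le> ?N"
      using card_small_subsets[OF finite_cube_verts \<beta>, of d \<sigma>] by (intro mult_right_mono) (auto simp: \<S>_def)
    finally show ?thesis .
  qed
  have "triple_prob (cube_edges d) p
      (\<lambda>F1 F2 F3. \<exists>R S W. separated d (F \<union> F1 \<union> F2 \<union> F3) (big_verts d F (C * d)) \<sigma> m R S W) \<le> real (card \<J>) * ?b"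
  proof (rule triple_prob_union_bound[OF p, where Q = "\<lambda>(S, X). sprinkle_fails d ?\<tau> S X (U' S - X)"])
    show "finite \<J>" by (rule finite_subset[OF _ fin\<I>]) (auto simp: \<J>_def)
  next
    fix i assume i: "i \<in> \<J>"
    obtain S X where SX: "i = (S, X)" by (cases i)
    have mem: "(S, X) \<in> \<I>" and wc: "w \<le> real (card (cross_pairs d ?\<tau> S X (U' S - X)))"
      using i SX by (auto simp: \<J>_def)
    have "U' S - X \<subseteq> ?V" using U'sub by blast
    from sprinkle_fails_prob[OF Xsub[OF mem] this p d wc k q w(1)]
    show "triple_prob (cube_edges d) p (case i of (S, X) \<Rightarrow> sprinkle_fails d ?\<tau> S X (U' S - X)) \<le> ?b"
      by (simp add: SX)
  next
    fix F1 F2 F3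
    assume "\<exists>R S W. separated d (F \<union> F1 \<union> F2 \<union> F3) (big_verts d F (C * d)) \<sigma> m R S W"
    then obtain R S W where part: "R \<union> S \<union> W = ?V" "R \<inter> S = {}" "R \<inter> W = {}" "S \<inter> W = {}"
      and no: "\<And>x y. x \<in> R \<Longrightarrow> y \<in> W \<Longrightarrow> {x, y} \<notin> F \<union> F1 \<union> F2 \<union> F3" and S: "card S \<le> \<sigma>"
      and m: "m \<le> card (big_verts d F ?K \<inter> R)" "m \<le> card (big_verts d F ?K \<inter> W)"
      unfolding separated_def by blast
    define X where "X = U' S \<inter> R"
    have VS: "?V - S = R \<union> W" using part by blast
    have UW: "U' S - X = U' S \<inter> W"
    proof -
      have "U' S \<subseteq> R \<union> W" unfolding VS[symmetric] by (auto simp: U'_def big_parts_def)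
      then show ?thesis using part(3) by (auto simp: X_def)
    qed
    have "X \<in> \<Union> ` Pow (\<C> S)"
      unfolding X_def \<C>_def U'_def using VS part(3) no by (intro big_parts_side) auto
    moreover have "S \<in> \<S>" using S part by (auto simp: \<S>_def)
    ultimately have mem: "(S, X) \<in> \<I>" by (simp add: \<I>_def)
    have "real a \<le> real (card (cross_pairs d ?\<tau> S (U' S \<inter> R) (U' S \<inter> W)))
           + real d * (2 ^ d / real d ^ 2 + 2 * \<delta> / \<theta>) + 2 * real d * real \<sigma>"
      unfolding U'_def \<delta>_def
      by (rule separation_pairs[OF F ty \<theta> d part S m]) (use a in \<open>simp_all add: \<delta>_def\<close>)
    then have "w \<le> real (card (cross_pairs d ?\<tau> S X (U' S - X)))"
      unfolding UW using w by (simp add: X_def)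
    then have J: "(S, X) \<in> \<J>" using mem by (simp add: \<J>_def)
    \<comment> \<open>A successful triple would cross the separation: its attachment to
      \<open>X\<close> puts \<open>x\<close> into \<open>R\<close>, that of \<open>y\<close> puts
      \<open>y\<close> into \<open>W\<close>, and \<open>xy\<close> would be an edge between
      them.\<close>
    have "sprinkle_fails d ?\<tau> S X (U' S - X) F1 F2 F3"
      unfolding sprinkle_fails_def
    proof (intro ballI, clarify)
      fix x y u v
      assume xy: "(x, y) \<in> cross_pairs d ?\<tau> S X (U' S - X)"
        and u: "u \<in> X" "{x, u} \<in> F1" and v: "v \<in> U' S" "v \<notin> X" "{y, v} \<in> F2" and e: "{x, y} \<in> F3"
      have "x \<in> ?V - S" "y \<in> ?V - S" using xy rich_verts_subset by (auto simp: cross_pairs_def)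
      then have "x \<in> R \<union> W" "y \<in> R \<union> W" using VS by auto
      moreover have "x \<notin> W" using no[of u x] u by (auto simp: X_def insert_commute)
      moreover have "v \<in> W" using v UW by blast
      then have "y \<notin> R" using no[of y v] v by auto
      ultimately show False using no[of x y] e by auto
    qed
    then show "\<exists>i\<in>\<J>. (case i of (S, X) \<Rightarrow> sprinkle_fails d ?\<tau> S X (U' S - X)) F1 F2 F3"
      using J by (intro bexI[of _ "(S, X)"]) auto
  qed
  also have "\<dots> \<le> real (card \<I>) * ?b"
    using fin\<I> by (intro mult_right_mono) (auto simp: \<J>_def intro!: card_mono add_nonneg_nonneg)
  also have "\<dots> \<le> ?N * ?b"
    using card\<I> by (intro mult_right_mono) (auto intro!: add_nonneg_nonneg)
  finally show ?thesis .
qed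

lemma separated_of_no_minor:
  fixes l \<sigma> m t d :: nat
  assumes "\<not> has_K_minor (cube_verts d) G t"
    and U: "U \<subseteq> cube_verts d" "3 * m + 3 * \<sigma> \<le> card U" and m: "m > 0" and l: "l > 0"
    and size: "2 ^ d + l * (t * (t * (2 * (l * (d + 1)) + 1))) \<le> l * \<sigma>"
  shows "\<exists>R S W. separated d G U \<sigma> m R S W"
proof (rule ccontr)
  assume no: "\<nexists>R S W. separated d G U \<sigma> m R S W"
  have "has_K_minor (cube_verts d) G t"
  proof (rule complete_minor_of_no_sparse_separator[OF _ U(1) _ U(2) m l])
    show "card (U \<inter> R) < m \<or> card (U \<inter> W) < m"
      if "R \<union> S \<union> W = cube_verts d" "R \<inter> S = {}" "R \<inter> W = {}" "S \<inter> W = {}"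
        "\<forall>x\<in>R. \<forall>y\<in>W. {x, y} \<notin> G" "card S \<le> \<sigma>" for R S W
      using no that unfolding separated_def by (meson not_le)
    \<comment> \<open>By Bernoulli every \<open>l\<close> layers double a thickly growing ball, so
      radius \<open>l * (d + 1)\<close> is enough to exceed the whole cube.\<close>
    have "1 + real l * (1 / real l) \<le> (1 + 1 / real l) ^ l"
      by (rule Bernoulli_inequality) (rule order_trans[of _ 0]; simp)
    then have "2 \<le> (1 + 1 / real l) ^ l" using l by simp
    then have "(2::real) ^ (d + 1) \<le> ((1 + 1 / real l) ^ l) ^ (d + 1)" by (intro power_mono) auto
    also have "\<dots> = (1 + 1 / real l) ^ (l * (d + 1))" by (simp only: power_mult)
    finally have "(2::real) ^ (d + 1) \<le> (1 + 1 / real l) ^ (l * (d + 1))" .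
    moreover have "real (card (cube_verts d)) < 2 ^ (d + 1)" by simp
    ultimately show "real (card (cube_verts d)) < (1 + 1 / real l) ^ (l * (d + 1))" by linarith
  qed (use size in simp_all)
  then show False using assms(1) by blast
qed

lemma cube_prob_eq: "cube_prob d p P = rand_prob (cube_edges d) p P"
proof -
  have "rand_prob (cube_edges d) p P = (\<Sum>F\<in>Pow (cube_edges d). if P F then p ^ card F * (1 - p) ^ (card (cube_edges d) - card F) else 0)"
    unfolding rand_prob_def rand_exp_def by (intro sum.cong) auto
  also have "\<dots> = cube_prob d p P"
    unfolding cube_prob_def by (subst sum.inter_filter[symmetric]) (auto intro: sum.cong)
  finally show ?thesis ..
qed

section \<open>Asymptotics\<close>

lemma first_round_probability:
  fixes p p2 :: real
  assumes "0 \<le> p2" "p2 < 1" "3 * p2 \<le> p" "p \<le> 1"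
  shows "p - 3 * p2 \<le> 1 - (1 - p) / (1 - p2) ^ 3" "1 - (1 - p) / (1 - p2) ^ 3 \<le> p"
proof -
  have pos: "0 < (1 - p2) ^ 3" using assms by simp
  have "1 + real 3 * (- p2) \<le> (1 + - p2) ^ 3" using assms by (intro Bernoulli_inequality) auto
  then have B: "1 - 3 * p2 \<le> (1 - p2) ^ 3" by simp
  \<comment> \<open>The two sides differ by \<open>3 * p2 * (p - 3 * p2)\<close>.\<close>
  have "1 - p \<le> (1 - p + 3 * p2) * (1 - 3 * p2)"
    using mult_left_mono[OF assms(3), of p2] assms(1) by (simp add: algebra_simps power2_eq_square)
  also have "\<dots> \<le> (1 - p + 3 * p2) * (1 - p2) ^ 3" using B assms by (intro mult_left_mono) auto
  finally have "(1 - p) / (1 - p2) ^ 3 \<le> 1 - p + 3 * p2" using pos by (simp add: divide_le_eq)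
  then show "p - 3 * p2 \<le> 1 - (1 - p) / (1 - p2) ^ 3" by simp
  have "(1 - p2) ^ 3 \<le> 1" using assms by (intro power_le_one) auto
  then have "(1 - p) * (1 - p2) ^ 3 \<le> 1 - p" using assms by (intro mult_left_le) auto
  then have "1 - p \<le> (1 - p) / (1 - p2) ^ 3" using pos by (simp add: le_divide_eq)
  then show "1 - (1 - p) / (1 - p2) ^ 3 \<le> p" by simp
qed

lemma second_round_asymp:
  fixes \<theta> e :: real
  assumes \<theta>: "\<theta> > 0" "\<theta> \<le> 1" and e: "e > 0"
  obtains C :: nat and g :: "nat \<Rightarrow> real" where "g \<longlonglongrightarrow> 0"
    "\<forall>\<^sub>F d in sequentially. \<forall>F. F \<subseteq> cube_edges d \<longrightarrow> typical \<theta> C d F \<longrightarrow>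
       triple_prob (cube_edges d) (e / real d) (\<lambda>F1 F2 F3.
         \<not> has_K_minor (cube_verts d) (F \<union> F1 \<union> F2 \<union> F3)
           (nat \<lceil>2 powr (real d / 2) / (real d ^ 3 * ln (real d) ^ 3)\<rceil>)) \<le> g d"
proof -
  \<comment> \<open>A rich vertex has about \<open>\<theta> / 32 * d\<close> trials of probability
    \<open>e / d\<close>; half of the product \<open>e * \<theta> / 32\<close> absorbs
    rounding.\<close>
  define q0 where "q0 = 1 - exp (- (e * \<theta> / 64))"
  have q0: "0 < q0" "q0 < 1" using e \<theta> by (simp_all add: q0_def)
  \<comment> \<open>A common rate, in units of 2^d / d, for the three failure terms with
    \<open>w = \<theta> / 128 * 2 ^ d\<close>; the factor \<open>min 1 e\<close> covers the term
    that contains the edge probability.\<close>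
  define \<kappa> where "\<kappa> = q0\<^sup>2 * (\<theta> / 128) / 32 * min 1 e"
  have \<kappa>: "\<kappa> > 0" using q0 \<theta> e by (simp add: \<kappa>_def)
  \<comment> \<open>With this \<open>C\<close> the number of bipartitions uses at most a quarter of
    the rate \<kappa>. The choices of \<open>S\<close> use another quarter, and half is left for
    \<open>g\<close>.\<close>
  define C where "C = nat \<lceil>4 / \<kappa>\<rceil>"
  have C: "4 / \<kappa> \<le> real C" "C > 0" using \<kappa> by (auto simp: C_def)
  define c where "c = real C"
  have c: "c > 0" using C by (simp add: c_def)
  \<comment> \<open>Here \<open>s\<close>, \<open>y\<close> and \<open>x\<close> are the real
    versions of \<sigma>, \<open>l\<close> and \<open>t\<close>. The product
    \<open>y d * s d\<close> is twice 2^d: one half pays for \<open>card V\<close>, and the branch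
    sets need only order 2^d / (d ln^2 d) of the other.\<close>
  define s where "s d = 2 ^ d / (2 * real d ^ 2 * ln (real d) ^ 2)" for d :: nat
  define \<delta> where "\<delta> d = s d + c * real d * (5 * ln (real d) * s d + real d * (2 ^ d / real d ^ 4))" for d :: nat
  define x where "x d = 2 powr (real d / 2) / (real d ^ 3 * ln (real d) ^ 3)" for d :: nat
  define y where "y d = 4 * real d ^ 2 * ln (real d) ^ 2" for d :: nat
  define g where "g d = 3 * exp (- (\<kappa> * 2 ^ d / (2 * real d)))" for d :: nat
  have ev:
    "\<forall>\<^sub>F d in sequentially. \<theta> / 64 * 2 ^ d + \<delta> d + \<theta> / 32 * 2 ^ d \<le> \<theta> / 16 * 2 ^ d"
    "\<forall>\<^sub>F d in sequentially. \<theta> / 128 * 2 ^ d \<le> \<theta> / 64 * 2 ^ d - 1 - real d * (2 ^ d / real d ^ 2 + 2 * \<delta> d / \<theta>) - 2 * real d * s d"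
    "\<forall>\<^sub>F d in sequentially. s d * ln (real d ^ 3) + 1 / real d ^ 3 * 2 ^ d \<le> \<kappa> * 2 ^ d / (4 * real d)"
    "\<forall>\<^sub>F d in sequentially. 3 * (\<theta> / 16 * 2 ^ d + 1) + 3 * s d \<le> \<theta> * (2 ^ d - 2 ^ d / real d ^ 2)"
    "\<forall>\<^sub>F d in sequentially. 2 ^ d + (y d + 1) * ((x d + 1) * ((x d + 1) * (2 * ((y d + 1) * (real d + 1)) + 1))) \<le> y d * (s d - 1)"
    "\<forall>\<^sub>F d in sequentially. e * \<theta> / 64 \<le> e / real d * (\<theta> / 32 * real d - 1)"
    "\<forall>\<^sub>F d in sequentially. e / real d \<le> 1"
    "\<forall>\<^sub>F d in sequentially. 1 \<le> y d"
    "\<forall>\<^sub>F d in sequentially. 1 \<le> \<theta> / 64 * 2 ^ d"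
    unfolding \<delta>_def s_def x_def y_def using \<theta> e c \<kappa> by real_asymp+
  have "g \<longlonglongrightarrow> 0" unfolding g_def using \<kappa> by real_asymp
  moreover have "\<forall>\<^sub>F d in sequentially. \<forall>F. F \<subseteq> cube_edges d \<longrightarrow> typical \<theta> C d F \<longrightarrow>
       triple_prob (cube_edges d) (e / real d) (\<lambda>F1 F2 F3.
         \<not> has_K_minor (cube_verts d) (F \<union> F1 \<union> F2 \<union> F3) (nat \<lceil>x d\<rceil>)) \<le> g d"
    using ev eventually_gt_at_top[of 1]
  proof eventually_elim
    case (elim d)
    \<comment> \<open>Each side is asked for a share \<open>\<theta> / 16\<close> of the cube.
      Passing to rich vertices costs \<open>\<theta> / 32\<close>, \<open>a\<close> takes
      \<open>\<theta> / 64\<close> and the lower-order \<delta> fits into the rest; half of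
      \<open>a\<close> survives as \<open>w\<close>. Three such shares still fit into the share
      \<theta> occupied by \<open>U\<close>.\<close>
    define \<sigma> m a k l t where "\<sigma> = nat \<lfloor>s d\<rfloor>" and "m = nat \<lceil>\<theta> / 16 * 2 ^ d\<rceil>"
      and "a = nat \<lfloor>\<theta> / 64 * 2 ^ d\<rfloor>" and "k = nat \<lfloor>\<theta> / 32 * real d\<rfloor>"
      and "l = nat \<lceil>y d\<rceil>" and "t = nat \<lceil>x d\<rceil>"
    have d: "d > 0" "real d > 1" "0 < ln (real d)" using elim(10) by simp_all
    have s0: "0 \<le> s d" "0 \<le> x d" "0 \<le> y d" using d by (simp_all add: s_def x_def y_def)
    have \<theta>0: "0 \<le> \<theta> / 16 * 2 ^ d" "0 \<le> \<theta> / 64 * 2 ^ d" "0 \<le> \<theta> / 32 * real d" using \<theta> by simp_all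
    have \<sigma>: "real \<sigma> \<le> s d" "s d - 1 \<le> real \<sigma>" using s0 unfolding \<sigma>_def by linarith+
    have m: "\<theta> / 16 * 2 ^ d \<le> real m" "real m \<le> \<theta> / 16 * 2 ^ d + 1" using \<theta>0 unfolding m_def by linarith+
    have a: "real a \<le> \<theta> / 64 * 2 ^ d" "\<theta> / 64 * 2 ^ d - 1 \<le> real a" using \<theta>0 unfolding a_def by linarith+
    have k: "real k \<le> \<theta> / 32 * real d" "\<theta> / 32 * real d - 1 \<le> real k" using \<theta>0 unfolding k_def by linarith+
    have l: "y d \<le> real l" "real l \<le> y d + 1" using s0 unfolding l_def by linarith+
    have t: "real t \<le> x d + 1" using s0 unfolding t_def by linarith
    have p: "0 \<le> e / real d" "e / real d \<le> 1" using e elim by auto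
    define q where "q = 1 - (1 - e / real d) ^ k"
    have q: "q0 \<le> q"
    proof -
      have "e * \<theta> / 64 \<le> e / real d * real k"
        using elim(6) mult_left_mono[OF k(2) p(1)] by linarith
      then have "exp (- (e / real d * real k)) \<le> exp (- (e * \<theta> / 64))" by simp
      then have "(1 - e / real d) ^ k \<le> exp (- (e * \<theta> / 64))"
        using one_minus_power_le_exp[OF p, of k] by (rule order_trans[rotated])
      then show ?thesis by (simp add: q_def q0_def)
    qed
    define w where "w = \<theta> / 128 * 2 ^ d"
    have w0: "0 \<le> w" using \<theta> by (simp add: w_def)
    define \<delta>' where "\<delta>' = real \<sigma> + real (C * d) * (5 * ln (real d) * real \<sigma> + real d * (2 ^ d / real d ^ 4))"
    have \<delta>': "\<delta>' \<le> \<delta> d"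
    proof -
      have "5 * ln (real d) * real \<sigma> \<le> 5 * ln (real d) * s d" using \<sigma> d by (intro mult_left_mono) auto
      then have "5 * ln (real d) * real \<sigma> + real d * (2 ^ d / real d ^ 4)
          \<le> 5 * ln (real d) * s d + real d * (2 ^ d / real d ^ 4)" by (rule add_right_mono)
      then have "c * real d * (5 * ln (real d) * real \<sigma> + real d * (2 ^ d / real d ^ 4))
          \<le> c * real d * (5 * ln (real d) * s d + real d * (2 ^ d / real d ^ 4))"
        by (rule mult_left_mono) (use c in simp)
      then show ?thesis using \<sigma> by (simp add: \<delta>'_def \<delta>_def c_def)
    qed
    show ?case
    proof (intro allI impI)
      fix F assume F: "F \<subseteq> cube_edges d" and ty: "typical \<theta> C d F"
      have lm: "l > 0" "m > 0"
        using l m elim(8,9) \<theta> by (auto intro!: gr0I)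
      have "3 * real m + 3 * real \<sigma> \<le> 3 * (\<theta> / 16 * 2 ^ d + 1) + 3 * s d"
        by (intro add_mono mult_left_mono m \<sigma>) auto
      also note elim(4)
      also note card_big_verts_typical[OF ty \<theta>(1) d(1)]
      finally have "3 * real m + 3 * real \<sigma> \<le> real (card (big_verts d F (C * d)))" .
      then have U: "3 * m + 3 * \<sigma> \<le> card (big_verts d F (C * d))" by linarith
      have size: "2 ^ d + l * (t * (t * (2 * (l * (d + 1)) + 1))) \<le> l * \<sigma>"
      proof -
        have "real l * (real t * (real t * (2 * (real l * (real d + 1)) + 1)))
            \<le> (y d + 1) * ((x d + 1) * ((x d + 1) * (2 * ((y d + 1) * (real d + 1)) + 1)))"
          using l t s0 by (intro mult_mono add_mono) auto
        moreover have "y d * (s d - 1) \<le> real l * real \<sigma>"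
        proof (cases "s d - 1 \<le> 0")
          case True
          then have "y d * (s d - 1) \<le> 0" using s0 by (simp add: mult_nonneg_nonpos)
          then show ?thesis by (meson mult_nonneg_nonneg of_nat_0_le_iff order_trans)
        next
          case False
          then show ?thesis using l \<sigma> s0 by (intro mult_mono) auto
        qed
        ultimately have "2 ^ d + real l * (real t * (real t * (2 * (real l * (real d + 1)) + 1))) \<le> real l * real \<sigma>"
          using elim(5) by linarith
        then have "real (2 ^ d + l * (t * (t * (2 * (l * (d + 1)) + 1)))) \<le> real (l * \<sigma>)"
          by (simp only: of_nat_add of_nat_mult of_nat_power of_nat_numeral of_nat_1)
        then show ?thesis by (simp only: of_nat_le_iff)
      qed
      have "triple_prob (cube_edges d) (e / real d) (\<lambda>F1 F2 F3. \<not> has_K_minor (cube_verts d) (F \<union> F1 \<union> F2 \<union> F3) t)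
        \<le> triple_prob (cube_edges d) (e / real d)
          (\<lambda>F1 F2 F3. \<exists>R S W. separated d (F \<union> F1 \<union> F2 \<union> F3) (big_verts d F (C * d)) \<sigma> m R S W)"
        by (intro triple_prob_mono p separated_of_no_minor[OF _ _ U lm(2,1) size]) (auto simp: big_verts_def)
      also have "\<dots> \<le> exp (real \<sigma> * ln (1 / (1 / real d ^ 3)) + 1 / real d ^ 3 * 2 ^ d) * 2 powr (2 ^ d / (real C * real d))
        * (exp (- (q * w / (8 * real d))) + exp (- (q\<^sup>2 * w / (32 * real d))) + exp (- (e / real d * (q\<^sup>2 * w / 32))))"
      proof (rule second_round[where \<sigma> = \<sigma>, OF F ty \<theta>(1) d(1) C(2) _ _ w0 _ p k(1) q_def, folded \<delta>'_def])
        show "real a + \<delta>' + \<theta> / 32 * 2 ^ d \<le> real m" using elim(1) \<delta>' a m by linarith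
        have "2 * real a \<le> 2 ^ d"
        proof -
          have "\<theta> / 64 * 2 ^ d \<le> 1 / 2 * 2 ^ d" using \<theta> by (intro mult_right_mono) auto
          then show ?thesis using a by linarith
        qed
        then have "real (2 * a) \<le> real (2 ^ d)" by simp
        then show "2 * a \<le> 2 ^ d" by (simp only: of_nat_le_iff)
        have "real d * (2 ^ d / real d ^ 2 + 2 * \<delta>' / \<theta>) \<le> real d * (2 ^ d / real d ^ 2 + 2 * \<delta> d / \<theta>)"
          using \<delta>' \<theta> by (intro mult_left_mono add_left_mono divide_right_mono) auto
        moreover have "2 * real d * real \<sigma> \<le> 2 * real d * s d" using \<sigma> by (intro mult_left_mono) auto
        ultimately show "w \<le> real a - real d * (2 ^ d / real d ^ 2 + 2 * \<delta>' / \<theta>) - 2 * real d * real \<sigma>"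
          using elim(2) a unfolding w_def by linarith
        show "1 / real d ^ 3 \<le> 1" using d by (simp add: divide_le_eq)
      qed (use d in simp)
      also have "\<dots> \<le> exp (\<kappa> * 2 ^ d / (4 * real d)) * exp (\<kappa> * 2 ^ d / (4 * real d)) * (3 * exp (- (\<kappa> * 2 ^ d / real d)))"
      proof (intro mult_mono)
        have "real \<sigma> * ln (real d ^ 3) \<le> s d * ln (real d ^ 3)"
          using \<sigma> d by (intro mult_right_mono) auto
        then show "exp (real \<sigma> * ln (1 / (1 / real d ^ 3)) + 1 / real d ^ 3 * 2 ^ d) \<le> exp (\<kappa> * 2 ^ d / (4 * real d))"
          using elim(3) by simp
        have "2 ^ d / (real C * real d) * ln 2 \<le> \<kappa> * 2 ^ d / (4 * real d)"
        proof -
          have "1 / real C \<le> \<kappa> / 4" using C \<kappa> by (simp add: field_simps)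
          then have "1 / real C * (2 ^ d / real d) \<le> \<kappa> / 4 * (2 ^ d / real d)" by (intro mult_right_mono) auto
          moreover have "2 ^ d / (real C * real d) * ln 2 \<le> 2 ^ d / (real C * real d) * 1"
            using ln_2_less_1 by (intro mult_left_mono) auto
          ultimately show ?thesis by simp
        qed
        then show "2 powr (2 ^ d / (real C * real d)) \<le> exp (\<kappa> * 2 ^ d / (4 * real d))"
          by (simp add: powr_def)
        have \<kappa>w: "\<kappa> * 2 ^ d = q0\<^sup>2 * w / 32 * min 1 e" by (simp add: \<kappa>_def w_def)
        let ?z = "exp (- (\<kappa> * 2 ^ d / real d))"
        have qq: "q0\<^sup>2 * w \<le> q\<^sup>2 * w" "q0\<^sup>2 * w \<le> q * w"
        proof -
          show "q0\<^sup>2 * w \<le> q\<^sup>2 * w" using q q0 w0 by (intro mult_right_mono power_mono) auto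
          have "q0\<^sup>2 \<le> q0" using q0 by (simp add: power2_eq_square mult_left_le)
          then show "q0\<^sup>2 * w \<le> q * w" using q w0 by (intro mult_right_mono) auto
        qed
        have nn: "0 \<le> q0\<^sup>2 * w / 32" using w0 by simp
        have 1: "\<kappa> * 2 ^ d \<le> q0\<^sup>2 * w / 32" "\<kappa> * 2 ^ d \<le> q0\<^sup>2 * w / 32 * e"
          unfolding \<kappa>w using nn e by (auto intro: mult_left_le mult_left_mono)
        have "q0\<^sup>2 * w / 32 \<le> q * w / 8" using qq(2) w0 nn by linarith
        then have "\<kappa> * 2 ^ d \<le> q * w / 8" "\<kappa> * 2 ^ d \<le> q\<^sup>2 * w / 32" using 1 qq by linarith+
        then have 2: "\<kappa> * 2 ^ d / real d \<le> q * w / 8 / real d" "\<kappa> * 2 ^ d / real d \<le> q\<^sup>2 * w / 32 / real d"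
          using d by (intro divide_right_mono; simp)+
        have "q0\<^sup>2 * w / 32 * e \<le> q\<^sup>2 * w / 32 * e"
          by (rule mult_right_mono[OF divide_right_mono[OF qq(1)]]) (use e in auto)
        then have 3: "\<kappa> * 2 ^ d / real d \<le> q\<^sup>2 * w / 32 * e / real d"
          using 1 d by (intro divide_right_mono) auto
        show "exp (- (q * w / (8 * real d))) + exp (- (q\<^sup>2 * w / (32 * real d))) + exp (- (e / real d * (q\<^sup>2 * w / 32)))
            \<le> 3 * ?z"
        proof -
          have "exp (- (q * w / (8 * real d))) \<le> ?z" using 2(1) by simp
          moreover have "exp (- (q\<^sup>2 * w / (32 * real d))) \<le> ?z" using 2(2) by simp
          moreover have "exp (- (e / real d * (q\<^sup>2 * w / 32))) \<le> ?z"
            using 3 by (simp add: mult.commute)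
          ultimately show ?thesis by linarith
        qed
      qed (auto intro!: add_nonneg_nonneg)
      also have "\<dots> = g d"
        by (simp add: g_def exp_add[symmetric] mult.commute[of _ 3] mult.left_commute[of _ 3])
      finally show "triple_prob (cube_edges d) (e / real d) (\<lambda>F1 F2 F3.
         \<not> has_K_minor (cube_verts d) (F \<union> F1 \<union> F2 \<union> F3) (nat \<lceil>x d\<rceil>)) \<le> g d"
        by (simp add: t_def)
    qed
  qed
  ultimately show ?thesis using that unfolding x_def by blast
qed

theorem theorem1p3:
  fixes \<epsilon> :: real
  assumes "\<epsilon> > 0"
  shows "\<exists>c>0. (\<lambda>d::nat. cube_prob d ((1 + \<epsilon>) / real d)
            (\<lambda>F. \<exists>t::nat. real t \<ge> c * 2 powr (real d / 2) / (real d ^ 3 * (ln (real d)) ^ 3)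
                          \<and> has_K_minor (cube_verts d) F t))
          \<longlonglongrightarrow> 1"
proof (intro exI[of _ 1] conjI)
  \<comment> \<open>The constant 1 works because the condition on \<open>t\<close> leaves a factor
    of order d ln^2 d to spare in the square of \<open>t\<close>.\<close>
  let ?P = "\<lambda>d F. \<exists>t::nat. real t \<ge> 1 * 2 powr (real d / 2) / (real d ^ 3 * (ln (real d)) ^ 3)
                          \<and> has_K_minor (cube_verts d) F t"
  define p where "p d = (1 + \<epsilon>) / real d" for d
  define p2 where "p2 d = \<epsilon> / 6 / real d" for d
  \<comment> \<open>Solves \<open>1 - p d = (1 - p1 d) * (1 - p2 d) ^ 3\<close>, so the four rounds
    compose exactly to \<open>p d\<close>. The sprinkling uses at most \<epsilon> / 2 of the mean
    degree.\<close>
  define p1 where "p1 d = 1 - (1 - p d) / (1 - p2 d) ^ 3" for d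
  have probs: "\<forall>\<^sub>F d in sequentially. 0 \<le> p2 d \<and> p2 d < 1 \<and> 3 * p2 d \<le> p d \<and> 0 \<le> p d \<and> p d \<le> 1 \<and>
      p d * real d = 1 + \<epsilon> \<and> p2 d * real d = \<epsilon> / 6"
  proof -
    have "\<forall>\<^sub>F d in sequentially. p2 d < 1" "\<forall>\<^sub>F d in sequentially. p d \<le> 1"
      unfolding p_def p2_def using assms by real_asymp+
    then show ?thesis
      using eventually_gt_at_top[of 0]
    proof eventually_elim
      case (elim d)
      have "3 * p2 d \<le> p d" unfolding p_def p2_def using assms elim by (simp add: field_simps)
      then show ?case using elim assms by (auto simp: p_def p2_def)
    qed
  qed
  have p1: "\<forall>\<^sub>F d in sequentially. 0 \<le> p1 d \<and> p1 d \<le> 1 \<and> 1 + \<epsilon> / 2 \<le> p1 d * real d \<and> p1 d * real d \<le> 1 + \<epsilon>"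
    using probs
  proof eventually_elim
    case (elim d)
    note b = first_round_probability[of "p2 d" "p d", folded p1_def]
    have "p d - 3 * p2 d \<le> p1 d" "p1 d \<le> p d" using b elim by auto
    moreover from this have "(p d - 3 * p2 d) * real d \<le> p1 d * real d" "p1 d * real d \<le> p d * real d"
      by (intro mult_right_mono; simp)+
    ultimately show ?case using elim by (simp add: left_diff_distrib)
  qed
  obtain \<theta> where \<theta>: "\<theta> > 0" "\<theta> \<le> 1"
    and ty: "\<And>C. (\<lambda>d. rand_prob (cube_edges d) (p1 d) (\<lambda>F. \<not> typical \<theta> C d F)) \<longlonglongrightarrow> 0"
    using first_round_typical[OF _ p1] assms by auto
  obtain C :: nat and g where g: "g \<longlonglongrightarrow> 0"
    and second: "\<forall>\<^sub>F d in sequentially. \<forall>F. F \<subseteq> cube_edges d \<longrightarrow> typical \<theta> C d F \<longrightarrow>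
       triple_prob (cube_edges d) (\<epsilon> / 6 / real d) (\<lambda>F1 F2 F3.
         \<not> has_K_minor (cube_verts d) (F \<union> F1 \<union> F2 \<union> F3)
           (nat \<lceil>2 powr (real d / 2) / (real d ^ 3 * ln (real d) ^ 3)\<rceil>)) \<le> g d"
  proof (rule second_round_asymp[OF \<theta>])
    show "0 < \<epsilon> / 6" using assms by simp
  qed
  \<comment> \<open>The absolute value supplies the nonnegative bound required by
    \<open>rand_exp_le_tail\<close>; of \<open>g\<close> only convergence to 0 is known
    here.\<close>
  have lower: "\<forall>\<^sub>F d in sequentially. 1 - (rand_prob (cube_edges d) (p1 d) (\<lambda>F. \<not> typical \<theta> C d F) + \<bar>g d\<bar>)
      \<le> cube_prob d ((1 + \<epsilon>) / real d) (?P d)"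
    using probs p1 second
  proof eventually_elim
    case (elim d)
    let ?E = "cube_edges d" and ?t = "nat \<lceil>2 powr (real d / 2) / (real d ^ 3 * ln (real d) ^ 3)\<rceil>"
    let ?M = "\<lambda>F F1 F2 F3. \<not> has_K_minor (cube_verts d) (F \<union> F1 \<union> F2 \<union> F3) ?t"
    have "(1 - p2 d) ^ 3 \<noteq> 0" using elim by auto
    then have "1 - p d = (1 - p1 d) * (1 - p2 d) ^ 3" by (simp add: p1_def)
    then have "rand_prob ?E (p d) (\<lambda>F. \<not> has_K_minor (cube_verts d) F ?t)
      = rand_exp ?E (p1 d) (\<lambda>F. triple_prob ?E (p2 d) (?M F))"
      by (intro rand_prob_sprinkle3) auto
    also have "\<dots> \<le> rand_prob ?E (p1 d) (\<lambda>F. \<not> typical \<theta> C d F) + \<bar>g d\<bar>"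
    proof (rule rand_exp_le_tail)
      fix F assume F: "F \<subseteq> ?E"
      show "triple_prob ?E (p2 d) (?M F) \<le> 1"
        using elim by (intro triple_prob_le_1) auto
      assume "\<not> \<not> typical \<theta> C d F"
      then show "triple_prob ?E (p2 d) (?M F) \<le> \<bar>g d\<bar>"
        using elim(3) F unfolding p2_def by (meson abs_ge_self order_trans)
    qed (use elim in auto)
    finally have "1 - (rand_prob ?E (p1 d) (\<lambda>F. \<not> typical \<theta> C d F) + \<bar>g d\<bar>)
        \<le> rand_prob ?E (p d) (\<lambda>F. has_K_minor (cube_verts d) F ?t)"
      using rand_prob_not[of ?E "p d" "\<lambda>F. has_K_minor (cube_verts d) F ?t"] by simp
    also have "\<dots> \<le> rand_prob ?E (p d) (?P d)"
    proof (rule rand_prob_mono)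
      fix F assume "has_K_minor (cube_verts d) F ?t"
      moreover have "1 * 2 powr (real d / 2) / (real d ^ 3 * (ln (real d)) ^ 3) \<le> real ?t" by linarith
      ultimately show "?P d F" by blast
    qed (use elim in auto)
    finally show ?case by (simp add: cube_prob_eq p_def)
  qed
  have upper: "\<forall>\<^sub>F d in sequentially. cube_prob d ((1 + \<epsilon>) / real d) (?P d) \<le> 1"
    using probs
  proof eventually_elim
    case (elim d)
    then show ?case unfolding cube_prob_eq by (intro rand_prob_le_1) (auto simp: p_def)
  qed
  have "(\<lambda>d. 1 - (rand_prob (cube_edges d) (p1 d) (\<lambda>F. \<not> typical \<theta> C d F) + \<bar>g d\<bar>)) \<longlonglongrightarrow> 1 - (0 + \<bar>0\<bar>)"
    by (intro tendsto_intros ty g)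
  then show "(\<lambda>d. cube_prob d ((1 + \<epsilon>) / real d) (?P d)) \<longlonglongrightarrow> 1"
    by (intro tendsto_sandwich[OF lower upper]) auto
qed simp

end
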